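(* Let $\sigma,\tau:\mathbb R_+\to\mathbb R$ satisfy $\sup_{x>0}\int_x^{x+1}\sigma(t)^2\,dt<\infty$ and $\sup_{x>0}\int_x^{x+1}|\tau(t)|\,dt<\infty$, and suppose $$\sigma\in L^1(\mathbb R_+),\qquad \sigma^2-\tau\in L^1(\mathbb R_+).$$ Then for arbitrary $\alpha\in[0,\pi)$, the spectral measure on $(0,\infty)$ is of the form $$\chi_{(0,\infty)}(E)\,d\mu^\alpha(E)=w_\alpha(E)\,dE$$ with $w_\alpha$ continuous on $(0,\infty)$ and strictly positive there. In particular, the spectrum of $H^\alpha$ is purely absolutely continuous on $(0,\infty)$.
   Context: $\mathbb R_+=(0,\infty)$. For $u\in AC_{\mathrm{loc}}(\mathbb R_+)$ put $u^{[1]}:=u'-\sigma u$, let $\mathfrak D:=\{u\in AC_{\mathrm{loc}}(\mathbb R_+): u^{[1]}\in AC_{\mathrm{loc}}(\mathbb R_+)\}$ and, for $u\in\mathfrak D$, $\ell u:=-(u^{[1]})'-\sigma u^{[1]}+(\tau-\sigma^2)u$. The endpoint $0$ is regular, so $u(0),u^{[1]}(0)$ exist as limits whenever $u\in L^2(\mathbb R_+)\cap\mathfrak D$, $\ell u\in L^2(\mathbb R_+)$, or $\ell u=zu$; the endpoint $\infty$ is limit point. $H^\alpha$ is the self-adjoint operator in $L^2(\mathbb R_+)$ given by $H^\alpha u=\ell u$ on $\mathrm{dom}(H^\alpha)=\{u\in L^2(\mathbb R_+): u\in\mathfrak D,\ \ell u\in L^2(\mathbb R_+),\ u(0)\cos\alpha+u^{[1]}(0)\sin\alpha=0\}$.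 For $z\in\mathbb C\setminus\mathbb R$ there is, up to multiples, a unique nontrivial solution $\psi_z\in L^2(\mathbb R_+)$ of $\ell\psi_z=z\psi_z$; set $$m_\alpha(z)=\frac{\cos(\alpha)\psi_z^{[1]}(0)-\sin(\alpha)\psi_z(0)}{\sin(\alpha)\psi_z^{[1]}(0)+\cos(\alpha)\psi_z(0)},$$ a Herglotz function. The spectral measure $\mu^\alpha$ is the Borel measure on $\mathbb R$ with $\mu^\alpha((\lambda_1,\lambda_2])=\lim_{\delta\downarrow0}\lim_{\varepsilon\downarrow0}\frac1\pi\int_{\lambda_1+\delta}^{\lambda_2+\delta}\mathrm{Im}\,m_\alpha(\lambda+i\varepsilon)\,d\lambda$ for $\lambda_1<\lambda_2$; $H^\alpha$ is unitarily equivalent to multiplication by the independent variable in $L^2(\mathbb R,\mu^\alpha)$. Purely absolutely continuous spectrum on an interval $I$ means that the restriction of $\mu^\alpha$ to $I$ is absolutely continuous with respect to Lebesgue measure. *)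

theory Defs
  imports "HOL-Analysis.Analysis"
begin

text \<open>
  Functions on \<open>(0, \<infinity>)\<close> are total functions on the reals whose values outside
  \<open>(0, \<infinity>)\<close> are never inspected.
\<close>

definition abs_cont_on :: "real set \<Rightarrow> (real \<Rightarrow> 'a::real_normed_vector) \<Rightarrow> bool" where
  "abs_cont_on S u \<longleftrightarrow>
     (\<forall>e>0. \<exists>d>0. \<forall>D. D division_of \<Union>D \<and> \<Union>D \<subseteq> S \<and> (\<Sum>K\<in>D. measure lborel K) < d
        \<longrightarrow> (\<Sum>K\<in>D. norm (u (Sup K) - u (Inf K))) < e)"

definition AC_loc :: "(real \<Rightarrow> 'a::real_normed_vector) \<Rightarrow> bool" where
  "AC_loc u \<longleftrightarrow> (\<forall>a b. 0 < a \<longrightarrow> a < b \<longrightarrow> abs_cont_on {a..b} u)"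

definition L2_pos :: "(real \<Rightarrow> complex) \<Rightarrow> bool" where
  "L2_pos u \<longleftrightarrow> set_borel_measurable lebesgue {0<..} u
     \<and> set_integrable lebesgue {0<..} (\<lambda>x. (norm (u x))\<^sup>2)"

text \<open>
  The expression \<open>u' - \<sigma> u\<close> is only determined almost everywhere; saying that it lies in
  \<open>AC\<^sub>l\<^sub>o\<^sub>c\<close> means that it has a (then unique on \<open>(0, \<infinity>)\<close>) locally absolutely continuous
  representative \<open>v\<close>.
\<close>

definition is_quasi_deriv :: "(real \<Rightarrow> real) \<Rightarrow> (real \<Rightarrow> complex) \<Rightarrow> (real \<Rightarrow> complex) \<Rightarrow> bool" where
  "is_quasi_deriv \<sigma> u v \<longleftrightarrow> AC_loc v
     \<and> (AE x in lebesgue. 0 < x \<longrightarrow>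
          u differentiable (at x) \<and> v x = vector_derivative u (at x) - of_real (\<sigma> x) * u x)"

definition quasi_dom :: "(real \<Rightarrow> real) \<Rightarrow> (real \<Rightarrow> complex) set" where
  "quasi_dom \<sigma> = {u. AC_loc u \<and> (\<exists>v. is_quasi_deriv \<sigma> u v)}"

definition quasi_deriv :: "(real \<Rightarrow> real) \<Rightarrow> (real \<Rightarrow> complex) \<Rightarrow> real \<Rightarrow> complex" where
  "quasi_deriv \<sigma> u = (SOME v. is_quasi_deriv \<sigma> u v)"

definition ell :: "(real \<Rightarrow> real) \<Rightarrow> (real \<Rightarrow> real) \<Rightarrow> (real \<Rightarrow> complex) \<Rightarrow> real \<Rightarrow> complex" where
  "ell \<sigma> \<tau> u x =
     - vector_derivative (quasi_deriv \<sigma> u) (at x) - of_real (\<sigma> x) * quasi_deriv \<sigma> u x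
     + of_real (\<tau> x - (\<sigma> x)\<^sup>2) * u x"

definition is_weyl_solution ::
    "(real \<Rightarrow> real) \<Rightarrow> (real \<Rightarrow> real) \<Rightarrow> complex \<Rightarrow> (real \<Rightarrow> complex) \<Rightarrow> bool" where
  "is_weyl_solution \<sigma> \<tau> z \<psi> \<longleftrightarrow>
     \<psi> \<in> quasi_dom \<sigma> \<and> L2_pos \<psi> \<and> (\<exists>x>0. \<psi> x \<noteq> 0)
     \<and> (AE x in lebesgue. 0 < x \<longrightarrow> ell \<sigma> \<tau> \<psi> x = z * \<psi> x)"

text \<open>
  The choice of the solution is immaterial: it is unique up to multiples, and these cancel
  in the quotient below.
\<close>

definition weyl_solution :: "(real \<Rightarrow> real) \<Rightarrow> (real \<Rightarrow> real) \<Rightarrow> complex \<Rightarrow> real \<Rightarrow> complex" where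
  "weyl_solution \<sigma> \<tau> z = (SOME \<psi>. is_weyl_solution \<sigma> \<tau> z \<psi>)"

definition m_function :: "(real \<Rightarrow> real) \<Rightarrow> (real \<Rightarrow> real) \<Rightarrow> real \<Rightarrow> complex \<Rightarrow> complex" where
  "m_function \<sigma> \<tau> \<alpha> z =
     (let \<psi> = weyl_solution \<sigma> \<tau> z;
          \<psi>0 = Lim (at_right 0) \<psi>;
          \<psi>1 = Lim (at_right 0) (quasi_deriv \<sigma> \<psi>)
      in (of_real (cos \<alpha>) * \<psi>1 - of_real (sin \<alpha>) * \<psi>0)
         / (of_real (sin \<alpha>) * \<psi>1 + of_real (cos \<alpha>) * \<psi>0))"

text \<open>
  Stieltjes inversion: \<open>G \<delta>\<close> is the inner limit \<open>\<epsilon> \<down> 0\<close>. A measure with this property is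
  unique, since it is locally finite and prescribed on half-open intervals.
\<close>

definition is_spectral_measure ::
    "(real \<Rightarrow> real) \<Rightarrow> (real \<Rightarrow> real) \<Rightarrow> real \<Rightarrow> real measure \<Rightarrow> bool" where
  "is_spectral_measure \<sigma> \<tau> \<alpha> \<mu> \<longleftrightarrow>
     sets \<mu> = sets borel \<and>
     (\<forall>a b. a < b \<longrightarrow>
        emeasure \<mu> {a<..b} < \<infinity> \<and>
        (\<exists>G. (\<forall>\<^sub>F \<delta> in at_right 0.
               ((\<lambda>\<epsilon>. 1 / pi * (LINT t:{a+\<delta>..b+\<delta>}|lborel. Im (m_function \<sigma> \<tau> \<alpha> (Complex t \<epsilon>))))
                  \<longlongrightarrow> G \<delta>) (at_right 0))
           \<and> (G \<longlongrightarrow> measure \<mu> {a<..b}) (at_right 0)))"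

end

theory Submission
  imports Defs
begin

text \<open>
  With \<open>q = \<sigma>\<^sup>2 - \<tau>\<close> the equation \<open>\<ell>u = k\<^sup>2u\<close> is the first order system
  \<open>u' = v + \<sigma>u\<close>, \<open>v' = - \<sigma>v - (q + k\<^sup>2)u\<close>, an integrable perturbation of the free one.
  Hence for \<open>Im k \<ge> 0\<close>, \<open>k \<noteq> 0\<close> there is a Jost solution behaving like \<open>e\<^bsup>ikx\<^esup>\<close>, given by a
  Volterra series that is continuous in \<open>k\<close> up to the real axis.
  For \<open>Im k > 0\<close> it decays exponentially and spans the square integrable solutions, so it computes
  the \<open>m\<close>-function, which therefore extends continuously to \<open>(0, \<infinity>)\<close>.
  The current \<open>Im (cnj u v)\<close> of the Jost solution is nonincreasing in \<open>x\<close> and positive for large \<open>x\<close>,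
  hence positive at \<open>0\<close>, and \<open>Im m\<close> is this current divided by a squared modulus. Stieltjes inversion then gives
  the density.
\<close>

section \<open>Absolutely continuous functions\<close>

text \<open>Absolute continuity is given by the epsilon-delta condition on finite divisions, so
  differentiability almost everywhere and the fundamental theorem have to be derived from that
  condition; they link the differential system with its integrated form. The coefficients are known
  only almost everywhere and only on the open half line, while the m-function needs values at
  \<open>0\<close>. Extending them by zero to \<open>x <= 0\<close> makes the Jost solution
  continuous across \<open>0\<close>, so that right limits there become values. Only
  \<open>k\<close> with \<open>Re k > 0\<close> matters: this covers \<open>z = k^2\<close> close to
  \<open>(0, \<infinity>)\<close> from above and fixes the sign of the current at infinity. The
  delicate point is that a square integrable solution is a multiple of the Jost solution. Its
  quasi-derivative is not known to be square integrable, so the Wronskian cannot simply be sent to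
  zero; the uniform local bound on \<open>\<sigma>^2\<close> compensates for this. Positivity of the
  current at \<open>0\<close> serves twice: it makes the density strictly positive, and it keeps the
  denominator of the m-function nonzero up to the real axis, whatever the boundary
  condition.\<close>

lemma division_increments:
  fixes f :: "real \<Rightarrow> 'a::real_normed_vector"
  assumes "D division_of {a..b}" "a \<le> b"
  shows "(\<Sum>K\<in>D. f (Sup K) - f (Inf K)) = f b - f a"
proof -
  \<comment> \<open>Left endpoints serve as tags, so that the telescoping sum for tagged divisions
    applies.\<close>
  let ?p = "(\<lambda>K. (Inf K, K)) ` D"
  have K: "Inf K \<in> K" if "K \<in> D" for K
    using division_ofD(3,4)[OF assms(1) that] by (metis box_real(2) atLeastatMost_empty_iff2 cInf_atLeastAtMost atLeastAtMost_iff order_refl)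
  have "?p tagged_division_of {a..b}"
    unfolding tagged_division_of
  proof (intro conjI allI impI)
    fix x1 K1 x2 K2
    assume *: "(x1, K1) \<in> ?p \<and> (x2, K2) \<in> ?p \<and> (x1, K1) \<noteq> (x2, K2)"
    then have "K1 \<in> D" "K2 \<in> D" "K1 \<noteq> K2" by auto
    then show "interior K1 \<inter> interior K2 = {}" using division_ofD(5)[OF assms(1)] by blast
  next
    have "{K. \<exists>x. (x, K) \<in> ?p} = D" by auto
    then show "\<Union> {K. \<exists>x. (x, K) \<in> ?p} = {a..b}" using division_ofD(6)[OF assms(1)] by simp
  next
    fix x K' assume "(x, K') \<in> ?p"
    then have K': "K' \<in> D" "x = Inf K'" by auto
    then show "x \<in> K'" "K' \<subseteq> {a..b}" "\<exists>l r. K' = cbox l r"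
      using division_ofD(2,4)[OF assms(1)] K by blast+
  qed (use division_ofD(1)[OF assms(1)] in simp)
  from additive_tagged_division_1[OF assms(2) this, of f]
  show ?thesis
    by (subst (asm) sum.reindex) (auto simp: inj_on_def)
qed

section \<open>Vitali coverings by intervals\<close>

text \<open>Continuity of the measure from below along finite partial unions. It trades the
  countable family of a Vitali covering for a finite one, since absolute continuity speaks of finite
  divisions only.\<close>

lemma countable_Union_finite_approx:
  assumes C: "countable C" and X: "\<And>i. i \<in> C \<Longrightarrow> X i \<in> sets lebesgue"
    and U: "U \<in> lmeasurable" "(\<Union>i\<in>C. X i) \<subseteq> U" and "0 < \<eta>"
  obtains F where "finite F" "F \<subseteq> C" "(\<Union>i\<in>C. X i) - (\<Union>i\<in>F. X i) \<in> lmeasurable"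
    "measure lebesgue ((\<Union>i\<in>C. X i) - (\<Union>i\<in>F. X i)) < \<eta>"
proof (cases "C = {}")
  case True
  then show ?thesis using that[of "{}"] \<open>0 < \<eta>\<close> by auto
next
  case False
  \<comment> \<open>If \<open>C\<close> is finite the enumeration repeats elements, which does not
    affect the unions.\<close>
  define e where "e = from_nat_into C"
  have e: "range e = C" unfolding e_def using C False by (simp add: range_from_nat_into)
  define A where "A n = (\<Union>i<n. X (e i))" for n
  have UA: "(\<Union>n. A n) = (\<Union>i\<in>C. X i)"
    unfolding A_def e[symmetric] by (auto intro: lessI)
  have Am: "A n \<in> sets lebesgue" for n
    unfolding A_def using X e by auto
  have UAm: "(\<Union>n. A n) \<in> lmeasurable"
    using U fmeasurableI2[OF U(1)] Am UA by (metis sets.countable_UN rangeI subsetI image_subset_iff)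
  have Af: "A n \<in> lmeasurable" for n
    using fmeasurableI2[OF UAm] Am by blast
  have "(\<lambda>n. measure lebesgue (A n)) \<longlonglongrightarrow> measure lebesgue (\<Union>n. A n)"
  proof (rule Lim_measure_incseq)
    show "range A \<subseteq> sets lebesgue" using Am by auto
    show "incseq A" unfolding A_def incseq_def by (auto intro: less_le_trans)
    show "emeasure lebesgue (\<Union> (range A)) \<noteq> \<infinity>" using fmeasurableD2[OF UAm] unfolding infinity_ennreal_def .
  qed
  then have "\<forall>\<^sub>F n in sequentially. measure lebesgue (\<Union>n. A n) - \<eta> < measure lebesgue (A n)"
    using \<open>0 < \<eta>\<close> by (intro order_tendstoD) auto
  then obtain n where n: "measure lebesgue (\<Union>n. A n) - \<eta> < measure lebesgue (A n)"
    by (auto simp: eventually_sequentially)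
  have sub: "A n \<subseteq> (\<Union>n. A n)" by blast
  have "measure lebesgue ((\<Union>n. A n) - A n) = measure lebesgue (\<Union>n. A n) - measure lebesgue (A n)"
    using measurable_measure_Diff[OF UAm Am sub] .
  moreover have "A n = (\<Union>i\<in>e ` {..<n}. X i)" unfolding A_def by auto
  moreover have "(\<Union>n. A n) - A n \<in> lmeasurable" using UAm Am by (simp add: fmeasurable_Diff)
  ultimately show ?thesis
    using that[of "e ` {..<n}"] n UA e by auto
qed

text \<open>Intervals are encoded as closed balls about their midpoints; \<open>x\<close> only has
  to lie in its interval, not at the centre. The remainder \<open>R\<close> collects the null set
  missed by the countable Vitali family and the part lost by passing to finitely many intervals. No
  measurability of \<open>E\<close> enters.\<close>

lemma vitali_finite_cover:
  fixes E U :: "real set"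
  assumes U: "open U" "U \<in> lmeasurable" "E \<subseteq> U"
    and fine: "\<And>x d. x \<in> E \<Longrightarrow> 0 < d \<Longrightarrow> \<exists>l r. l < r \<and> r - l < d \<and> x \<in> {l..r} \<and> G l r"
    and "0 < \<eta>"
  obtains D R where "finite D" "pairwise disjnt D" "\<Union>D \<subseteq> U"
    "\<And>K. K \<in> D \<Longrightarrow> \<exists>l r. K = {l..r} \<and> l < r \<and> G l r"
    "R \<in> lmeasurable" "measure lebesgue R < \<eta>" "E \<subseteq> \<Union>D \<union> R"
proof -
  define I where "I = {(l, r). l < r \<and> {l..r} \<subseteq> U \<and> G l r}"
  define c :: "real \<times> real \<Rightarrow> real" where "c i = (fst i + snd i) / 2" for i
  define \<rho> :: "real \<times> real \<Rightarrow> real" where "\<rho> i = (snd i - fst i) / 2" for i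
  have cb: "cball (c i) (\<rho> i) = {fst i..snd i}" for i
    unfolding cball_eq_atLeastAtMost c_def \<rho>_def by (auto simp: field_simps)
  have pos: "0 < \<rho> i" if "i \<in> I" for i
    using that unfolding I_def \<rho>_def by auto
  have cover: "\<exists>i. i \<in> I \<and> x \<in> cball (c i) (\<rho> i) \<and> \<rho> i < d" if x: "x \<in> E" and d: "0 < d" for x d
  proof -
    obtain e where e: "0 < e" "ball x e \<subseteq> U" using U x open_contains_ball by blast
    \<comment> \<open>Length below \<open>e\<close> keeps the interval inside the ball around
      \<open>x\<close>, hence inside \<open>U\<close>.\<close>
    obtain l r where lr: "l < r" "r - l < min d e" "x \<in> {l..r}" "G l r"
      using fine[OF x, of "min d e"] d e by auto
    then have "{l..r} \<subseteq> ball x e" by (auto simp: dist_real_def)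
    then have "(l, r) \<in> I" unfolding I_def using lr e by auto
    then show ?thesis using lr d
      by (intro exI[of _ "(l, r)"]) (auto simp: cb, auto simp: \<rho>_def)
  qed
  obtain C where C: "countable C" "C \<subseteq> I"
     "pairwise (\<lambda>i j. disjnt (cball (c i) (\<rho> i)) (cball (c j) (\<rho> j))) C"
     "negligible (E - (\<Union>i\<in>C. cball (c i) (\<rho> i)))"
    using Vitali_covering_theorem_cballs[of I \<rho> E c, OF pos cover] by blast
  define X where "X i = cball (c i) (\<rho> i)" for i
  have XU: "(\<Union>i\<in>C. X i) \<subseteq> U" using C(2) unfolding X_def cb I_def by (auto simp: split_beta subset_iff)
  obtain F where F: "finite F" "F \<subseteq> C" "(\<Union>i\<in>C. X i) - (\<Union>i\<in>F. X i) \<in> lmeasurable"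
    "measure lebesgue ((\<Union>i\<in>C. X i) - (\<Union>i\<in>F. X i)) < \<eta>"
    by (rule countable_Union_finite_approx[OF C(1) _ U(2) XU \<open>0 < \<eta>\<close>]) (auto simp: X_def)
  define N where "N = E - (\<Union>i\<in>C. X i)"
  have N: "negligible N" using C(4) unfolding N_def X_def .
  show ?thesis
  proof (rule that[of "X ` F" "N \<union> ((\<Union>i\<in>C. X i) - (\<Union>i\<in>F. X i))"])
    show "finite (X ` F)" using F by simp
    show "pairwise disjnt (X ` F)"
    proof (rule pairwiseI)
      fix K L assume "K \<in> X ` F" "L \<in> X ` F" and ne: "K \<noteq> L"
      then obtain i j where ij: "i \<in> F" "j \<in> F" "K = X i" "L = X j" by auto
      then show "disjnt K L" using pairwiseD[OF C(3), of i j] F(2) ne by (auto simp: X_def)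
    qed
    show "\<Union> (X ` F) \<subseteq> U" using XU F(2) by blast
    show "\<exists>l r. K = {l..r} \<and> l < r \<and> G l r" if K: "K \<in> X ` F" for K
    proof -
      obtain i where i: "i \<in> F" "K = X i" using K by auto
      then have "i \<in> I" using F C by auto
      then show ?thesis using i unfolding X_def cb I_def by (intro exI[of _ "fst i"] exI[of _ "snd i"]) auto
    qed
    show "N \<union> ((\<Union>i\<in>C. X i) - (\<Union>i\<in>F. X i)) \<in> lmeasurable"
      using N F(3) negligible_imp_measurable by blast
    show "measure lebesgue (N \<union> ((\<Union>i\<in>C. X i) - (\<Union>i\<in>F. X i))) < \<eta>"
      using F(4) measure_Un_le[of N lebesgue "(\<Union>i\<in>C. X i) - (\<Union>i\<in>F. X i)"] N F(3)
      by (auto simp: negligible_imp_measure0 negligible_imp_sets fmeasurableD)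
    show "E \<subseteq> \<Union> (X ` F) \<union> (N \<union> ((\<Union>i\<in>C. X i) - (\<Union>i\<in>F. X i)))"
      unfolding N_def by auto
  qed
qed

lemma measure_Union_disjoint_intervals:
  fixes D :: "real set set"
  assumes "finite D" "pairwise disjnt D" and lr: "\<And>K. K \<in> D \<Longrightarrow> \<exists>l r. K = {l..r} \<and> l < r"
  shows "measure lebesgue (\<Union>D) = (\<Sum>K\<in>D. Sup K - Inf K)" "\<Union>D \<in> lmeasurable"
proof -
  have m: "measure lebesgue K = Sup K - Inf K" "K \<in> lmeasurable" if "K \<in> D" for K
    using lr[OF that] by auto
  have "measure lebesgue (\<Union>D) = (\<Sum>K\<in>D. measure lebesgue K)"
    using measure_Union'[of D lebesgue] assms(1,2) m(2) by auto
  then show "measure lebesgue (\<Union>D) = (\<Sum>K\<in>D. Sup K - Inf K)" using m(1) by simp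
  show "\<Union>D \<in> lmeasurable" using assms(1) m(2) by (simp add: fmeasurable.finite_Union subset_iff)
qed

section \<open>Slopes of absolutely continuous functions and differentiability almost
  everywhere\<close>

text \<open>The intervals of \<open>D2\<close> inside one interval of \<open>D1\<close> extend to a
  division of it. The added gap intervals account for the whole difference of the two sums, and
  their total length is the difference of the two measures, so absolute continuity controls
  them.\<close>

lemma sum_increments_le:
  fixes f :: "real \<Rightarrow> real"
  assumes ac: "\<And>D. \<lbrakk>D division_of \<Union>D; \<Union>D \<subseteq> {a..b}; (\<Sum>K\<in>D. measure lborel K) < d\<rbrakk>
        \<Longrightarrow> (\<Sum>K\<in>D. norm (f (Sup K) - f (Inf K))) < e"
    and D1: "finite D1" "pairwise disjnt D1" "\<And>K. K \<in> D1 \<Longrightarrow> \<exists>l r. K = {l..r} \<and> l < r"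
    and D2: "finite D2" "pairwise disjnt D2" "\<And>K. K \<in> D2 \<Longrightarrow> \<exists>l r. K = {l..r} \<and> l < r \<and> (\<exists>I\<in>D1. {l..r} \<subseteq> I)"
    and sub: "\<Union>D1 \<subseteq> {a..b}"
    and d: "measure lebesgue (\<Union>D1) - measure lebesgue (\<Union>D2) < d"
  shows "\<bar>(\<Sum>K\<in>D1. f (Sup K) - f (Inf K)) - (\<Sum>K\<in>D2. f (Sup K) - f (Inf K))\<bar> < e"
proof -
  define J where "J I = {K \<in> D2. K \<subseteq> I}" for I
  let ?g = "\<lambda>K. f (Sup K) - f (Inf K)"
  have D2': "K \<noteq> {}" if "K \<in> D2" for K using D2(3)[OF that] by auto
  have D1': "K \<noteq> {}" if "K \<in> D1" for K using D1(3)[OF that] by auto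
  have "\<exists>r. J I \<subseteq> r \<and> r division_of I" if I: "I \<in> D1" for I
  proof -
    obtain l u where lu: "I = {l..u}" "l < u" using D1(3)[OF I] by auto
    have "J I division_of \<Union>(J I)"
    proof (rule division_ofI)
      show "finite (J I)" using D2(1) unfolding J_def by simp
      show "K \<subseteq> \<Union> (J I)" "K \<noteq> {}" "\<exists>a b. K = cbox a b" if "K \<in> J I" for K
        using that D2(3)[of K] D2'[of K] unfolding J_def box_real by auto
      show "interior K1 \<inter> interior K2 = {}" if "K1 \<in> J I" "K2 \<in> J I" "K1 \<noteq> K2" for K1 K2
        using pairwiseD[OF D2(2), of K1 K2] that interior_subset[of K1] interior_subset[of K2] unfolding J_def disjnt_def by blast
    qed auto
    moreover have "{I} division_of I" using lu division_of_self[of l u] by simp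
    moreover have "\<Union>(J I) \<subseteq> I" unfolding J_def by auto
    ultimately show ?thesis by (metis partial_division_extend)
  qed
  then obtain r where r: "\<And>I. I \<in> D1 \<Longrightarrow> J I \<subseteq> r I" "\<And>I. I \<in> D1 \<Longrightarrow> r I division_of I"
    by metis
  have rsub: "K \<subseteq> I" "K \<noteq> {}" if "I \<in> D1" "K \<in> r I" for I K
    using division_ofD(2,3)[OF r(2)[OF that(1)] that(2)] by auto
  have disj: "I = I'" if "I \<in> D1" "I' \<in> D1" "K \<subseteq> I" "K \<subseteq> I'" "K \<noteq> {}" for I I' K
    using pairwiseD[OF D1(2), of I I'] that unfolding disjnt_def by blast
  have D2U: "D2 = (\<Union>I\<in>D1. J I)" using D2(3) unfolding J_def by auto
  have sum2: "(\<Sum>K\<in>D2. h K) = (\<Sum>I\<in>D1. \<Sum>K\<in>J I. h K)" for h :: "real set \<Rightarrow> real"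
    unfolding D2U
  proof (rule sum.UNION_disjoint)
    show "\<forall>i\<in>D1. finite (J i)" using D2(1) unfolding J_def by auto
    show "\<forall>i\<in>D1. \<forall>j\<in>D1. i \<noteq> j \<longrightarrow> J i \<inter> J j = {}"
    proof (intro ballI impI equals0I)
      fix I I' K assume *: "I \<in> D1" "I' \<in> D1" "I \<noteq> I'" "K \<in> J I \<inter> J I'"
      then have "K \<subseteq> I" "K \<subseteq> I'" "K \<noteq> {}" using D2' by (auto simp: J_def)
      then show False using disj[OF *(1,2)] *(3) by simp
    qed
  qed (use D1 in auto)
  \<comment> \<open>The gaps left by \<open>D2\<close> inside \<open>D1\<close>.\<close>
  define Q where "Q = (\<Union>I\<in>D1. r I - J I)"
  have sumQ: "(\<Sum>K\<in>Q. h K) = (\<Sum>I\<in>D1. \<Sum>K\<in>r I - J I. h K)" for h :: "real set \<Rightarrow> real"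
    unfolding Q_def
  proof (rule sum.UNION_disjoint)
    show "\<forall>i\<in>D1. finite (r i - J i)" using division_ofD(1)[OF r(2)] by auto
    show "\<forall>i\<in>D1. \<forall>j\<in>D1. i \<noteq> j \<longrightarrow> (r i - J i) \<inter> (r j - J j) = {}"
    proof (intro ballI impI equals0I)
      fix I I' K assume *: "I \<in> D1" "I' \<in> D1" "I \<noteq> I'" "K \<in> (r I - J I) \<inter> (r I' - J I')"
      then have "K \<in> r I" "K \<in> r I'" by auto
      then show False using disj[OF *(1,2) rsub(1)[OF *(1)] rsub(1)[OF *(2)] rsub(2)[OF *(1)]] *(3) by simp
    qed
  qed (use D1 in auto)
  have add: "(\<Sum>K\<in>D1. h (Sup K) - h (Inf K)) = (\<Sum>K\<in>D2. h (Sup K) - h (Inf K)) + (\<Sum>K\<in>Q. h (Sup K) - h (Inf K))"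
    for h :: "real \<Rightarrow> real"
  proof -
    have "h (Sup I) - h (Inf I) = (\<Sum>K\<in>J I. h (Sup K) - h (Inf K)) + (\<Sum>K\<in>r I - J I. h (Sup K) - h (Inf K))"
      if I: "I \<in> D1" for I
    proof -
      obtain l u where lu: "I = {l..u}" "l < u" using D1(3)[OF I] by auto
      have "h (Sup I) - h (Inf I) = (\<Sum>K\<in>r I. h (Sup K) - h (Inf K))"
        using division_increments[of "r I" l u h] r(2)[OF I] lu by simp
      also have "\<dots> = (\<Sum>K\<in>r I - J I. h (Sup K) - h (Inf K)) + (\<Sum>K\<in>J I. h (Sup K) - h (Inf K))"
        by (rule sum.subset_diff) (use r(1)[OF I] division_ofD(1)[OF r(2)[OF I]] in auto)
      finally show ?thesis by simp
    qed
    then show ?thesis unfolding sum2 sumQ by (simp add: sum.distrib)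
  qed
  have Qdiv: "Q division_of \<Union>Q"
  proof (rule division_ofI)
    show "finite Q" unfolding Q_def using D1(1) division_ofD(1)[OF r(2)] by auto
    show "K \<subseteq> \<Union> Q" "K \<noteq> {}" "\<exists>a b. K = cbox a b" if "K \<in> Q" for K
      using that division_ofD(3,4)[OF r(2)] unfolding Q_def by auto
    show "interior K1 \<inter> interior K2 = {}" if K: "K1 \<in> Q" "K2 \<in> Q" "K1 \<noteq> K2" for K1 K2
    proof -
      obtain I1 I2 where I: "I1 \<in> D1" "I2 \<in> D1" "K1 \<in> r I1" "K2 \<in> r I2" using K unfolding Q_def by auto
      show ?thesis
      proof (cases "I1 = I2")
        case True
        then show ?thesis using division_ofD(5)[OF r(2)[OF I(1)]] I K by auto
      next
        case False
        then have "I1 \<inter> I2 = {}" using pairwiseD[OF D1(2) I(1,2)] by (auto simp: disjnt_def)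
        then show ?thesis using rsub(1)[OF I(1,3)] rsub(1)[OF I(2,4)] interior_subset by blast
      qed
    qed
  qed auto
  have Qle: "measure lborel K = Sup K - Inf K" if K: "K \<in> Q" for K
  proof -
    obtain l u where "K = {l..u}" using division_ofD(4)[OF Qdiv K] by auto
    then show ?thesis using division_ofD(3)[OF Qdiv K] by auto
  qed
  have "(\<Sum>K\<in>Q. measure lborel K) = (\<Sum>K\<in>Q. Sup K - Inf K)" using Qle by simp
  \<comment> \<open>The additivity \<open>add\<close>, applied to the identity function, computes
    the total length of the gaps.\<close>
  also have "\<dots> = measure lebesgue (\<Union>D1) - measure lebesgue (\<Union>D2)"
    using add[of "\<lambda>x. x"] measure_Union_disjoint_intervals(1)[OF D1] measure_Union_disjoint_intervals(1)[OF D2(1,2)] D2(3) by fastforce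
  also have "\<dots> < d" by (rule d)
  finally have "(\<Sum>K\<in>Q. norm (?g K)) < e"
  proof (intro ac[OF Qdiv])
    show "\<Union>Q \<subseteq> {a..b}" using sub rsub(1) unfolding Q_def by blast
  qed
  moreover have "\<bar>\<Sum>K\<in>Q. ?g K\<bar> \<le> (\<Sum>K\<in>Q. norm (?g K))" by (simp add: sum_abs)
  ultimately show ?thesis using add[of f] unfolding real_norm_def by linarith
qed

text \<open>
  Cover \<open>E\<close> by disjoint intervals of slope at least \<open>q\<close>, and then, inside these, by intervals of slope
  at most \<open>p\<close>. Both families fill almost the same set, so by absolute continuity the total increments
  of \<open>f\<close> over them almost agree.
\<close>

lemma crossing_slopes_negligible:
  fixes f :: "real \<Rightarrow> real"
  assumes ac: "abs_cont_on {a..b} f" and E: "E \<subseteq> {a<..<b}" and "p < q"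
    and hi: "\<And>x d. x \<in> E \<Longrightarrow> 0 < d \<Longrightarrow> \<exists>l r. l < r \<and> r - l < d \<and> x \<in> {l..r} \<and> q * (r - l) \<le> f r - f l"
    and lo: "\<And>x d. x \<in> E \<Longrightarrow> 0 < d \<Longrightarrow> \<exists>l r. l < r \<and> r - l < d \<and> x \<in> {l..r} \<and> f r - f l \<le> p * (r - l)"
  shows "negligible E"
proof -
  let ?m = "measure lebesgue"
  define M where "M = {?m T | T. T \<in> lmeasurable \<and> E \<subseteq> T}"
  \<comment> \<open>\<open>s\<close> is the outer measure of \<open>E\<close>, whose measurability
    is not known at this point.\<close>
  define s where "s = Inf M"
  have M0: "bdd_below M" unfolding M_def bdd_below_def by (rule exI[of _ 0]) auto
  have Mne: "M \<noteq> {}"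
    using E lmeasurable_box[of a b] unfolding M_def by (auto simp flip: box_real)
  have s_le: "s \<le> ?m T" if "T \<in> lmeasurable" "E \<subseteq> T" for T
    unfolding s_def by (rule cInf_lower[OF _ M0]) (use that in \<open>auto simp: M_def\<close>)
  have s0: "0 \<le> s" unfolding s_def by (rule cInf_greatest[OF Mne]) (auto simp: M_def)
  have s_ex: "\<exists>T. T \<in> lmeasurable \<and> E \<subseteq> T \<and> ?m T < s + e" if "0 < e" for e
  proof -
    have "Inf M < s + e" using that unfolding s_def by simp
    then obtain m where "m \<in> M" "m < s + e" using cInf_lessD[OF Mne] by blast
    then show ?thesis unfolding M_def by auto
  qed
  have "s = 0"
  proof (rule ccontr)
    assume "s \<noteq> 0"
    then have spos: "0 < s" using s0 by simp
    define c where "c = q - p"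
    have c: "0 < c" using \<open>p < q\<close> unfolding c_def by simp
    obtain d where d: "0 < d" "\<And>D. \<lbrakk>D division_of \<Union>D; \<Union>D \<subseteq> {a..b}; (\<Sum>K\<in>D. measure lborel K) < d\<rbrakk>
        \<Longrightarrow> (\<Sum>K\<in>D. norm (f (Sup K) - f (Inf K))) < c * s / 4"
      using ac[unfolded abs_cont_on_def, rule_format, of "c * s / 4"] c spos by auto
    \<comment> \<open>The three bounds serve in turn: \<open>?m (\<Union>D1)\<close> is at least
      \<open>3 * s / 4\<close>; the gaps, shorter than \<open>4 * \<eta>\<close>, meet the threshold
      \<open>d\<close>; and the error \<open>\<bar>p\<bar> * t\<close> is at most
      \<open>c * s / 4\<close>.\<close>
    define \<eta> where "\<eta> = min (s / 4) (min (d / 4) (c * s / (16 * (\<bar>p\<bar> + 1))))"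
    have \<eta>: "0 < \<eta>" unfolding \<eta>_def using spos c d(1) by auto
    obtain T where T: "T \<in> lmeasurable" "E \<subseteq> T" "?m T < s + \<eta>"
      using s_ex[OF \<eta>] by auto
    obtain V where V0: "open V" "T \<subseteq> V" "V - T \<in> lmeasurable" "emeasure lebesgue (V - T) < ennreal \<eta>"
      using sets_lebesgue_outer_open[of T \<eta>] T(1) \<eta> by (auto simp: fmeasurableD)
    have VT: "V = T \<union> (V - T)" using V0(2) by auto
    have "?m (V - T) < \<eta>"
      using V0(4) emeasure_eq_measure2[OF V0(3)] \<eta> by (simp only: ennreal_less_iff measure_nonneg)
    then have V: "open V" "T \<subseteq> V" "V \<in> lmeasurable" "?m V < ?m T + \<eta>"
      using V0(1-3) T(1) VT measure_Un_le[of T lebesgue "V - T"] fmeasurable.Un[OF T(1) V0(3)]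
      by (auto simp: fmeasurableD)
    define U where "U = V \<inter> {a<..<b}"
    have U: "open U" "U \<in> lmeasurable" "E \<subseteq> U" "?m U < s + 2 * \<eta>"
    proof -
      show "open U" using V unfolding U_def by auto
      show m: "U \<in> lmeasurable" using V(3) unfolding U_def
        by (intro fmeasurable.Int) (auto simp flip: box_real)
      show "E \<subseteq> U" using T V E unfolding U_def by auto
      have "?m U \<le> ?m V"
        using V(3) m unfolding U_def by (intro measure_mono_fmeasurable) (auto simp: fmeasurableD)
      then show "?m U < s + 2 * \<eta>" using V T by simp
    qed
    obtain D1 R1 where D1: "finite D1" "pairwise disjnt D1" "\<Union>D1 \<subseteq> U"
      "\<And>K. K \<in> D1 \<Longrightarrow> \<exists>l r. K = {l..r} \<and> l < r \<and> q * (r - l) \<le> f r - f l"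
      "R1 \<in> lmeasurable" "?m R1 < \<eta>" "E \<subseteq> \<Union>D1 \<union> R1"
      using vitali_finite_cover[OF U(1-3), where G="\<lambda>l r. q * (r - l) \<le> f r - f l", OF hi \<eta>] by metis
    \<comment> \<open>The second covering must lie inside the intervals of the first, so only their
      interior points can be covered again; the endpoints lost here form the finite null set
      \<open>N\<close> below.\<close>
    define W where "W = (\<Union>K\<in>D1. interior K)"
    define E2 where "E2 = E \<inter> W"
    have W1: "W \<subseteq> \<Union>D1" unfolding W_def using interior_subset by auto
    have W: "open W" "W \<in> lmeasurable" "E2 \<subseteq> W"
    proof -
      show "open W" unfolding W_def by auto
      then show "W \<in> lmeasurable"
        using W1 measure_Union_disjoint_intervals(2)[OF D1(1,2)] D1(4) by (metis fmeasurableI2 lborelD sets_completionI_sets sets_lborel borel_open)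
    qed (auto simp: E2_def)
    have fine2: "\<exists>l r. l < r \<and> r - l < e \<and> x \<in> {l..r} \<and> (f r - f l \<le> p * (r - l) \<and> (\<exists>I\<in>D1. {l..r} \<subseteq> I))"
      if x: "x \<in> E2" and e: "0 < e" for x e
    proof -
      obtain I where I: "I \<in> D1" "x \<in> interior I" using x unfolding E2_def W_def by auto
      obtain t where t: "0 < t" "ball x t \<subseteq> interior I"
        using open_contains_ball[of "interior I"] I(2) by auto
      obtain l r where lr: "l < r" "r - l < min e t" "x \<in> {l..r}" "f r - f l \<le> p * (r - l)"
        using lo[of x "min e t"] x e t unfolding E2_def by auto
      then have "{l..r} \<subseteq> ball x t" by (auto simp: dist_real_def)
      then have "{l..r} \<subseteq> I" using t(2) interior_subset by blast
      then show ?thesis using lr I by (intro exI[of _ l] exI[of _ r]) auto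
    qed
    obtain D2 R2 where D2: "finite D2" "pairwise disjnt D2" "\<Union>D2 \<subseteq> W"
      "\<And>K. K \<in> D2 \<Longrightarrow> \<exists>l r. K = {l..r} \<and> l < r \<and> f r - f l \<le> p * (r - l) \<and> (\<exists>I\<in>D1. {l..r} \<subseteq> I)"
      "R2 \<in> lmeasurable" "?m R2 < \<eta>" "E2 \<subseteq> \<Union>D2 \<union> R2"
      using vitali_finite_cover[OF W, where G="\<lambda>l r. f r - f l \<le> p * (r - l) \<and> (\<exists>I\<in>D1. {l..r} \<subseteq> I)", OF fine2 \<eta>]
      by metis
    have m1: "?m (\<Union>D1) = (\<Sum>K\<in>D1. Sup K - Inf K)" "\<Union>D1 \<in> lmeasurable"
      using measure_Union_disjoint_intervals[OF D1(1,2)] D1(4) by meson+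
    have m2: "?m (\<Union>D2) = (\<Sum>K\<in>D2. Sup K - Inf K)" "\<Union>D2 \<in> lmeasurable"
      using measure_Union_disjoint_intervals[OF D2(1,2)] D2(4) by meson+
    define N where "N = (\<Union>K\<in>D1. {Inf K, Sup K})"
    have "finite N" using D1(1) unfolding N_def by auto
    then have N: "N \<in> lmeasurable" "?m N = 0"
      by (auto simp: negligible_finite negligible_imp_measurable negligible_imp_measure0)
    have "\<Union>D1 \<subseteq> W \<union> N"
    proof
      fix x assume "x \<in> \<Union>D1"
      then obtain K where K: "K \<in> D1" "x \<in> K" by auto
      obtain l r where lr: "K = {l..r}" "l < r" using D1(4)[OF K(1)] by auto
      show "x \<in> W \<union> N"
      proof (cases "l < x \<and> x < r")
        case True
        then have "x \<in> interior K" using lr by (simp add: interior_atLeastAtMost_real)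
        then show ?thesis using K unfolding W_def by auto
      next
        case False
        then have "x = l \<or> x = r" using K(2) lr by auto
        then have "x \<in> {Inf K, Sup K}" using lr by auto
        then show ?thesis using K unfolding N_def by blast
      qed
    qed
    then have Ecov: "E \<subseteq> \<Union>D2 \<union> (R1 \<union> (R2 \<union> N))"
      using D1(7) D2(7) unfolding E2_def by blast
    have "s \<le> ?m (\<Union>D2 \<union> (R1 \<union> (R2 \<union> N)))"
      using m2 D1(5) D2(5) N Ecov by (intro s_le) auto
    also have "\<dots> \<le> ?m (\<Union>D2) + (?m R1 + (?m R2 + ?m N))"
      using m2(2) D1(5) D2(5) N(1)
      by (intro order_trans[OF measure_Un_le] add_left_mono) (auto simp: fmeasurableD)
    finally have sD2: "s \<le> ?m (\<Union>D2) + 2 * \<eta>" using N D1(6) D2(6) by simp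
    have "s \<le> ?m (\<Union>D1 \<union> R1)"
      using m1 D1 by (intro s_le) auto
    also have "\<dots> \<le> ?m (\<Union>D1) + ?m R1"
      using m1(2) D1(5) by (intro measure_Un_le) (auto simp: fmeasurableD)
    finally have sD1: "s \<le> ?m (\<Union>D1) + \<eta>" using D1(6) by simp
    have D1U: "?m (\<Union>D1) \<le> ?m U"
      using D1(3) m1(2) U(2) by (intro measure_mono_fmeasurable) (auto simp: fmeasurableD)
    have D2D1: "?m (\<Union>D2) \<le> ?m (\<Union>D1)"
      using D2(3) W1 m1(2) m2(2) by (intro measure_mono_fmeasurable) (auto simp: fmeasurableD)
    define t where "t = ?m (\<Union>D1) - ?m (\<Union>D2)"
    have t: "0 \<le> t" "t < 4 * \<eta>" using sD2 D1U U(4) D2D1 unfolding t_def by auto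
    have "\<bar>(\<Sum>K\<in>D1. f (Sup K) - f (Inf K)) - (\<Sum>K\<in>D2. f (Sup K) - f (Inf K))\<bar> < c * s / 4"
    proof (rule sum_increments_le[OF d(2)])
      show "\<Union>D1 \<subseteq> {a..b}" using D1(3) unfolding U_def by auto
      show "\<exists>l r. K = {l..r} \<and> l < r" if "K \<in> D1" for K using D1(4)[OF that] by blast
      show "\<exists>l r. K = {l..r} \<and> l < r \<and> (\<exists>I\<in>D1. {l..r} \<subseteq> I)" if "K \<in> D2" for K using D2(4)[OF that] by blast
      have "4 * \<eta> \<le> d" unfolding \<eta>_def by auto
      then show "?m (\<Union>D1) - ?m (\<Union>D2) < d" using t unfolding t_def by simp
    qed (use D1 D2 in auto)
    moreover have "q * ?m (\<Union>D1) \<le> (\<Sum>K\<in>D1. f (Sup K) - f (Inf K))"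
      unfolding m1(1) sum_distrib_left
    proof (rule sum_mono)
      fix K assume "K \<in> D1" then show "q * (Sup K - Inf K) \<le> f (Sup K) - f (Inf K)" using D1(4)[of K] by auto
    qed
    moreover have "(\<Sum>K\<in>D2. f (Sup K) - f (Inf K)) \<le> p * ?m (\<Union>D2)"
      unfolding m2(1) sum_distrib_left
    proof (rule sum_mono)
      fix K assume "K \<in> D2" then show "f (Sup K) - f (Inf K) \<le> p * (Sup K - Inf K)" using D2(4)[of K] by auto
    qed
    ultimately have "q * ?m (\<Union>D1) < p * ?m (\<Union>D2) + c * s / 4" by linarith
    \<comment> \<open>Here \<open>c * ?m (\<Union>D1)\<close> is
      \<open>q * ?m (\<Union>D1) - p * ?m (\<Union>D1)\<close>, and replacing \<open>D1\<close> by
      \<open>D2\<close> in the term with \<open>p\<close> costs \<open>- p * t\<close>.\<close>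
    then have "c * ?m (\<Union>D1) < - p * t + c * s / 4"
      unfolding c_def t_def by (simp add: algebra_simps)
    also have "- p * t \<le> \<bar>p\<bar> * t" using t(1) by (simp add: mult_right_mono flip: minus_mult_left) (metis abs_ge_minus_self minus_mult_left mult_right_mono)
    also have "\<bar>p\<bar> * t \<le> (\<bar>p\<bar> + 1) * (4 * \<eta>)" using t by (intro mult_mono) auto
    also have "\<dots> \<le> (\<bar>p\<bar> + 1) * (4 * (c * s / (16 * (\<bar>p\<bar> + 1))))"
      unfolding \<eta>_def by (intro mult_left_mono) auto
    also have "\<dots> = c * s / 4" by (simp add: field_simps)
    finally have "c * ?m (\<Union>D1) < c * (s / 2)" by simp
    then have "?m (\<Union>D1) < s / 2" using c by simp
    moreover have "\<eta> \<le> s / 4" unfolding \<eta>_def by (rule min.cobounded1)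
    ultimately show False using sD1 spos by simp
  qed
  then have "\<exists>T. E \<subseteq> T \<and> T \<in> lmeasurable \<and> ?m T < e" if "0 < e" for e
    using s_ex[OF that] by auto
  then show ?thesis unfolding negligible_outer by blast
qed

text \<open>Disjoint intervals of small total length carry total increment below \<open>1\<close>;
  if all their slopes exceed \<open>k\<close> in modulus, their total length is below
  \<open>1 / k\<close>, and \<open>k\<close> is arbitrary.\<close>

lemma unbounded_slopes_negligible:
  fixes f :: "real \<Rightarrow> real"
  assumes ac: "abs_cont_on {a..b} f" and E: "E \<subseteq> {a<..<b}"
    and hi: "\<And>x d k. x \<in> E \<Longrightarrow> 0 < d \<Longrightarrow> \<exists>l r. l < r \<and> r - l < d \<and> x \<in> {l..r} \<and> k * (r - l) \<le> \<bar>f r - f l\<bar>"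
  shows "negligible E"
proof -
  let ?m = "measure lebesgue"
  obtain d where d: "0 < d" "\<And>D. \<lbrakk>D division_of \<Union>D; \<Union>D \<subseteq> {a..b}; (\<Sum>K\<in>D. measure lborel K) < d\<rbrakk>
      \<Longrightarrow> (\<Sum>K\<in>D. norm (f (Sup K) - f (Inf K))) < 1"
    using ac[unfolded abs_cont_on_def, rule_format, of 1] by auto
  \<comment> \<open>A window of length \<open>2 * d / 3\<close> has measure below \<open>d\<close>,
    so disjoint intervals in it meet the smallness condition whatever their number. The windows are
    glued at the end by local negligibility.\<close>
  have loc: "negligible (E \<inter> {x - d/3<..<x + d/3})" for x
    unfolding negligible_outer
  proof (intro allI impI)
    fix e :: real assume e: "0 < e"
    define U where "U = {a<..<b} \<inter> {x - d/3<..<x + d/3}"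
    have U: "open U" "U \<in> lmeasurable" "E \<inter> {x - d/3<..<x + d/3} \<subseteq> U"
      using E unfolding U_def by (auto intro!: fmeasurable.Int simp flip: box_real)
    have mU: "?m U \<le> ?m {x - d/3<..<x + d/3}"
      unfolding U_def by (intro measure_mono_fmeasurable) (auto simp flip: box_real)
    also have "\<dots> < d" using d(1) by auto
    finally have mU: "?m U < d" .
    \<comment> \<open>Slope at least \<open>2 / e\<close> against total increment below
      \<open>1\<close> leaves length below \<open>e / 2\<close>; the uncovered rest costs another
      \<open>e / 2\<close>.\<close>
    obtain D R where D: "finite D" "pairwise disjnt D" "\<Union>D \<subseteq> U"
      "\<And>K. K \<in> D \<Longrightarrow> \<exists>l r. K = {l..r} \<and> l < r \<and> 2 / e * (r - l) \<le> \<bar>f r - f l\<bar>"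
      "R \<in> lmeasurable" "?m R < e / 2" "E \<inter> {x - d/3<..<x + d/3} \<subseteq> \<Union>D \<union> R"
      using vitali_finite_cover[OF U, where G="\<lambda>l r. 2 / e * (r - l) \<le> \<bar>f r - f l\<bar>" and \<eta>="e / 2"] hi e
      by (metis (no_types, lifting) IntD1 half_gt_zero)
    have lr: "\<exists>l r. K = {l..r} \<and> l < r" if "K \<in> D" for K using D(4)[OF that] by blast
    have m: "?m (\<Union>D) = (\<Sum>K\<in>D. Sup K - Inf K)" "\<Union>D \<in> lmeasurable"
      by (rule measure_Union_disjoint_intervals[OF D(1,2)], erule lr)+
    have Ddiv: "D division_of \<Union>D"
    proof (rule division_ofI)
      show "K \<subseteq> \<Union> D" "K \<noteq> {}" "\<exists>a b. K = cbox a b" if "K \<in> D" for K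
        using that lr[of K] by auto
      show "interior K1 \<inter> interior K2 = {}" if "K1 \<in> D" "K2 \<in> D" "K1 \<noteq> K2" for K1 K2
        using pairwiseD[OF D(2) that] interior_subset[of K1] interior_subset[of K2] by (auto simp: disjnt_def)
    qed (use D in auto)
    have "(\<Sum>K\<in>D. measure lborel K) = (\<Sum>K\<in>D. Sup K - Inf K)"
      using lr by (intro sum.cong refl) fastforce
    also have "\<dots> = ?m (\<Union>D)" using m(1) by simp
    also have "\<dots> \<le> ?m U"
      using D(3) m(2) U(2) by (intro measure_mono_fmeasurable) (auto simp: fmeasurableD)
    finally have "(\<Sum>K\<in>D. norm (f (Sup K) - f (Inf K))) < 1"
      using mU D(3) by (intro d(2)[OF Ddiv]) (auto simp: U_def)
    moreover have "2 / e * ?m (\<Union>D) \<le> (\<Sum>K\<in>D. norm (f (Sup K) - f (Inf K)))"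
      unfolding m(1) sum_distrib_left
    proof (rule sum_mono)
      fix K assume "K \<in> D"
      then obtain l r where "K = {l..r}" "l < r" "2 / e * (r - l) \<le> \<bar>f r - f l\<bar>" using D(4)[of K] by blast
      then show "2 / e * (Sup K - Inf K) \<le> norm (f (Sup K) - f (Inf K))" by simp
    qed
    ultimately have "2 / e * ?m (\<Union>D) < 1" by linarith
    then have "?m (\<Union>D) < e / 2" using e by (simp add: field_simps)
    moreover have "?m (\<Union>D \<union> R) \<le> ?m (\<Union>D) + ?m R"
      using m(2) D(5) by (intro measure_Un_le) (auto simp: fmeasurableD)
    ultimately have "?m (\<Union>D \<union> R) < e" using D(6) by simp
    then show "\<exists>T. E \<inter> {x - d/3<..<x + d/3} \<subseteq> T \<and> T \<in> lmeasurable \<and> ?m T < e"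
      using D(5,7) m(2) by (intro exI[of _ "\<Union>D \<union> R"]) auto
  qed
  show ?thesis
  proof (rule locally_negligible_alt[THEN iffD2], rule)
    fix x assume "x \<in> E"
    then show "\<exists>U. openin (top_of_set E) U \<and> x \<in> U \<and> negligible U"
      using d(1) loc[of x] openin_open_Int[of "{x - d/3<..<x + d/3}" E]
      by (intro exI[of _ "E \<inter> {x - d/3<..<x + d/3}"]) simp
  qed
qed

text \<open>The difference quotient is symmetric in \<open>x\<close> and \<open>y\<close>, so it is
  the slope over the interval between them on either side of \<open>x\<close>.\<close>

lemma slope_interval:
  fixes f :: "real \<Rightarrow> real"
  assumes "y \<noteq> x" "\<bar>y - x\<bar> < d"
  obtains l r where "l < r" "r - l < d" "x \<in> {l..r}" "f r - f l = (f y - f x) / (y - x) * (r - l)"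
proof (cases "x < y")
  case True
  then show ?thesis using that[of x y] assms by auto
next
  case False
  then have "y < x" using assms by simp
  moreover have "f x - f y = (f y - f x) / (y - x) * (x - y)"
    using \<open>y < x\<close> by (simp add: field_simps)
  ultimately show ?thesis using that[of y x] assms by auto
qed

text \<open>At a point of non-differentiability either the difference quotients are unbounded
  (\<open>C\<close>), or their lower and upper limits are separated by rationals
  \<open>p < q\<close>, which puts the point into \<open>A p \<inter> B q\<close>. Countably many
  null sets remain.\<close>

lemma abs_cont_on_differentiable_real:
  fixes f :: "real \<Rightarrow> real"
  assumes ac: "abs_cont_on {a..b} f"
  shows "negligible {x \<in> {a<..<b}. \<not> f differentiable (at x)}"
proof -
  define Q where "Q x y = (f y - f x) / (y - x)" for x y
  define A where "A p = {x \<in> {a<..<b}. \<forall>d>0. \<exists>y. y \<noteq> x \<and> \<bar>y - x\<bar> < d \<and> Q x y \<le> p}" for p :: real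
  define B where "B q = {x \<in> {a<..<b}. \<forall>d>0. \<exists>y. y \<noteq> x \<and> \<bar>y - x\<bar> < d \<and> q \<le> Q x y}" for q :: real
  define C where "C = {x \<in> {a<..<b}. \<forall>k. \<forall>d>0. \<exists>y. y \<noteq> x \<and> \<bar>y - x\<bar> < d \<and> k \<le> \<bar>Q x y\<bar>}"
  have AB: "negligible (A p \<inter> B q)" if "p < q" for p q
  proof (rule crossing_slopes_negligible[OF ac _ that])
    show "A p \<inter> B q \<subseteq> {a<..<b}" unfolding A_def by auto
    fix x d :: real assume x: "x \<in> A p \<inter> B q" and d: "0 < d"
    obtain y where y: "y \<noteq> x" "\<bar>y - x\<bar> < d" "q \<le> Q x y" using x d unfolding B_def by auto
    obtain l r where lr: "l < r" "r - l < d" "x \<in> {l..r}" "f r - f l = Q x y * (r - l)"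
      using slope_interval[OF y(1,2), of f] unfolding Q_def by metis
    show "\<exists>l r. l < r \<and> r - l < d \<and> x \<in> {l..r} \<and> q * (r - l) \<le> f r - f l"
      using lr y(3) by (intro exI[of _ l] exI[of _ r]) (auto intro: mult_right_mono)
    obtain y where y: "y \<noteq> x" "\<bar>y - x\<bar> < d" "Q x y \<le> p" using x d unfolding A_def by auto
    obtain l r where lr: "l < r" "r - l < d" "x \<in> {l..r}" "f r - f l = Q x y * (r - l)"
      using slope_interval[OF y(1,2), of f] unfolding Q_def by metis
    show "\<exists>l r. l < r \<and> r - l < d \<and> x \<in> {l..r} \<and> f r - f l \<le> p * (r - l)"
      using lr y(3) by (intro exI[of _ l] exI[of _ r]) (auto intro: mult_right_mono)
  qed
  have Cneg: "negligible C"
  proof (rule unbounded_slopes_negligible[OF ac])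
    show "C \<subseteq> {a<..<b}" unfolding C_def by auto
    fix x d k :: real assume x: "x \<in> C" and d: "0 < d"
    obtain y where y: "y \<noteq> x" "\<bar>y - x\<bar> < d" "k \<le> \<bar>Q x y\<bar>" using x d unfolding C_def by auto
    obtain l r where lr: "l < r" "r - l < d" "x \<in> {l..r}" "f r - f l = Q x y * (r - l)"
      using slope_interval[OF y(1,2), of f] unfolding Q_def by metis
    show "\<exists>l r. l < r \<and> r - l < d \<and> x \<in> {l..r} \<and> k * (r - l) \<le> \<bar>f r - f l\<bar>"
      using lr y(3) by (intro exI[of _ l] exI[of _ r]) (auto simp: abs_mult intro: mult_right_mono)
  qed
  have "{x \<in> {a<..<b}. \<not> f differentiable (at x)}
      \<subseteq> C \<union> (\<Union>(p, q) \<in> {(p, q). p \<in> \<rat> \<and> q \<in> \<rat> \<and> p < q}. A p \<inter> B q)"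
  proof
    fix x assume "x \<in> {x \<in> {a<..<b}. \<not> f differentiable (at x)}"
    then have x: "x \<in> {a<..<b}" and nd: "\<not> f differentiable (at x)" by auto
    show "x \<in> C \<union> (\<Union>(p, q) \<in> {(p, q). p \<in> \<rat> \<and> q \<in> \<rat> \<and> p < q}. A p \<inter> B q)"
    proof (rule ccontr)
      assume no: "\<not> ?thesis"
      \<comment> \<open>Lower and upper limits are taken in the extended reals, where they always
        exist; \<open>x \<notin> C\<close> then makes them finite.\<close>
      let ?Q = "\<lambda>y. ereal (Q x y)"
      obtain k d where kd: "0 < d" "\<And>y. y \<noteq> x \<Longrightarrow> \<bar>y - x\<bar> < d \<Longrightarrow> \<bar>Q x y\<bar> < k"
        using no x unfolding C_def mem_Collect_eq Un_iff de_Morgan_disj by (meson not_le)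
      have ev: "\<forall>\<^sub>F y in at x. \<bar>Q x y\<bar> < k"
        unfolding eventually_at using kd by (intro exI[of _ d]) (auto simp: dist_real_def)
      have lower: "ereal (- k) \<le> Liminf (at x) ?Q"
        by (rule Liminf_bounded) (use ev in \<open>auto elim: eventually_mono\<close>)
      have upper: "Limsup (at x) ?Q \<le> ereal k"
        by (rule Limsup_bounded) (use ev in \<open>auto elim: eventually_mono\<close>)
      have le: "Liminf (at x) ?Q \<le> Limsup (at x) ?Q" by (rule Liminf_le_Limsup) simp
      have "Liminf (at x) ?Q = Limsup (at x) ?Q"
      proof (rule ccontr)
        assume "Liminf (at x) ?Q \<noteq> Limsup (at x) ?Q"
        then have lt: "Liminf (at x) ?Q < Limsup (at x) ?Q" using le by simp
        then obtain p where p: "Liminf (at x) ?Q < real_of_rat p" "ereal (real_of_rat p) < Limsup (at x) ?Q"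
          using ereal_dense3 by blast
        then obtain q where q: "ereal (real_of_rat p) < real_of_rat q" "ereal (real_of_rat q) < Limsup (at x) ?Q"
          using ereal_dense3 by blast
        have "x \<in> A (real_of_rat p)"
        proof (rule ccontr)
          assume "x \<notin> A (real_of_rat p)"
          then obtain d where d: "0 < d" "\<And>y. y \<noteq> x \<Longrightarrow> \<bar>y - x\<bar> < d \<Longrightarrow> real_of_rat p < Q x y"
            using x unfolding A_def by (auto simp: not_le)
          have "ereal (real_of_rat p) \<le> Liminf (at x) ?Q"
            by (rule Liminf_bounded, unfold eventually_at)
              (use d in \<open>auto simp: dist_real_def intro!: exI[of _ d] less_imp_le\<close>)
          then show False using p(1) by simp
        qed
        moreover have "x \<in> B (real_of_rat q)"
        proof (rule ccontr)
          assume "x \<notin> B (real_of_rat q)"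
          then obtain d where d: "0 < d" "\<And>y. y \<noteq> x \<Longrightarrow> \<bar>y - x\<bar> < d \<Longrightarrow> Q x y < real_of_rat q"
            using x unfolding B_def by (auto simp: not_le)
          have "Limsup (at x) ?Q \<le> ereal (real_of_rat q)"
            by (rule Limsup_bounded, unfold eventually_at)
              (use d in \<open>auto simp: dist_real_def intro!: exI[of _ d] less_imp_le\<close>)
          then show False using q(2) by simp
        qed
        ultimately show False using no q(1) by auto
      qed
      moreover obtain L where L: "Liminf (at x) ?Q = ereal L"
        using lower upper le by (cases "Liminf (at x) ?Q") auto
      ultimately have "(?Q \<longlongrightarrow> ereal L) (at x)"
        by (intro Liminf_eq_Limsup) auto
      then have "(Q x \<longlongrightarrow> L) (at x)" by simp
      then have "(f has_field_derivative L) (at x)"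
        unfolding has_field_derivative_iff Q_def .
      then show False using nd by (auto simp: real_differentiable_def)
    qed
  qed
  moreover have "negligible (C \<union> (\<Union>(p, q) \<in> {(p, q). p \<in> \<rat> \<and> q \<in> \<rat> \<and> p < q}. A p \<inter> B q))"
  proof (intro negligible_Un Cneg negligible_countable_Union)
    have "{(p, q). p \<in> \<rat> \<and> q \<in> \<rat> \<and> p < q} \<subseteq> \<rat> \<times> (\<rat> :: real set)" by auto
    then have "countable {(p, q). p \<in> (\<rat> :: real set) \<and> q \<in> \<rat> \<and> p < q}"
      by (rule countable_subset) (intro countable_SIGMA countable_rat)
    then show "countable ((\<lambda>(p, q). A p \<inter> B q) ` {(p, q). p \<in> \<rat> \<and> q \<in> \<rat> \<and> p < q})" by simp
  qed (use AB in auto)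
  ultimately show ?thesis using negligible_subset by blast
qed

section \<open>The fundamental theorem of calculus and indefinite integrals\<close>

text \<open>A single source for all closure properties: sums, products, inverses and linear images
  (the last two with \<open>g = f\<close>) satisfy such a Lipschitz estimate on compact
  intervals.\<close>

lemma abs_cont_on_combine:
  assumes f: "abs_cont_on {a..b} f" and g: "abs_cont_on {a..b} g"
    and C: "\<And>x y. x \<in> {a..b} \<Longrightarrow> y \<in> {a..b} \<Longrightarrow>
      norm (h x - h y) \<le> C * (norm (f x - f y) + norm (g x - g y))"
  shows "abs_cont_on {a..b} h"
  unfolding abs_cont_on_def
proof (intro allI impI)
  fix e :: real assume e: "0 < e"
  \<comment> \<open>\<open>C\<close> may be zero or negative, while the tolerance is divided by the
    constant.\<close>
  define k where "k = max C 0 + 1"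
  have k: "0 < k" "C \<le> k" unfolding k_def by auto
  obtain d1 where d1: "0 < d1" "\<And>D. \<lbrakk>D division_of \<Union>D; \<Union>D \<subseteq> {a..b}; (\<Sum>K\<in>D. measure lborel K) < d1\<rbrakk>
      \<Longrightarrow> (\<Sum>K\<in>D. norm (f (Sup K) - f (Inf K))) < e / (2 * k)"
    using f[unfolded abs_cont_on_def, rule_format, of "e / (2 * k)"] e k by auto
  obtain d2 where d2: "0 < d2" "\<And>D. \<lbrakk>D division_of \<Union>D; \<Union>D \<subseteq> {a..b}; (\<Sum>K\<in>D. measure lborel K) < d2\<rbrakk>
      \<Longrightarrow> (\<Sum>K\<in>D. norm (g (Sup K) - g (Inf K))) < e / (2 * k)"
    using g[unfolded abs_cont_on_def, rule_format, of "e / (2 * k)"] e k by auto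
  show "\<exists>d>0. \<forall>D. D division_of \<Union> D \<and> \<Union> D \<subseteq> {a..b} \<and> (\<Sum>K\<in>D. measure lborel K) < d
        \<longrightarrow> (\<Sum>K\<in>D. norm (h (Sup K) - h (Inf K))) < e"
  proof (intro exI[of _ "min d1 d2"] conjI allI impI; (elim conjE)?)
    fix D assume D: "D division_of \<Union> D" "\<Union> D \<subseteq> {a..b}" "(\<Sum>K\<in>D. measure lborel K) < min d1 d2"
    have "(\<Sum>K\<in>D. norm (h (Sup K) - h (Inf K)))
        \<le> (\<Sum>K\<in>D. k * (norm (f (Sup K) - f (Inf K)) + norm (g (Sup K) - g (Inf K))))"
    proof (rule sum_mono)
      fix K assume K: "K \<in> D"
      obtain l u where "K = {l..u}" "l \<le> u" using division_ofD(3,4)[OF D(1) K] by auto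
      moreover have "K \<subseteq> {a..b}" using K D(2) by auto
      ultimately have "Sup K \<in> {a..b}" "Inf K \<in> {a..b}" by auto
      then have "norm (h (Sup K) - h (Inf K)) \<le> C * (norm (f (Sup K) - f (Inf K)) + norm (g (Sup K) - g (Inf K)))"
        by (rule C)
      also have "\<dots> \<le> k * (norm (f (Sup K) - f (Inf K)) + norm (g (Sup K) - g (Inf K)))"
        using k by (intro mult_right_mono) auto
      finally show "norm (h (Sup K) - h (Inf K)) \<le> k * (norm (f (Sup K) - f (Inf K)) + norm (g (Sup K) - g (Inf K)))" .
    qed
    also have "\<dots> = k * ((\<Sum>K\<in>D. norm (f (Sup K) - f (Inf K))) + (\<Sum>K\<in>D. norm (g (Sup K) - g (Inf K))))"
      by (simp only: sum_distrib_left sum.distrib distrib_left)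
    also have "\<dots> < k * (e / (2 * k) + e / (2 * k))"
      using d1(2)[OF D(1,2)] d2(2)[OF D(1,2)] D(3) k by (intro mult_strict_left_mono add_strict_mono) auto
    finally show "(\<Sum>K\<in>D. norm (h (Sup K) - h (Inf K))) < e" using k by (simp add: field_simps)
  qed (use d1 d2 in auto)
qed

lemma AC_loc_bounded_linear:
  assumes "bounded_linear L" "AC_loc f"
  shows "AC_loc (\<lambda>x. L (f x))"
proof -
  obtain C where C: "\<And>x. norm (L x) \<le> norm x * C" using bounded_linear.bounded[OF assms(1)] by auto
  have le: "norm (L (f x) - L (f y)) \<le> C * norm (f x - f y)" for x y
    using C[of "f x - f y"] by (simp add: linear_diff[OF bounded_linear.linear[OF assms(1)]] mult.commute)
  show ?thesis
    unfolding AC_loc_def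
  proof (intro allI impI)
    fix a b :: real assume "0 < a" "a < b"
    then have "abs_cont_on {a..b} f" using assms(2) unfolding AC_loc_def by simp
    then show "abs_cont_on {a..b} (\<lambda>x. L (f x))"
      by (rule abs_cont_on_combine[where C="\<bar>C\<bar>", OF _ \<open>abs_cont_on {a..b} f\<close>])
        (rule order_trans[OF le], intro mult_mono, auto)
  qed
qed

lemma AC_loc_differentiable:
  fixes f :: "real \<Rightarrow> complex"
  assumes "AC_loc f"
  shows "AE x in lebesgue. 0 < x \<longrightarrow> f differentiable (at x)"
proof -
  have *: "AE x in lebesgue. 0 < x \<longrightarrow> g differentiable (at x)" if g: "AC_loc g" for g :: "real \<Rightarrow> real"
  proof -
    \<comment> \<open>\<open>Suc (Suc n)\<close> instead of \<open>Suc n\<close> keeps the interval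
      proper at \<open>n = 0\<close>, as \<open>AC_loc\<close> requires.\<close>
    have "negligible (\<Union>n. {x \<in> {1 / real (Suc n)<..<real (Suc (Suc n))}. \<not> g differentiable (at x)})"
    proof (intro negligible_Union_nat abs_cont_on_differentiable_real)
      fix n
      have "1 / real (Suc n) \<le> 1" by simp
      also have "1 < real (Suc (Suc n))" by simp
      finally have "1 / real (Suc n) < real (Suc (Suc n))" .
      then show "abs_cont_on {1 / real (Suc n)..real (Suc (Suc n))} g" using g unfolding AC_loc_def by simp
    qed
    then have N: "(\<Union>n. {x \<in> {1 / real (Suc n)<..<real (Suc (Suc n))}. \<not> g differentiable (at x)}) \<in> null_sets lebesgue"
      by (simp add: negligible_iff_null_sets)
    show ?thesis
    proof (rule AE_I'[OF N], rule)
      fix x assume "x \<in> {x \<in> space lebesgue. \<not> (0 < x \<longrightarrow> g differentiable at x)}"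
      then have x: "0 < x" "\<not> g differentiable (at x)" by auto
      obtain n where n: "max x (1 / x) < real n" using reals_Archimedean2 by blast
      then have "1 / x < real (Suc n)" by simp
      then have "1 / real (Suc n) < x" using x(1) by (simp add: field_simps)
      then have "x \<in> {1 / real (Suc n)<..<real (Suc (Suc n))}" using n by auto
      then show "x \<in> (\<Union>n. {x \<in> {1 / real (Suc n)<..<real (Suc (Suc n))}. \<not> g differentiable (at x)})"
        using x(2) by blast
    qed
  qed
  have "AE x in lebesgue. 0 < x \<longrightarrow> (\<lambda>x. Re (f x)) differentiable (at x)"
       "AE x in lebesgue. 0 < x \<longrightarrow> (\<lambda>x. Im (f x)) differentiable (at x)"
    by (rule *[OF AC_loc_bounded_linear[OF bounded_linear_Re assms]],
        rule *[OF AC_loc_bounded_linear[OF bounded_linear_Im assms]])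
  then show ?thesis
  proof eventually_elim
    case (elim x)
    show ?case
    proof
      assume "0 < x"
      then obtain r i where "((\<lambda>x. Re (f x)) has_field_derivative r) (at x)" "((\<lambda>x. Im (f x)) has_field_derivative i) (at x)"
        using elim by (auto simp: real_differentiable_def)
      then have "(f has_vector_derivative (Complex r i)) (at x)"
        by (simp add: has_vector_derivative_complex_iff)
      then show "f differentiable (at x)" by (rule differentiableI_vector)
    qed
  qed
qed

lemma negligible_outer_open:
  fixes N :: "real set"
  assumes "negligible N" "0 < e"
  obtains U where "open U" "N \<subseteq> U" "U \<in> lmeasurable" "measure lebesgue U < e"
proof -
  obtain T where T: "open T" "N \<subseteq> T" "T - N \<in> lmeasurable" "emeasure lebesgue (T - N) < ennreal e"
    using sets_lebesgue_outer_open[of N e] negligible_imp_sets assms by metis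
  have eq: "T = N \<union> (T - N)" using T(2) by auto
  have N: "N \<in> lmeasurable" "measure lebesgue N = 0"
    using assms(1) by (auto simp: negligible_imp_measurable negligible_imp_measure0)
  have "measure lebesgue (T - N) < e"
    using T(4) emeasure_eq_measure2[OF T(3)] \<open>0 < e\<close> by (simp only: ennreal_less_iff measure_nonneg)
  then have "T \<in> lmeasurable" "measure lebesgue T < e"
    using N eq measure_Un_le[of N lebesgue "T - N"] fmeasurable.Un[OF N(1) T(3)] T(3)
    by (auto simp: fmeasurableD)
  then show ?thesis using that T by blast
qed

text \<open>
  The gauge is a straddle gauge off \<open>N\<close> and forces intervals tagged in \<open>N\<close> into a small open
  neighbourhood of \<open>N\<close>, where absolute continuity controls the increments.
\<close>

theorem fundamental_theorem_of_calculus_abs_cont: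
  fixes f :: "real \<Rightarrow> 'a::banach"
  assumes ab: "a \<le> b" and ac: "abs_cont_on {a..b} f" and N: "negligible N"
    and der: "\<And>x. x \<in> {a..b} - N \<Longrightarrow> (f has_vector_derivative g x) (at x within {a..b})"
  shows "(g has_integral (f b - f a)) {a..b}"
proof (cases "a = b")
  case True
  then show ?thesis using has_integral_refl(2)[of g b] by (simp add: has_integral_null_eq)
next
  case False
  then have ab: "a < b" using ab by simp
  \<comment> \<open>With value zero on \<open>N\<close>, terms tagged in \<open>N\<close> reduce to
    increments of \<open>f\<close>; the integral does not see the change.\<close>
  define g' where "g' x = (if x \<in> N then 0 else g x)" for x
  have "(g' has_integral (f b - f a)) {a..b}"
    unfolding has_integral_real
  proof (intro allI impI)
    fix e :: real assume e: "0 < e"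
    define e' where "e' = e / (2 * (b - a))"
    have e': "0 < e'" using e ab unfolding e'_def by simp
    obtain d where d: "0 < d" "\<And>D. \<lbrakk>D division_of \<Union>D; \<Union>D \<subseteq> {a..b}; (\<Sum>K\<in>D. measure lborel K) < d\<rbrakk>
        \<Longrightarrow> (\<Sum>K\<in>D. norm (f (Sup K) - f (Inf K))) < e / 2"
      using ac[unfolded abs_cont_on_def, rule_format, of "e / 2"] e by auto
    obtain U where U: "open U" "N \<subseteq> U" "U \<in> lmeasurable" "measure lebesgue U < d"
      using negligible_outer_open[OF N d(1)] by blast
    have "\<exists>r>0. \<forall>y\<in>{a..b}. norm (y - x) < r \<longrightarrow> norm (f y - f x - (y - x) *\<^sub>R g x) \<le> e' * norm (y - x)"
      if "x \<in> {a..b} - N" for x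
      using der[OF that] e' unfolding has_vector_derivative_def has_derivative_within_alt by blast
    then obtain r where r: "\<And>x. x \<in> {a..b} - N \<Longrightarrow> 0 < r x"
      "\<And>x y. x \<in> {a..b} - N \<Longrightarrow> y \<in> {a..b} \<Longrightarrow> norm (y - x) < r x \<Longrightarrow>
         norm (f y - f x - (y - x) *\<^sub>R g x) \<le> e' * norm (y - x)"
      by metis
    define \<gamma> where "\<gamma> x = (if x \<in> N then U else if x \<in> {a..b} then ball x (r x) else UNIV)" for x
    have gauge: "gauge \<gamma>" unfolding gauge_def \<gamma>_def using U r(1) by auto
    have est: "norm ((\<Sum>(x, k)\<in>p. measure lborel k *\<^sub>R g' x) - (f b - f a)) < e"
      if p: "p tagged_division_of {a..b}" and fine: "\<gamma> fine p" for p
    proof -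
      define P where "P = {(x, K). (x, K) \<in> p \<and> x \<in> N}"
      define R where "R = {(x, K). (x, K) \<in> p \<and> x \<notin> N}"
      note pD = tagged_division_ofD[OF p]
      have PR: "p = P \<union> R" "P \<inter> R = {}" "finite P" "finite R"
        using pD(1) unfolding P_def R_def by (auto intro: finite_subset[OF _ pD(1)])
      have K: "\<exists>u v. K = {u..v} \<and> u \<le> v \<and> a \<le> u \<and> v \<le> b \<and> u \<le> x \<and> x \<le> v" if xK: "(x, K) \<in> p" for x K
      proof -
        obtain u v where uv: "K = {u..v}" using pD(4)[OF xK] by auto
        then show ?thesis using pD(2,3)[OF xK] by (intro exI[of _ u] exI[of _ v]) auto
      qed
      let ?\<Delta> = "\<lambda>K. f (Sup K) - f (Inf K)"
      have fba: "f b - f a = (\<Sum>(x, K)\<in>p. ?\<Delta> K)"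
        using additive_tagged_division_1[OF _ p, of f] ab by simp
      have ba: "b - a = (\<Sum>(x, K)\<in>p. Sup K - Inf K)"
        using additive_tagged_division_1[OF _ p, of "\<lambda>x. x"] ab by simp
      have "(\<Sum>(x, k)\<in>p. measure lborel k *\<^sub>R g' x) - (f b - f a) = (\<Sum>(x, K)\<in>p. measure lborel K *\<^sub>R g' x - ?\<Delta> K)"
        unfolding fba by (simp add: sum_subtractf split_def)
      also have "\<dots> = (\<Sum>(x, K)\<in>P. measure lborel K *\<^sub>R g' x - ?\<Delta> K) + (\<Sum>(x, K)\<in>R. measure lborel K *\<^sub>R g' x - ?\<Delta> K)"
        unfolding PR(1) by (rule sum.union_disjoint) (use PR in auto)
      finally have eq: "(\<Sum>(x, k)\<in>p. measure lborel k *\<^sub>R g' x) - (f b - f a) = \<dots>" .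
      have "norm (\<Sum>(x, K)\<in>R. measure lborel K *\<^sub>R g' x - ?\<Delta> K) \<le> (\<Sum>(x, K)\<in>R. e' * (Sup K - Inf K))"
      proof (rule sum_norm_le, clarify)
        fix x K assume xK: "(x, K) \<in> R"
        then have xp: "(x, K) \<in> p" and xN: "x \<notin> N" unfolding R_def by auto
        obtain u v where uv: "K = {u..v}" "u \<le> v" "a \<le> u" "v \<le> b" "u \<le> x" "x \<le> v" using K[OF xp] by blast
        have xab: "x \<in> {a..b} - N" using uv xN by auto
        have "K \<subseteq> \<gamma> x" using fine xp unfolding fine_def by blast
        then have "K \<subseteq> ball x (r x)" using xab unfolding \<gamma>_def by simp
        moreover have "u \<in> K" "v \<in> K" using uv by auto
        ultimately have "u \<in> ball x (r x)" "v \<in> ball x (r x)" by blast+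
        then have close: "norm (u - x) < r x" "norm (v - x) < r x" by (auto simp: dist_real_def)
        have "measure lborel K *\<^sub>R g' x - ?\<Delta> K = (f u - f x - (u - x) *\<^sub>R g x) - (f v - f x - (v - x) *\<^sub>R g x)"
          using uv xN by (simp add: g'_def algebra_simps)
        also have "norm \<dots> \<le> norm (f u - f x - (u - x) *\<^sub>R g x) + norm (f v - f x - (v - x) *\<^sub>R g x)"
          by (rule norm_triangle_ineq4)
        also have "\<dots> \<le> e' * norm (u - x) + e' * norm (v - x)"
          using close uv by (intro add_mono r(2) xab) auto
        also have "\<dots> = e' * (Sup K - Inf K)" using uv by (simp add: algebra_simps)
        finally show "norm (measure lborel K *\<^sub>R g' x - ?\<Delta> K) \<le> e' * (Sup K - Inf K)" .
      qed
      also have "\<dots> \<le> (\<Sum>(x, K)\<in>p. e' * (Sup K - Inf K))"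
      proof (rule sum_mono2[OF pD(1)])
        show "R \<subseteq> p" using PR by auto
        fix z assume "z \<in> p - R"
        then obtain x L where z: "z = (x, L)" "(x, L) \<in> p" by (cases z) auto
        obtain u v where "L = {u..v}" "u \<le> v" using K[OF z(2)] by blast
        then show "0 \<le> (case z of (x, K) \<Rightarrow> e' * (Sup K - Inf K))" using e' z by simp
      qed
      also have "\<dots> = e' * (b - a)" unfolding ba by (simp add: sum_distrib_left split_def)
      also have "\<dots> = e / 2" using ab unfolding e'_def by (simp add: field_simps)
      finally have R_le: "norm (\<Sum>(x, K)\<in>R. measure lborel K *\<^sub>R g' x - ?\<Delta> K) \<le> e / 2" .
      have Ppart: "P tagged_partial_division_of {a..b}"
        using p unfolding tagged_division_of_def P_def
        by (rule_tac tagged_partial_division_subset[of p]) auto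
      have Pdiv: "P tagged_division_of \<Union>(snd ` P)" by (rule tagged_partial_division_of_Union_self[OF Ppart])
      have Sdiv: "snd ` P division_of \<Union>(snd ` P)" by (rule division_of_tagged_division[OF Pdiv])
      have "(\<Sum>K\<in>snd ` P. norm (?\<Delta> K)) < e / 2"
      proof (rule d(2)[OF Sdiv])
        show "\<Union> (snd ` P) \<subseteq> {a..b}" using pD(3) unfolding P_def by fastforce
        have "(\<Sum>K\<in>snd ` P. measure lborel K) = measure lebesgue (\<Union>(snd ` P))"
        proof -
          have "measure lborel K = measure lebesgue K" if "K \<in> snd ` P" for K
            using division_ofD(4)[OF Sdiv that] by auto
          then show ?thesis using content_division[OF Sdiv] by simp
        qed
        also have "\<dots> \<le> measure lebesgue U"
        proof (rule measure_mono_fmeasurable)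
          show "\<Union> (snd ` P) \<subseteq> U"
          proof (rule Union_least)
            fix K assume "K \<in> snd ` P"
            then obtain x where "(x, K) \<in> p" "x \<in> N" unfolding P_def by auto
            then show "K \<subseteq> U" using fineD[OF fine \<open>(x, K) \<in> p\<close>] by (simp add: \<gamma>_def)
          qed
          show "\<Union> (snd ` P) \<in> sets lebesgue" using Sdiv by (metis lmeasurable_division fmeasurableD)
        qed (rule U(3))
        finally show "(\<Sum>K\<in>snd ` P. measure lborel K) < d" using U(4) by simp
      qed
      \<comment> \<open>Passing from tagged pairs to intervals can only identify pairs with the same
        degenerate interval, and those contribute 0. The empty interval gets the value 0 explicitly
        because \<open>Sup\<close> and \<open>Inf\<close> are unspecified there.\<close>
      moreover have "(\<Sum>(x, K)\<in>P. if K = {} then 0 else norm (?\<Delta> K)) = (\<Sum>K\<in>snd ` P. if K = {} then 0 else norm (?\<Delta> K))"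
      proof (rule sum.over_tagged_division_lemma[OF Pdiv])
        fix u v :: real assume "box u v = {}"
        then show "(if cbox u v = {} then 0 else norm (?\<Delta> (cbox u v))) = 0"
          by (cases "u = v") auto
      qed
      moreover have "(\<Sum>K\<in>snd ` P. if K = {} then 0 else norm (?\<Delta> K)) = (\<Sum>K\<in>snd ` P. norm (?\<Delta> K))"
        using division_ofD(3)[OF Sdiv] by (intro sum.cong) auto
      moreover have "norm (\<Sum>(x, K)\<in>P. measure lborel K *\<^sub>R g' x - ?\<Delta> K) \<le> (\<Sum>(x, K)\<in>P. if K = {} then 0 else norm (?\<Delta> K))"
      proof (rule sum_norm_le, clarify)
        fix x L assume xL: "(x, L) \<in> P"
        then have "L \<noteq> {}" "x \<in> N" using K[of x L] unfolding P_def by auto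
        then show "norm (measure lborel L *\<^sub>R g' x - ?\<Delta> L) \<le> (if L = {} then 0 else norm (?\<Delta> L))"
          by (simp add: g'_def norm_minus_commute)
      qed
      ultimately have "norm (\<Sum>(x, K)\<in>P. measure lborel K *\<^sub>R g' x - ?\<Delta> K) < e / 2" by linarith
      then show ?thesis unfolding eq
        using R_le norm_triangle_ineq[of "\<Sum>(x, K)\<in>P. measure lborel K *\<^sub>R g' x - ?\<Delta> K" "\<Sum>(x, K)\<in>R. measure lborel K *\<^sub>R g' x - ?\<Delta> K"]
        by linarith
    qed
    show "\<exists>\<gamma>. gauge \<gamma> \<and> (\<forall>\<D>. \<D> tagged_division_of {a..b} \<and> \<gamma> fine \<D> \<longrightarrow>
        norm ((\<Sum>(x, k)\<in>\<D>. measure lborel k *\<^sub>R g' x) - (f b - f a)) < e)"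
      by (rule exI[of _ \<gamma>], rule conjI[OF gauge], intro allI impI, erule conjE, rule est)
  qed
  then show ?thesis
    by (rule has_integral_spike[OF N, rotated]) (auto simp: g'_def)
qed

text \<open>All interval integrals vanish, so the Henstock lemma bounds the Riemann sums of
  \<open>norm (D x)\<close> over fine divisions by \<open>e\<close>. Hence the norm has integral 0,
  although \<open>D\<close> is a priori only gauge integrable.\<close>

lemma has_integral_zero_on_subintervals:
  fixes D :: "real \<Rightarrow> 'b::euclidean_space"
  assumes z: "\<And>c d. a \<le> c \<Longrightarrow> c \<le> d \<Longrightarrow> d \<le> b \<Longrightarrow> (D has_integral 0) {c..d}"
  shows "AE x in lebesgue. x \<in> {a..b} \<longrightarrow> D x = 0"
proof (cases "a \<le> b")
  case True
  have Dint: "D integrable_on cbox a b" using z[of a b] True by auto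
  have "((\<lambda>x. norm (D x)) has_integral 0) {a..b}"
    unfolding has_integral_real
  proof (intro allI impI)
    fix e :: real assume "0 < e"
    then obtain \<gamma> where \<gamma>: "gauge \<gamma>"
      "\<And>p. p tagged_partial_division_of cbox a b \<Longrightarrow> \<gamma> fine p \<Longrightarrow>
         (\<Sum>(x, k)\<in>p. norm (measure lborel k *\<^sub>R D x - integral k D)) < e"
      using Henstock_lemma[OF Dint] by blast
    show "\<exists>\<gamma>. gauge \<gamma> \<and> (\<forall>\<D>. \<D> tagged_division_of {a..b} \<and> \<gamma> fine \<D> \<longrightarrow>
        norm ((\<Sum>(x, k)\<in>\<D>. measure lborel k *\<^sub>R norm (D x)) - 0) < e)"
    proof (intro exI conjI allI impI)
      fix p assume p: "p tagged_division_of {a..b} \<and> \<gamma> fine p"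
      have "norm ((\<Sum>(x, k)\<in>p. measure lborel k *\<^sub>R norm (D x)) - 0) \<le> (\<Sum>(x, k)\<in>p. norm (measure lborel k *\<^sub>R D x - integral k D))"
        unfolding diff_zero
      proof (rule sum_norm_le, clarify)
        fix x k assume xk: "(x, k) \<in> p"
        obtain u v where uv: "k = {u..v}" using tagged_division_ofD(4)[OF conjunct1[OF p] xk] by auto
        have "u \<le> v" "a \<le> u" "v \<le> b" using tagged_division_ofD(2,3)[OF conjunct1[OF p] xk] uv by auto
        then have "integral k D = 0" unfolding uv by (intro integral_unique z)
        then show "norm (measure lborel k *\<^sub>R norm (D x)) \<le> norm (measure lborel k *\<^sub>R D x - integral k D)" by simp
      qed
      also have "\<dots> < e" by (rule \<gamma>(2)) (use p in \<open>auto simp: tagged_division_of_def\<close>)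
      finally show "norm ((\<Sum>(x, k)\<in>p. measure lborel k *\<^sub>R norm (D x)) - 0) < e" .
    qed (rule \<gamma>(1))
  qed
  then have n: "(\<lambda>x. norm (D x)) integrable_on {a..b}" "integral {a..b} (\<lambda>x. norm (D x)) = 0"
    by (auto intro: integral_unique)
  have s: "set_integrable lebesgue {a..b} (\<lambda>x. norm (D x))"
    by (rule nonnegative_absolutely_integrable_1[OF n(1)]) simp
  then have "(LINT x:{a..b}|lebesgue. norm (D x)) = 0"
    using set_lebesgue_integral_eq_integral(2)[OF s] n(2) by simp
  then have "AE x in lebesgue. indicator {a..b} x *\<^sub>R norm (D x) = 0"
    using s unfolding set_lebesgue_integral_def set_integrable_def
    by (subst (asm) integral_nonneg_eq_0_iff_AE) auto
  then show ?thesis by eventually_elim (auto simp: indicator_def)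
qed simp

text \<open>Truncation of \<open>norm (h x)\<close> at height \<open>n\<close>: the excess has small
  integral over all of \<open>{a..b}\<close>, and the truncated part contributes at most
  \<open>n\<close> times the total length.\<close>

lemma abs_cont_on_indefinite_integral:
  fixes h :: "real \<Rightarrow> 'b::euclidean_space"
  assumes h: "h absolutely_integrable_on {a..b}"
    and F: "\<And>x y. a \<le> x \<Longrightarrow> x \<le> y \<Longrightarrow> y \<le> b \<Longrightarrow> F y - F x = integral {x..y} h"
  shows "abs_cont_on {a..b} F"
  unfolding abs_cont_on_def
proof (intro allI impI)
  fix e :: real assume e: "0 < e"
  define m where "m n x = min (norm (h x)) (real n)" for n x
  have nh: "(\<lambda>x. norm (h x)) integrable_on {a..b}" and hi: "h integrable_on {a..b}"
    using h unfolding absolutely_integrable_on_def by auto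
  have m: "m n integrable_on {a..b}" for n
    unfolding m_def
    by (rule set_lebesgue_integral_eq_integral(1), rule absolutely_integrable_min_1)
      (use nh in \<open>auto simp: absolutely_integrable_on_iff_nonneg\<close>)
  have "(\<lambda>n. integral {a..b} (m n)) \<longlonglongrightarrow> integral {a..b} (\<lambda>x. norm (h x))"
  proof (rule dominated_convergence(2)[OF m nh])
    fix x
    have "\<forall>\<^sub>F n in sequentially. m n x = norm (h x)"
      using eventually_ge_at_top[of "nat \<lceil>norm (h x)\<rceil>"]
      by eventually_elim (simp add: m_def nat_le_iff ceiling_le_iff)
    then show "(\<lambda>n. m n x) \<longlonglongrightarrow> norm (h x)" by (rule tendsto_eventually)
  qed (auto simp: m_def)
  then have "\<forall>\<^sub>F n in sequentially. integral {a..b} (\<lambda>x. norm (h x)) - e / 2 < integral {a..b} (m n)"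
    using e by (intro order_tendstoD) auto
  then obtain n where n: "integral {a..b} (\<lambda>x. norm (h x)) - e / 2 < integral {a..b} (m n)"
    by (auto simp: eventually_sequentially)
  \<comment> \<open>The summand \<open>1\<close> only guards against \<open>n = 0\<close>.\<close>
  define d where "d = e / (2 * (real n + 1))"
  have d: "0 < d" "real n * d \<le> e / 2" using e unfolding d_def by (auto simp: field_simps)
  show "\<exists>d>0. \<forall>D. D division_of \<Union> D \<and> \<Union> D \<subseteq> {a..b} \<and> (\<Sum>K\<in>D. measure lborel K) < d
      \<longrightarrow> (\<Sum>K\<in>D. norm (F (Sup K) - F (Inf K))) < e"
  proof (intro exI conjI allI impI; (elim conjE)?)
    fix D assume D: "D division_of \<Union> D" "\<Union> D \<subseteq> {a..b}" "(\<Sum>K\<in>D. measure lborel K) < d"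
    have Dint: "\<phi> integrable_on \<Union>D" "\<And>K. K \<in> D \<Longrightarrow> \<phi> integrable_on K"
      if "\<phi> integrable_on {a..b}" for \<phi> :: "real \<Rightarrow> 'c::banach"
    proof -
      show K: "\<phi> integrable_on K" if K: "K \<in> D" for K
      proof -
        obtain u v where uv: "K = {u..v}" using division_ofD(4)[OF D(1) K] by auto
        have "{u..v} \<subseteq> {a..b}" using D(2) K uv by blast
        then show ?thesis unfolding uv by (rule integrable_subinterval_real[OF \<open>\<phi> integrable_on {a..b}\<close>])
      qed
      show "\<phi> integrable_on \<Union>D" by (rule integrable_combine_division[OF D(1) K])
    qed
    have "(\<Sum>K\<in>D. norm (F (Sup K) - F (Inf K))) \<le> (\<Sum>K\<in>D. integral K (\<lambda>x. norm (h x)))"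
    proof (rule sum_mono)
      fix K assume K: "K \<in> D"
      obtain u v where uv: "K = {u..v}" "u \<le> v" using division_ofD(3,4)[OF D(1) K] by auto
      have "K \<subseteq> {a..b}" using D(2) K by blast
      then have "a \<le> u" "v \<le> b" using uv by auto
      then have "F (Sup K) - F (Inf K) = integral K h" using F[of u v] uv by simp
      also have "norm \<dots> \<le> integral K (\<lambda>x. norm (h x))"
        by (rule Henstock_Kurzweil_Integration.integral_norm_bound_integral) (use Dint(2)[OF _ K] nh hi in auto)
      finally show "norm (F (Sup K) - F (Inf K)) \<le> integral K (\<lambda>x. norm (h x))" .
    qed
    also have "\<dots> = integral (\<Union>D) (\<lambda>x. norm (h x))"
      by (rule integral_combine_division_topdown[symmetric, OF Dint(1)[OF nh] D(1)])
    also have "\<dots> = integral (\<Union>D) (\<lambda>x. norm (h x) - m n x) + integral (\<Union>D) (m n)"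
      by (subst integral_diff) (use Dint(1) nh m in auto)
    also have "integral (\<Union>D) (\<lambda>x. norm (h x) - m n x) \<le> integral {a..b} (\<lambda>x. norm (h x) - m n x)"
      by (rule integral_subset_le[OF D(2)]) (use Dint(1)[OF nh] Dint(1)[OF m] nh m in \<open>auto intro!: integrable_diff\<close>, simp add: m_def)
    also have "\<dots> = integral {a..b} (\<lambda>x. norm (h x)) - integral {a..b} (m n)"
      by (rule integral_diff[OF nh m])
    also have "integral (\<Union>D) (m n) = (\<Sum>K\<in>D. integral K (m n))"
      by (rule integral_combine_division_topdown[OF Dint(1)[OF m] D(1)])
    also have "\<dots> \<le> (\<Sum>K\<in>D. real n * measure lborel K)"
    proof (rule sum_mono)
      fix K assume K: "K \<in> D"
      obtain u v where uv: "K = cbox u v" using division_ofD(3,4)[OF D(1) K] by auto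
      have "norm (integral K (m n)) \<le> real n * measure lborel K"
        unfolding uv
        by (rule has_integral_bound[OF _ integrable_integral]) (use Dint(2)[OF m K] uv in auto, simp add: m_def)
      then show "integral K (m n) \<le> real n * measure lborel K" by simp
    qed
    also have "\<dots> = real n * (\<Sum>K\<in>D. measure lborel K)" by (simp add: sum_distrib_left)
    also have "\<dots> \<le> real n * d" using D(3) by (intro mult_left_mono) auto
    also have "\<dots> \<le> e / 2" by (rule d(2))
    finally show "(\<Sum>K\<in>D. norm (F (Sup K) - F (Inf K))) < e" using n by simp
  qed (rule d(1))
qed

section \<open>Calculus of almost everywhere derivatives\<close>

text \<open>Carries a locally absolutely continuous function along with one representative of its
  derivative. The representative matters only up to null sets, which suits coefficients that are
  themselves given only almost everywhere.\<close>

definition ac_deriv :: "(real \<Rightarrow> 'a::real_normed_vector) \<Rightarrow> (real \<Rightarrow> 'a) \<Rightarrow> bool" where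
  "ac_deriv f g \<longleftrightarrow> AC_loc f \<and> (AE x in lebesgue. 0 < x \<longrightarrow> (f has_vector_derivative g x) (at x))"

lemma abs_cont_on_imp_continuous_on:
  assumes "abs_cont_on {a..b} f"
  shows "continuous_on {a..b} f"
  unfolding continuous_on_iff
proof (intro ballI allI impI)
  fix x and e :: real assume x: "x \<in> {a..b}" and e: "0 < e"
  obtain d where d: "0 < d" "\<And>D. \<lbrakk>D division_of \<Union>D; \<Union>D \<subseteq> {a..b}; (\<Sum>K\<in>D. measure lborel K) < d\<rbrakk>
      \<Longrightarrow> (\<Sum>K\<in>D. norm (f (Sup K) - f (Inf K))) < e"
    using assms[unfolded abs_cont_on_def, rule_format, OF e] by auto
  have *: "norm (f v - f u) < e" if "u \<le> v" "u \<in> {a..b}" "v \<in> {a..b}" "v - u < d" for u v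
  proof -
    have "{{u..v}} division_of \<Union>{{u..v}}" using that(1) division_of_self[of u v] by simp
    from d(2)[OF this] that show ?thesis by auto
  qed
  show "\<exists>d>0. \<forall>x'\<in>{a..b}. dist x' x < d \<longrightarrow> dist (f x') (f x) < e"
  proof (intro exI[of _ d] conjI ballI impI d(1))
    fix x' assume x': "x' \<in> {a..b}" "dist x' x < d"
    show "dist (f x') (f x) < e"
    proof (cases "x \<le> x'")
      case True
      then show ?thesis using *[OF True x x'(1)] x'(2) by (simp add: dist_norm)
    next
      case False
      then show ?thesis using *[of x' x] x x' by (simp add: dist_norm norm_minus_commute)
    qed
  qed
qed

lemma AC_loc_continuous_on: "AC_loc f \<Longrightarrow> continuous_on {0<..} f"
  unfolding continuous_on_eq_continuous_at[OF open_greaterThan]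
proof
  fix x :: real assume f: "AC_loc f" and "x \<in> {0<..}"
  then have x: "0 < x" by simp
  then have "abs_cont_on {x/2..x+1} f" using f unfolding AC_loc_def by simp
  then have "continuous_on {x/2<..<x+1} f"
    by (rule continuous_on_subset[OF abs_cont_on_imp_continuous_on]) auto
  then show "isCont f x" using x by (simp add: continuous_on_eq_continuous_at)
qed

lemma AC_loc_combine:
  fixes h :: "real \<Rightarrow> 'c::real_normed_vector"
  assumes "AC_loc f" "AC_loc g"
    and "\<And>a b. 0 < a \<Longrightarrow> a < b \<Longrightarrow> \<exists>C. \<forall>x\<in>{a..b}. \<forall>y\<in>{a..b}. norm (h x - h y) \<le> C * (norm (f x - f y) + norm (g x - g y))"
  shows "AC_loc h"
  unfolding AC_loc_def
proof (intro allI impI)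
  fix a b :: real assume ab: "0 < a" "a < b"
  then obtain C where C: "\<forall>x\<in>{a..b}. \<forall>y\<in>{a..b}. norm (h x - h y) \<le> C * (norm (f x - f y) + norm (g x - g y))"
    using assms(3) by blast
  show "abs_cont_on {a..b} h"
    by (rule abs_cont_on_combine[of a b f g h C]) (use assms(1,2) ab C in \<open>auto simp: AC_loc_def\<close>)
qed

lemma continuous_on_bounded_interval:
  fixes f :: "real \<Rightarrow> 'a::real_normed_vector"
  assumes "continuous_on {0<..} f" "0 < a"
  obtains B where "0 \<le> B" "\<And>x. x \<in> {a..b} \<Longrightarrow> norm (f x) \<le> B"
proof -
  have "compact (f ` {a..b})"
    by (rule compact_continuous_image[OF continuous_on_subset[OF assms(1)]]) (use assms(2) in auto)
  then obtain B where "\<forall>y\<in>f ` {a..b}. norm y \<le> B" using compact_imp_bounded bounded_iff by metis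
  then have "norm (f x) \<le> max B 0" if "x \<in> {a..b}" for x
    using that by (force simp: le_max_iff_disj)
  then show ?thesis using that[of "max B 0"] by simp
qed

lemma ac_deriv_add:
  assumes "ac_deriv f f'" "ac_deriv g g'"
  shows "ac_deriv (\<lambda>x. f x + g x) (\<lambda>x. f' x + g' x)"
  unfolding ac_deriv_def
proof
  show "AC_loc (\<lambda>x. f x + g x)"
  proof (rule AC_loc_combine[of f g])
    show "\<exists>C. \<forall>x\<in>{a..b}. \<forall>y\<in>{a..b}. norm (f x + g x - (f y + g y)) \<le> C * (norm (f x - f y) + norm (g x - g y))" for a b
      by (intro exI[of _ 1]) (auto simp: add_diff_add norm_triangle_ineq)
  qed (use assms in \<open>auto simp: ac_deriv_def\<close>)
  show "AE x in lebesgue. 0 < x \<longrightarrow> ((\<lambda>x. f x + g x) has_vector_derivative f' x + g' x) (at x)"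
    using assms[unfolded ac_deriv_def, THEN conjunct2]
    by eventually_elim (auto intro: has_vector_derivative_add)
qed

lemma ac_deriv_mult:
  fixes f g :: "real \<Rightarrow> complex"
  assumes "ac_deriv f f'" "ac_deriv g g'"
  shows "ac_deriv (\<lambda>x. f x * g x) (\<lambda>x. f x * g' x + f' x * g x)"
  unfolding ac_deriv_def
proof
  have ac: "AC_loc f" "AC_loc g" using assms by (auto simp: ac_deriv_def)
  show "AC_loc (\<lambda>x. f x * g x)"
  proof (rule AC_loc_combine[OF ac])
    fix a b :: real assume "0 < a" "a < b"
    obtain A where A: "0 \<le> A" "\<And>x. x \<in> {a..b} \<Longrightarrow> norm (f x) \<le> A"
      using continuous_on_bounded_interval[OF AC_loc_continuous_on[OF ac(1)] \<open>0 < a\<close>] by blast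
    obtain B where B: "0 \<le> B" "\<And>x. x \<in> {a..b} \<Longrightarrow> norm (g x) \<le> B"
      using continuous_on_bounded_interval[OF AC_loc_continuous_on[OF ac(2)] \<open>0 < a\<close>] by blast
    show "\<exists>C. \<forall>x\<in>{a..b}. \<forall>y\<in>{a..b}. norm (f x * g x - f y * g y) \<le> C * (norm (f x - f y) + norm (g x - g y))"
    proof (intro exI[of _ "A + B"] ballI)
      fix x y assume xy: "x \<in> {a..b}" "y \<in> {a..b}"
      have "norm (f x * g x - f y * g y) = norm (f x * (g x - g y) + (f x - f y) * g y)"
        by (simp add: algebra_simps)
      also have "\<dots> \<le> norm (f x) * norm (g x - g y) + norm (f x - f y) * norm (g y)"
        by (rule order_trans[OF norm_triangle_ineq]) (simp add: norm_mult)
      also have "\<dots> \<le> A * norm (g x - g y) + norm (f x - f y) * B"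
        by (intro add_mono mult_right_mono mult_left_mono A B xy) auto
      also have "\<dots> \<le> (A + B) * (norm (f x - f y) + norm (g x - g y))"
        using A(1) B(1) by (simp add: algebra_simps)
      finally show "norm (f x * g x - f y * g y) \<le> (A + B) * (norm (f x - f y) + norm (g x - g y))" .
    qed
  qed
  show "AE x in lebesgue. 0 < x \<longrightarrow> ((\<lambda>x. f x * g x) has_vector_derivative f x * g' x + f' x * g x) (at x)"
    using assms[unfolded ac_deriv_def, THEN conjunct2]
    by eventually_elim (auto intro: has_vector_derivative_mult)
qed

lemma ac_deriv_bounded_linear:
  assumes "bounded_linear L" "ac_deriv f f'"
  shows "ac_deriv (\<lambda>x. L (f x)) (\<lambda>x. L (f' x))"
  unfolding ac_deriv_def
proof
  show "AC_loc (\<lambda>x. L (f x))"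
    using assms by (auto simp: ac_deriv_def intro: AC_loc_bounded_linear)
  show "AE x in lebesgue. 0 < x \<longrightarrow> ((\<lambda>x. L (f x)) has_vector_derivative L (f' x)) (at x)"
    using assms(2)[unfolded ac_deriv_def, THEN conjunct2]
    by eventually_elim (auto intro: bounded_linear.has_vector_derivative[OF assms(1)])
qed

lemma ac_deriv_cmult:
  fixes f :: "real \<Rightarrow> complex"
  assumes "ac_deriv f f'"
  shows "ac_deriv (\<lambda>x. c * f x) (\<lambda>x. c * f' x)"
  by (rule ac_deriv_bounded_linear[OF bounded_linear_mult_right assms])

lemma ac_deriv_diff:
  fixes f g :: "real \<Rightarrow> complex"
  assumes "ac_deriv f f'" "ac_deriv g g'"
  shows "ac_deriv (\<lambda>x. f x - g x) (\<lambda>x. f' x - g' x)"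
  using ac_deriv_add[OF assms(1) ac_deriv_cmult[OF assms(2), of "-1"]] by simp

lemma ac_deriv_inverse:
  fixes f :: "real \<Rightarrow> complex"
  assumes f: "ac_deriv f f'" and nz: "\<And>x. 0 < x \<Longrightarrow> f x \<noteq> 0"
  shows "ac_deriv (\<lambda>x. inverse (f x)) (\<lambda>x. - (inverse (f x) * f' x * inverse (f x)))"
  unfolding ac_deriv_def
proof
  have ac: "AC_loc f" using f by (auto simp: ac_deriv_def)
  have cont: "continuous_on {0<..} (\<lambda>x. inverse (f x))"
    by (intro continuous_on_inverse AC_loc_continuous_on ac) (use nz in auto)
  show "AC_loc (\<lambda>x. inverse (f x))"
  proof (rule AC_loc_combine[OF ac ac])
    fix a b :: real assume a: "0 < a" "a < b"
    obtain A where A: "0 \<le> A" "\<And>x. x \<in> {a..b} \<Longrightarrow> norm (inverse (f x)) \<le> A"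
      using continuous_on_bounded_interval[OF cont \<open>0 < a\<close>] by blast
    show "\<exists>C. \<forall>x\<in>{a..b}. \<forall>y\<in>{a..b}. norm (inverse (f x) - inverse (f y)) \<le> C * (norm (f x - f y) + norm (f x - f y))"
    proof (intro exI[of _ "A * A"] ballI)
      fix x y assume xy: "x \<in> {a..b}" "y \<in> {a..b}"
      have "f x \<noteq> 0" "f y \<noteq> 0" using nz xy a by auto
      then have "norm (inverse (f x) - inverse (f y)) = norm (inverse (f x)) * norm (f x - f y) * norm (inverse (f y))"
        by (subst inverse_diff_inverse) (auto simp: norm_mult)
      also have "\<dots> \<le> A * norm (f x - f y) * A"
        using A(1) by (intro mult_mono A xy) auto
      also have "\<dots> \<le> A * A * (norm (f x - f y) + norm (f x - f y))"
        using A(1) by (simp add: algebra_simps)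
      finally show "norm (inverse (f x) - inverse (f y)) \<le> A * A * (norm (f x - f y) + norm (f x - f y))" .
    qed
  qed
  have *: "((\<lambda>x. inverse (f x)) has_vector_derivative - (inverse (f x) * f' x * inverse (f x))) (at x)"
    if "(f has_vector_derivative f' x) (at x)" "f x \<noteq> 0" for x
    using Deriv.has_derivative_inverse[OF that(2) that(1)[unfolded has_vector_derivative_def]]
    unfolding has_vector_derivative_def by (simp add: algebra_simps scaleR_conv_of_real)
  show "AE x in lebesgue. 0 < x \<longrightarrow> ((\<lambda>x. inverse (f x)) has_vector_derivative - (inverse (f x) * f' x * inverse (f x))) (at x)"
    using f[unfolded ac_deriv_def, THEN conjunct2] by eventually_elim (use * nz in blast)
qed

lemma ac_deriv_ftc:
  fixes f :: "real \<Rightarrow> 'a::banach"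
  assumes "ac_deriv f g" "0 < a" "a \<le> b"
  shows "(g has_integral (f b - f a)) {a..b}"
proof (cases "a = b")
  case True
  then show ?thesis using has_integral_refl(2)[of g b] by simp
next
  case False
  then have ab: "a < b" using assms by simp
  obtain N where "{x \<in> space lebesgue. \<not> (0 < x \<longrightarrow> (f has_vector_derivative g x) (at x))} \<subseteq> N"
      "emeasure lebesgue N = 0" "N \<in> sets lebesgue"
    using assms(1)[unfolded ac_deriv_def, THEN conjunct2] by (rule AE_E)
  then have N: "negligible N" and der: "\<And>x. 0 < x \<Longrightarrow> x \<notin> N \<Longrightarrow> (f has_vector_derivative g x) (at x)"
    by (auto simp: negligible_iff_null_sets)
  show ?thesis
  proof (rule fundamental_theorem_of_calculus_abs_cont[OF assms(3) _ N])
    show "abs_cont_on {a..b} f" using assms ab unfolding ac_deriv_def AC_loc_def by blast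
    show "(f has_vector_derivative g x) (at x within {a..b})" if "x \<in> {a..b} - N" for x
      by (rule has_vector_derivative_at_within, rule der) (use that assms(2) in auto)
  qed
qed

lemma ac_deriv_zero_const:
  fixes f :: "real \<Rightarrow> 'a::banach"
  assumes "ac_deriv f (\<lambda>x. 0)" "0 < x" "0 < y"
  shows "f x = f y"
proof -
  have "f b - f a = 0" if "0 < a" "a \<le> b" for a b
    using has_integral_unique[OF ac_deriv_ftc[OF assms(1) that] has_integral_0] .
  from this[of x y] this[of y x] show ?thesis using assms(2,3) by (cases "x \<le> y") auto
qed

lemma ac_deriv_cong_AE:
  assumes "ac_deriv f g" "AE x in lebesgue. 0 < x \<longrightarrow> g x = h x"
  shows "ac_deriv f h"
  unfolding ac_deriv_def
proof
  show "AE x in lebesgue. 0 < x \<longrightarrow> (f has_vector_derivative h x) (at x)"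
    using assms(1)[unfolded ac_deriv_def, THEN conjunct2] assms(2) by eventually_elim auto
qed (use assms in \<open>auto simp: ac_deriv_def\<close>)

text \<open>\<open>F\<close> is absolutely continuous, so it has some derivative \<open>g\<close>
  almost everywhere and is the integral of \<open>g\<close>. Then \<open>g - h\<close> integrates to
  zero over every compact subinterval and vanishes almost everywhere.\<close>

lemma ac_derivI_indefinite:
  fixes F h :: "real \<Rightarrow> complex"
  assumes h: "\<And>a b. 0 < a \<Longrightarrow> a < b \<Longrightarrow> h absolutely_integrable_on {a..b}"
    and F: "\<And>x y. 0 < x \<Longrightarrow> x \<le> y \<Longrightarrow> F y - F x = integral {x..y} h"
  shows "ac_deriv F h"
proof -
  have AC: "AC_loc F"
    unfolding AC_loc_def
  proof (intro allI impI)
    fix a b :: real assume ab: "0 < a" "a < b"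
    show "abs_cont_on {a..b} F"
    proof (rule abs_cont_on_indefinite_integral[where h=h, OF h[OF ab]])
      fix x y assume "a \<le> x" "x \<le> y"
      then show "F y - F x = integral {x..y} h" using F[of x y] ab by simp
    qed
  qed
  define g where "g x = vector_derivative F (at x)" for x
  have g: "ac_deriv F g"
    unfolding ac_deriv_def
  proof
    show "AE x in lebesgue. 0 < x \<longrightarrow> (F has_vector_derivative g x) (at x)"
      using AC_loc_differentiable[OF AC] by eventually_elim (auto simp: g_def vector_derivative_works)
  qed (rule AC)
  have "AE x in lebesgue. x \<in> {1 / real (Suc n)..real (Suc n)} \<longrightarrow> g x - h x = 0" for n
  proof (rule has_integral_zero_on_subintervals)
    fix c d assume cd: "1 / real (Suc n) \<le> c" "c \<le> d" "d \<le> real (Suc n)"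
    have c: "0 < c" by (rule less_le_trans[OF _ cd(1)]) simp
    have "(h has_integral integral {c..d} h) {c..d}"
    proof (cases "c = d")
      case True then show ?thesis by (simp add: has_integral_refl)
    next
      case False
      then show ?thesis using h[of c d] c cd
        by (intro integrable_integral) (auto simp: set_lebesgue_integral_eq_integral(1))
    qed
    from has_integral_diff[OF ac_deriv_ftc[OF g c cd(2)] this]
    show "((\<lambda>x. g x - h x) has_integral 0) {c..d}" using F[OF c cd(2)] by simp
  qed
  then have "AE x in lebesgue. \<forall>n. x \<in> {1 / real (Suc n)..real (Suc n)} \<longrightarrow> g x - h x = 0"
    by (subst AE_all_countable) blast
  then have "AE x in lebesgue. 0 < x \<longrightarrow> g x = h x"
  proof eventually_elim
    case (elim x)
    show ?case
    proof
      assume x: "0 < x"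
      obtain n where n: "max x (1 / x) < real n" using reals_Archimedean2 by blast
      then have "1 / x < real (Suc n)" by simp
      then have "1 / real (Suc n) < x" using x by (simp add: field_simps)
      then have "x \<in> {1 / real (Suc n)..real (Suc n)}" using n by simp
      then have "g x - h x = 0" using elim by blast
      then show "g x = h x" by simp
    qed
  qed
  then show ?thesis by (rule ac_deriv_cong_AE[OF g])
qed

lemma ac_derivI_C1:
  fixes f f' :: "real \<Rightarrow> complex"
  assumes der: "\<And>x. (f has_vector_derivative f' x) (at x)" and cont: "continuous_on UNIV f'"
  shows "ac_deriv f f'"
proof (rule ac_derivI_indefinite)
  show "f' absolutely_integrable_on {a..b}" for a b
    using absolutely_integrable_continuous[of a b f'] continuous_on_subset[OF cont] by auto
  show "f y - f x = integral {x..y} f'" if "x \<le> y" for x y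
    using fundamental_theorem_of_calculus[OF that has_vector_derivative_at_within[OF der]]
    by (simp add: integral_unique)
qed

section \<open>Jost solutions\<close>

definition tail :: "(real \<Rightarrow> 'a::{banach,second_countable_topology}) \<Rightarrow> real \<Rightarrow> 'a" where
  "tail h x = (LINT t|lborel. indicator {x..} t *\<^sub>R h t)"

lemma tail_diff:
  fixes h :: "real \<Rightarrow> 'a::euclidean_space"
  assumes h: "integrable lborel h" and "x \<le> y"
  shows "tail h y - tail h x = - integral {x..y} h"
proof -
  have si: "set_integrable lborel S h" if "S \<in> sets borel" for S
    using integrable_mult_indicator[OF _ h, of S] that unfolding set_integrable_def by simp
  have "tail h x - tail h y = (LINT t|lborel. indicator {x..} t *\<^sub>R h t - indicator {y..} t *\<^sub>R h t)"
    unfolding tail_def by (rule Bochner_Integration.integral_diff[symmetric]) (use si in \<open>auto simp: set_integrable_def\<close>)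
  also have "\<dots> = (LINT t|lborel. indicator {x..y} t *\<^sub>R h t)"
  proof (rule Bochner_Integration.integral_cong_AE)
    show "AE t in lborel. indicator {x..} t *\<^sub>R h t - indicator {y..} t *\<^sub>R h t = indicator {x..y} t *\<^sub>R h t"
      using AE_lborel_singleton[of y] by eventually_elim (use \<open>x \<le> y\<close> in \<open>auto simp: indicator_def\<close>)
  qed (use h in measurable)
  also have "\<dots> = integral {x..y} h"
    using set_borel_integral_eq_integral(2)[OF si, of "{x..y}"] by (simp add: set_lebesgue_integral_def)
  finally show ?thesis by (simp add: algebra_simps)
qed

lemma ac_deriv_tail:
  fixes h :: "real \<Rightarrow> complex"
  assumes h: "integrable lborel h"
  shows "ac_deriv (tail h) (\<lambda>x. - h x)"
proof (rule ac_derivI_indefinite)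
  have i: "integrable lebesgue (\<lambda>x. - h x)" using h by (simp add: integrable_completion)
  show "(\<lambda>x. - h x) absolutely_integrable_on {a..b}" for a b
    unfolding set_integrable_def by (rule integrable_mult_indicator[OF _ i]) simp
  show "tail h y - tail h x = integral {x..y} (\<lambda>x. - h x)" if "x \<le> y" for x y
    using tail_diff[OF h that] by simp
qed

lemma tail_mono:
  fixes f g :: "real \<Rightarrow> real"
  assumes "integrable lborel f" "integrable lborel g" "\<And>t. x \<le> t \<Longrightarrow> f t \<le> g t"
  shows "tail f x \<le> tail g x"
  unfolding tail_def
  by (intro integral_mono integrable_mult_indicator assms) (auto simp: indicator_def assms(3))

text \<open>A non-integrable \<open>h\<close> has tail 0 by the convention for the Bochner integral,
  so the estimate needs no separate integrability argument where it is applied.\<close>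

lemma norm_tail_le:
  fixes h :: "real \<Rightarrow> complex"
  assumes "\<And>t. x \<le> t \<Longrightarrow> norm (h t) \<le> b t" "integrable lborel b"
  shows "norm (tail h x) \<le> tail b x"
proof (cases "integrable lborel (\<lambda>t. indicator {x..} t *\<^sub>R h t)")
  case True
  have "norm (tail h x) \<le> (LINT t|lborel. norm (indicator {x..} t *\<^sub>R h t))"
    unfolding tail_def by (rule integral_norm_bound)
  also have "\<dots> \<le> tail b x"
    unfolding tail_def
    by (intro integral_mono integrable_norm True integrable_mult_indicator assms(2))
      (auto simp: indicator_def assms(1))
  finally show ?thesis .
next
  case False
  have "0 \<le> tail b x"
    unfolding tail_def
    by (rule Bochner_Integration.integral_nonneg) (auto simp: indicator_def intro: order_trans[OF norm_ge_zero assms(1)])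
  then show ?thesis using False unfolding tail_def by (simp add: not_integrable_integral_eq)
qed

context
  fixes w :: "real \<Rightarrow> real"
  assumes w: "integrable lborel w" and w0: "\<And>t. 0 \<le> w t"
begin

lemma tail_nonneg: "0 \<le> tail w x"
  unfolding tail_def by (rule Bochner_Integration.integral_nonneg) (auto simp: w0)

lemma tail_antimono: "x \<le> y \<Longrightarrow> tail w y \<le> tail w x"
  unfolding tail_def
  by (intro integral_mono integrable_mult_indicator w) (auto simp: indicator_def w0)

lemma tail_le_integral: "tail w x \<le> (LINT t|lborel. w t)"
  unfolding tail_def
  by (intro integral_mono integrable_mult_indicator w) (auto simp: indicator_def w0)

lemma tail_measurable: "tail w \<in> borel_measurable borel"
proof -
  have "mono (\<lambda>x. - tail w x)" by (auto intro!: monoI tail_antimono)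
  then have "(\<lambda>x. - tail w x) \<in> borel_measurable borel" by (rule borel_measurable_mono)
  then have "(\<lambda>x. - (- tail w x)) \<in> borel_measurable borel" by (rule borel_measurable_uminus)
  then show ?thesis by simp
qed

lemma integrable_mult_tail_power: "integrable lborel (\<lambda>t. w t * tail w t ^ n)"
proof (rule Bochner_Integration.integrable_bound)
  let ?W = "LINT t|lborel. w t"
  show "integrable lborel (\<lambda>t. w t * ?W ^ n)" using w by simp
  show "(\<lambda>t. w t * tail w t ^ n) \<in> borel_measurable lborel"
    using w tail_measurable by measurable
  show "AE t in lborel. norm (w t * tail w t ^ n) \<le> norm (w t * ?W ^ n)"
  proof (rule AE_I2)
    fix t
    have "tail w t ^ n \<le> ?W ^ n" by (intro power_mono tail_le_integral tail_nonneg)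
    then have "w t * tail w t ^ n \<le> w t * ?W ^ n" by (rule mult_left_mono) (rule w0)
    moreover have "0 \<le> w t * tail w t ^ n" using w0 tail_nonneg by simp
    ultimately show "norm (w t * tail w t ^ n) \<le> norm (w t * ?W ^ n)" by simp
  qed
qed

lemma tail_tendsto_0: "(tail w \<longlongrightarrow> 0) at_top"
proof -
  have "((\<lambda>y. (LINT t:{0..y}|lborel. w t)) \<longlongrightarrow> (LINT t:{0..}|lborel. w t)) at_top"
    by (rule tendsto_set_lebesgue_integral_at_top)
      (use integrable_mult_indicator[OF _ w, of "{0..}"] in \<open>auto simp: set_integrable_def\<close>)
  moreover have "\<forall>\<^sub>F y in at_top. (LINT t:{0..y}|lborel. w t) = tail w 0 - tail w y"
    using eventually_ge_at_top[of 0]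
  proof eventually_elim
    case (elim y)
    have "set_integrable lborel {0..y} w"
      using integrable_mult_indicator[OF _ w, of "{0..y}"] by (simp add: set_integrable_def)
    from set_borel_integral_eq_integral(2)[OF this] tail_diff[OF w elim] show ?case by simp
  qed
  ultimately have "((\<lambda>y. tail w 0 - tail w y) \<longlongrightarrow> (LINT t:{0..}|lborel. w t)) at_top"
    using tendsto_cong by force
  moreover have "(LINT t:{0..}|lborel. w t) = tail w 0" unfolding tail_def set_lebesgue_integral_def ..
  ultimately have "((\<lambda>y. tail w 0 - (tail w 0 - tail w y)) \<longlongrightarrow> tail w 0 - tail w 0) at_top"
    by (intro tendsto_diff tendsto_const) simp
  then show ?thesis by simp
qed

text \<open>Makes \<open>w x * tail w x ^ n\<close> an exact derivative. It is stated over the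
  complex numbers because the product rule \<open>ac_deriv_mult\<close> is.\<close>

lemma ac_deriv_tail_power:
  "ac_deriv (\<lambda>x. complex_of_real (tail w x) ^ Suc n)
    (\<lambda>x. - (of_nat (Suc n) * complex_of_real (w x * tail w x ^ n)))"
proof (induction n)
  have tc: "complex_of_real (tail w x) = tail (\<lambda>t. complex_of_real (w t)) x" for x
    unfolding tail_def by (simp add: scaleR_conv_of_real flip: of_real_mult)
  have i: "integrable lborel (\<lambda>t. complex_of_real (w t))" using w by simp
  have 1: "ac_deriv (\<lambda>x. complex_of_real (tail w x)) (\<lambda>x. - complex_of_real (w x))"
    unfolding tc using ac_deriv_tail[OF i] by simp
  case 0
  then show ?case using 1 by simp
  case (Suc n)
  have "ac_deriv (\<lambda>x. complex_of_real (tail w x) ^ Suc (Suc n))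
    (\<lambda>x. complex_of_real (tail w x) * - (of_nat (Suc n) * complex_of_real (w x * tail w x ^ n))
      + - complex_of_real (w x) * complex_of_real (tail w x) ^ Suc n)"
    using ac_deriv_mult[OF 1 Suc.IH] by (simp only: power_Suc[of _ "Suc n"])
  then show ?case
    by (rule ac_deriv_cong_AE) (simp add: algebra_simps)
qed

text \<open>Up to sign and the factor \<open>Suc n\<close> the integrand is the derivative of
  \<open>tail w ^ Suc n\<close>. The division by \<open>Suc n\<close> gained in each iteration
  builds up the factorial, so the Volterra series converges without any smallness of the
  coefficients. The exact derivative is available on the open half line, whence
  \<open>0 < x\<close>.\<close>

lemma tail_mult_tail_power_le:
  assumes x: "0 < x"
  shows "tail (\<lambda>t. w t * tail w t ^ n) x \<le> tail w x ^ Suc n / real (Suc n)"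
proof -
  let ?h = "\<lambda>t. w t * tail w t ^ n"
  have si: "set_integrable lborel S ?h" if "S \<in> sets borel" for S
    using integrable_mult_indicator[OF _ integrable_mult_tail_power, of S n] that by (simp add: set_integrable_def)
  have "(LINT t:{x..y}|lborel. ?h t) \<le> tail w x ^ Suc n / real (Suc n)" if xy: "x \<le> y" for y
  proof -
    have "((\<lambda>t. - (of_nat (Suc n) * complex_of_real (?h t))) has_integral
        (complex_of_real (tail w y) ^ Suc n - complex_of_real (tail w x) ^ Suc n)) {x..y}"
      by (rule ac_deriv_ftc[OF ac_deriv_tail_power x xy])
    from has_integral_linear[OF this bounded_linear_Re]
    have "((\<lambda>t. - (real (Suc n) * ?h t)) has_integral (tail w y ^ Suc n - tail w x ^ Suc n)) {x..y}"
      by (simp add: o_def flip: of_real_power of_real_mult of_real_diff)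
    note has_integral_mult_right[OF this, of "- 1 / real (Suc n)"]
    moreover have "- 1 / real (Suc n) * - (real (Suc n) * ?h t) = ?h t" for t by simp
    ultimately have "(?h has_integral - 1 / real (Suc n) * (tail w y ^ Suc n - tail w x ^ Suc n)) {x..y}"
      by (simp only:)
    then have "integral {x..y} ?h = - 1 / real (Suc n) * (tail w y ^ Suc n - tail w x ^ Suc n)"
      by (rule integral_unique)
    also have "\<dots> = (tail w x ^ Suc n - tail w y ^ Suc n) / real (Suc n)" by (simp add: field_simps)
    also have "\<dots> \<le> tail w x ^ Suc n / real (Suc n)"
      using tail_nonneg[of y] by (intro divide_right_mono) auto
    finally show ?thesis using set_borel_integral_eq_integral(2)[OF si, of "{x..y}"] by simp
  qed
  moreover have "((\<lambda>y. (LINT t:{x..y}|lborel. ?h t)) \<longlongrightarrow> (LINT t:{x..}|lborel. ?h t)) at_top"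
    by (rule tendsto_set_lebesgue_integral_at_top) (use si in auto)
  ultimately have "(LINT t:{x..}|lborel. ?h t) \<le> tail w x ^ Suc n / real (Suc n)"
    by (intro tendsto_upperbound) (auto intro: eventually_mono[OF eventually_ge_at_top[of x]])
  then show ?thesis unfolding tail_def set_lebesgue_integral_def .
qed

end

text \<open>Dominated convergence along sequences in \<open>(k, x)\<close>: the moving indicator
  converges at every \<open>t\<close> except the limit of the lower endpoints, a null set. The bound
  is asked only for \<open>x \<le> t\<close>, where the phase of the Volterra kernel is
  bounded.\<close>

lemma continuous_on_tail_parametric:
  fixes H :: "complex \<Rightarrow> real \<Rightarrow> real \<Rightarrow> complex"
  assumes cont: "\<And>t. continuous_on (K \<times> UNIV) (\<lambda>(k, x). H k x t)"
    and meas: "\<And>k x. k \<in> K \<Longrightarrow> H k x \<in> borel_measurable borel"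
    and bound: "\<And>k x t. k \<in> K \<Longrightarrow> x \<le> t \<Longrightarrow> norm (H k x t) \<le> b t"
    and b: "integrable lborel b"
  shows "continuous_on (K \<times> UNIV) (\<lambda>(k, x). tail (H k x) x)"
proof (rule continuous_on_sequentiallyI)
  fix u :: "nat \<Rightarrow> complex \<times> real" and a assume u: "\<forall>n. u n \<in> K \<times> UNIV" "a \<in> K \<times> UNIV" "u \<longlonglongrightarrow> a"
  have uK: "fst (u n) \<in> K" "fst a \<in> K" for n using u by (auto simp: mem_Times_iff)
  have "(\<lambda>n. tail (H (fst (u n)) (snd (u n))) (snd (u n))) \<longlonglongrightarrow> tail (H (fst a) (snd a)) (snd a)"
    unfolding tail_def
  \<comment> \<open>Below the lower endpoints nothing is known about the sign of
    \<open>b\<close>.\<close>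
  proof (rule integral_dominated_convergence[where w="\<lambda>t. \<bar>b t\<bar>"])
    show "(\<lambda>t. indicat_real {snd a..} t *\<^sub>R H (fst a) (snd a) t) \<in> borel_measurable lborel"
      using meas[OF uK(2)] by measurable
    show "(\<lambda>t. indicat_real {snd (u n)..} t *\<^sub>R H (fst (u n)) (snd (u n)) t) \<in> borel_measurable lborel" for n
      using meas[OF uK(1)[of n]] by measurable
    show "integrable lborel (\<lambda>t. \<bar>b t\<bar>)" using b by simp
    show "AE t in lborel. norm (indicat_real {snd (u n)..} t *\<^sub>R H (fst (u n)) (snd (u n)) t) \<le> \<bar>b t\<bar>" for n
      by (rule AE_I2) (auto simp: indicator_def intro: order_trans[OF bound[OF uK(1)]])
    show "AE t in lborel. (\<lambda>n. indicat_real {snd (u n)..} t *\<^sub>R H (fst (u n)) (snd (u n)) t)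
        \<longlonglongrightarrow> indicat_real {snd a..} t *\<^sub>R H (fst a) (snd a) t"
      using AE_lborel_singleton[of "snd a"]
    proof eventually_elim
      case (elim t)
      have H: "(\<lambda>n. H (fst (u n)) (snd (u n)) t) \<longlonglongrightarrow> H (fst a) (snd a) t"
        using cont[of t] u unfolding continuous_on_sequentially by (auto simp: o_def split_beta)
      have sn: "(\<lambda>n. snd (u n)) \<longlonglongrightarrow> snd a" by (rule tendsto_snd[OF u(3)])
      have "\<forall>\<^sub>F n in sequentially. indicat_real {snd (u n)..} t = indicat_real {snd a..} t"
      proof (cases "snd a < t")
        case True
        show ?thesis using order_tendstoD(2)[OF sn True] by eventually_elim (use True in \<open>auto simp: indicator_def\<close>)
      next
        case False
        then have lt: "t < snd a" using elim by simp
        show ?thesis using order_tendstoD(1)[OF sn lt] by eventually_elim (use False elim in \<open>auto simp: indicator_def\<close>)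
      qed
      then have "(\<lambda>n. indicat_real {snd (u n)..} t) \<longlonglongrightarrow> indicat_real {snd a..} t" by (rule tendsto_eventually)
      from tendsto_scaleR[OF this H] show ?case .
    qed
  qed
  then show "(\<lambda>n. (\<lambda>(k, x). tail (H k x) x) (u n)) \<longlonglongrightarrow> (\<lambda>(k, x). tail (H k x) x) a"
    by (simp add: split_beta)
qed

section \<open>The Volterra series\<close>

text \<open>Closed, so that it contains the real axis where boundary values are taken; the disc
  about 0 is removed because the kernel contains \<open>1 / (2 * \<i> * k)\<close>, and
  \<open>r\<close> makes all estimates uniform in \<open>k\<close>.\<close>

definition upper :: "real \<Rightarrow> complex set" where
  "upper r = {k. 0 \<le> Im k \<and> r \<le> norm k}"

text \<open>\<open>s\<close> and \<open>q\<close> stand for Borel representatives of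
  \<open>\<sigma>\<close> and \<open>\<sigma>^2 - \<tau>\<close>, set to zero for
  \<open>x <= 0\<close>. Tail integrals then make sense and are continuous on the whole line, in
  particular at \<open>0\<close>.\<close>

locale short_range =
  fixes s q :: "real \<Rightarrow> real"
  assumes s: "integrable lborel s" and q: "integrable lborel q"
    and s0: "\<And>x. x \<le> 0 \<Longrightarrow> s x = 0" and q0: "\<And>x. x \<le> 0 \<Longrightarrow> q x = 0"
begin

lemma s_measurable[measurable]: "s \<in> borel_measurable borel" using s by auto
lemma q_measurable[measurable]: "q \<in> borel_measurable borel" using q by auto

definition om :: "real \<Rightarrow> real" where "om t = \<bar>s t\<bar> + \<bar>q t\<bar>"

lemma om: "integrable lborel om" "0 \<le> om t"
  unfolding om_def using s q by auto

text \<open>With \<open>Y = (P, R)\<close>, the quotient is \<open>u\<close> without its exponential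
  factor. The system becomes \<open>P' = - 2ik P - kP\<close> and \<open>R' = - kR\<close>:
  \<open>s\<close> couples the two amplitudes crosswise, while \<open>q\<close> enters both
  equations through \<open>u\<close>.\<close>

definition kP :: "complex \<Rightarrow> real \<Rightarrow> complex \<times> complex \<Rightarrow> complex" where
  "kP k t Y = of_real (s t) * snd Y + of_real (q t) * ((snd Y - fst Y) / (2 * \<i> * k))"

definition kR :: "complex \<Rightarrow> real \<Rightarrow> complex \<times> complex \<Rightarrow> complex" where
  "kR k t Y = of_real (s t) * fst Y + of_real (q t) * ((snd Y - fst Y) / (2 * \<i> * k))"

abbreviation phase :: "complex \<Rightarrow> real \<Rightarrow> complex" where "phase k t \<equiv> exp (2 * \<i> * k * of_real t)"

text \<open>
  In terms of \<open>v - iku = e\<^bsup>ikx\<^esup>P\<close> and \<open>v + iku = e\<^bsup>ikx\<^esup>R\<close> the system and the conditions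
  \<open>P \<longrightarrow> 0\<close>, \<open>R \<longrightarrow> 1\<close> at infinity become a Volterra equation with bounded phase; \<open>J n\<close> is
  the \<open>n\<close>-th term \<open>(P, R)\<close> of its Neumann series.
\<close>

primrec J :: "nat \<Rightarrow> complex \<Rightarrow> real \<Rightarrow> complex \<times> complex" where
  "J 0 = (\<lambda>k x. (0, 1))"
| "J (Suc n) = (\<lambda>k x. (tail (\<lambda>t. phase k (t - x) * kP k t (J n k t)) x,
                       tail (\<lambda>t. kR k t (J n k t)) x))"

definition JP :: "complex \<Rightarrow> real \<Rightarrow> complex" where "JP k x = (\<Sum>n. fst (J n k x))"
definition JR :: "complex \<Rightarrow> real \<Rightarrow> complex" where "JR k x = (\<Sum>n. snd (J n k x))"

abbreviation PR :: "complex \<Rightarrow> real \<Rightarrow> complex \<times> complex" where "PR k x \<equiv> (JP k x, JR k x)"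

context
  fixes r :: real assumes r: "0 < r"
begin

text \<open>The term with \<open>s\<close> contributes the 1, and the term with \<open>q\<close>
  contributes \<open>1 / r\<close>, since two components of size \<open>M\<close> are divided by
  \<open>2 * norm k\<close>.\<close>

definition kC :: real where "kC = 1 + 1 / r"

lemma kC_pos: "0 < kC" unfolding kC_def using r by (simp add: add_pos_pos)

lemma norm_kernel:
  assumes k: "k \<in> upper r" and Y: "norm (fst Y) \<le> M" "norm (snd Y) \<le> M"
  shows "norm (kP k t Y) \<le> kC * om t * M" "norm (kR k t Y) \<le> kC * om t * M"
proof -
  have M: "0 \<le> M" using Y(1) norm_ge_zero order_trans by blast
  have k0: "r \<le> norm k" using k unfolding upper_def by simp
  have "norm ((snd Y - fst Y) / (2 * \<i> * k)) = norm (snd Y - fst Y) / (2 * norm k)"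
    by (simp add: norm_divide norm_mult)
  also have "\<dots> \<le> (M + M) / (2 * r)"
    using k0 r Y M by (intro frac_le order_trans[OF norm_triangle_ineq4] add_mono) auto
  finally have d: "norm ((snd Y - fst Y) / (2 * \<i> * k)) \<le> M / r" by simp
  have *: "norm (of_real (s t) * y + of_real (q t) * ((snd Y - fst Y) / (2 * \<i> * k))) \<le> kC * om t * M"
    if "norm y \<le> M" for y
  proof -
    have "norm (of_real (s t) * y + of_real (q t) * ((snd Y - fst Y) / (2 * \<i> * k)))
        \<le> \<bar>s t\<bar> * norm y + \<bar>q t\<bar> * norm ((snd Y - fst Y) / (2 * \<i> * k))"
      by (rule order_trans[OF norm_triangle_ineq]) (simp only: norm_mult norm_of_real order_refl)
    also have "\<dots> \<le> \<bar>s t\<bar> * M + \<bar>q t\<bar> * (M / r)"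
      by (intro add_mono mult_left_mono that d) auto
    also have "\<dots> \<le> kC * om t * M"
      using M r unfolding kC_def om_def by (simp add: algebra_simps)
    finally show ?thesis .
  qed
  show "norm (kP k t Y) \<le> kC * om t * M" unfolding kP_def by (rule *[OF Y(2)])
  show "norm (kR k t Y) \<le> kC * om t * M" unfolding kR_def by (rule *[OF Y(1)])
qed

text \<open>\<open>Im k \<ge> 0\<close> and \<open>t \<ge> x\<close> work together; this is why
  \<open>P\<close> is recovered by integrating from infinity.\<close>

lemma norm_phase:
  assumes "k \<in> upper r" "x \<le> t"
  shows "norm (phase k (t - x)) \<le> 1"
proof -
  have "Re (2 * \<i> * k * of_real (t - x)) = - (2 * Im k * (t - x))" by simp
  also have "\<dots> \<le> 0" using assms unfolding upper_def by simp
  finally show ?thesis unfolding norm_exp_eq_Re by simp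
qed

lemma continuous_on_kernel:
  assumes "continuous_on (upper r) (\<lambda>k. Y k)"
  shows "continuous_on (upper r) (\<lambda>k. kP k t (Y k))" "continuous_on (upper r) (\<lambda>k. kR k t (Y k))"
proof -
  have nz: "2 * \<i> * k \<noteq> 0" if "k \<in> upper r" for k using that r unfolding upper_def by auto
  show "continuous_on (upper r) (\<lambda>k. kP k t (Y k))" "continuous_on (upper r) (\<lambda>k. kR k t (Y k))"
    unfolding kP_def kR_def by (intro continuous_intros assms; use nz in auto)+
qed

abbreviation "W \<equiv> LINT t|lborel. om t"

lemma measurable_kernel:
  assumes Y: "Y \<in> borel_measurable borel"
  shows "(\<lambda>t. kP k t (Y t)) \<in> borel_measurable borel" "(\<lambda>t. kR k t (Y t)) \<in> borel_measurable borel"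
proof -
  have [measurable]: "(\<lambda>t. fst (Y t)) \<in> borel_measurable borel" "(\<lambda>t. snd (Y t)) \<in> borel_measurable borel"
    using borel_measurable_continuous_onI[OF continuous_on_fst[OF continuous_on_id]]
      borel_measurable_continuous_onI[OF continuous_on_snd[OF continuous_on_id]] Y
    by (auto intro: measurable_compose)
  show "(\<lambda>t. kP k t (Y t)) \<in> borel_measurable borel" "(\<lambda>t. kR k t (Y t)) \<in> borel_measurable borel"
    unfolding kP_def kR_def by measurable
qed

text \<open>Continuity of a term by dominated convergence needs the bound on the preceding one, so
  all claims go through one induction. The sharp factorial bound holds for \<open>0 < x\<close>. The
  second bound covers every real \<open>x\<close>, including \<open>0\<close>: the outermost
  integral is estimated crudely, which loses one factor of the factorial (\<open>n - 1\<close> is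
  truncated, so \<open>n = 0\<close> gives \<open>fact 0\<close>).\<close>

lemma J_properties:
  "continuous_on (upper r \<times> UNIV) (\<lambda>(k, x). J n k x) \<and>
   (\<forall>k\<in>upper r. \<forall>x>0. norm (fst (J n k x)) \<le> (kC * tail om x) ^ n / fact n
        \<and> norm (snd (J n k x)) \<le> (kC * tail om x) ^ n / fact n) \<and>
   (\<forall>k\<in>upper r. \<forall>x. norm (fst (J n k x)) \<le> (kC * W) ^ n / fact (n - 1)
        \<and> norm (snd (J n k x)) \<le> (kC * W) ^ n / fact (n - 1))"
proof (induction n)
  case 0
  then show ?case by (auto intro!: continuous_intros simp: split_beta)
next
  case (Suc n)
  have cJ: "continuous_on (upper r \<times> UNIV) (\<lambda>(k, x). J n k x)" using Suc by blast
  have bJ: "norm (fst (J n k x)) \<le> (kC * tail om x) ^ n / fact n"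
    "norm (snd (J n k x)) \<le> (kC * tail om x) ^ n / fact n" if "k \<in> upper r" "0 < x" for k x
    using Suc that by blast+
  \<comment> \<open>The sharp bound for the previous term multiplied by the kernel bound: a majorant
    independent of \<open>k\<close> and \<open>x\<close>.\<close>
  define b where "b t = kC ^ Suc n / fact n * (om t * tail om t ^ n)" for t
  have b: "integrable lborel b"
    unfolding b_def by (intro integrable_mult_right integrable_mult_tail_power om)
  have cJk: "continuous_on (upper r) (\<lambda>k. J n k t)" for t
  proof -
    have "continuous_on (upper r) ((\<lambda>(k, x). J n k x) \<circ> (\<lambda>k. (k, t)))"
      by (intro continuous_on_compose continuous_intros continuous_on_subset[OF cJ]) auto
    then show ?thesis by (simp add: o_def)
  qed
  have cJx: "J n k \<in> borel_measurable borel" if "k \<in> upper r" for k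
  proof -
    have "continuous_on UNIV ((\<lambda>(k, x). J n k x) \<circ> (\<lambda>t. (k, t)))"
      by (intro continuous_on_compose continuous_intros continuous_on_subset[OF cJ]) (use that in auto)
    then show ?thesis by (intro borel_measurable_continuous_onI) (simp add: o_def)
  qed
  have AB: "norm (kP k t (J n k t)) \<le> b t" "norm (kR k t (J n k t)) \<le> b t" if k: "k \<in> upper r" for k t
  proof -
    have "norm (kP k t (J n k t)) \<le> b t \<and> norm (kR k t (J n k t)) \<le> b t"
    proof (cases "0 < t")
      case True
      have "kC * om t * ((kC * tail om t) ^ n / fact n) = b t" by (simp add: b_def power_mult_distrib)
      then show ?thesis using norm_kernel[OF k bJ[OF k True], of t] by metis
    next
      case False
      then have "s t = 0" "q t = 0" using s0 q0 by auto
      then show ?thesis by (simp add: kP_def kR_def b_def om_def)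
    qed
    then show "norm (kP k t (J n k t)) \<le> b t" "norm (kR k t (J n k t)) \<le> b t" by auto
  qed
  have EA: "norm (phase k (t - x) * kP k t (J n k t)) \<le> b t" if "k \<in> upper r" "x \<le> t" for k x t
  proof -
    have "norm (phase k (t - x) * kP k t (J n k t)) \<le> 1 * b t"
      unfolding norm_mult by (intro mult_mono norm_phase AB that) auto
    then show ?thesis by simp
  qed
  have c1: "continuous_on (upper r \<times> UNIV) (\<lambda>(k, x). tail (\<lambda>t. phase k (t - x) * kP k t (J n k t)) x)"
  proof (rule continuous_on_tail_parametric[OF _ _ EA b])
    fix t
    have "continuous_on (upper r \<times> UNIV) (\<lambda>kx :: complex \<times> real. kP (fst kx) t (J n (fst kx) t))"
      by (rule continuous_on_compose2[OF continuous_on_kernel(1)[OF cJk]]) (auto intro!: continuous_intros)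
    then show "continuous_on (upper r \<times> UNIV) (\<lambda>(k, x). phase k (t - x) * kP k t (J n k t))"
      unfolding split_beta by (intro continuous_intros)
  next
    fix k x assume k: "k \<in> upper r"
    have "(\<lambda>t. phase k (t - x)) \<in> borel_measurable borel"
      by (intro borel_measurable_continuous_onI continuous_intros)
    then show "(\<lambda>t. phase k (t - x) * kP k t (J n k t)) \<in> borel_measurable borel"
      by (intro borel_measurable_times measurable_kernel(1)[OF cJx[OF k]])
  qed
  have c2: "continuous_on (upper r \<times> UNIV) (\<lambda>(k, x :: real). tail (\<lambda>t. kR k t (J n k t)) x)"
  proof (rule continuous_on_tail_parametric[OF _ _ AB(2) b])
    fix t
    have "continuous_on (upper r \<times> UNIV) (\<lambda>kx :: complex \<times> real. kR (fst kx) t (J n (fst kx) t))"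
      by (rule continuous_on_compose2[OF continuous_on_kernel(2)[OF cJk]]) (auto intro!: continuous_intros)
    then show "continuous_on (upper r \<times> UNIV) (\<lambda>(k, x :: real). kR k t (J n k t))"
      unfolding split_beta .
  next
    show "(\<lambda>t. kR k t (J n k t)) \<in> borel_measurable borel" if "k \<in> upper r" for k
      by (rule measurable_kernel(2)[OF cJx[OF that]])
  qed
  have le: "norm (fst (J (Suc n) k x)) \<le> tail b x" "norm (snd (J (Suc n) k x)) \<le> tail b x" if k: "k \<in> upper r" for k x
    using norm_tail_le[OF EA[OF k] b] norm_tail_le[OF AB(2)[OF k] b] by auto
  have tb: "tail b x = kC ^ Suc n / fact n * tail (\<lambda>t. om t * tail om t ^ n) x" for x
    unfolding tail_def b_def by (simp flip: Bochner_Integration.integral_mult_right_zero)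
       (simp add: algebra_simps)
  have "tail b x \<le> (kC * tail om x) ^ Suc n / fact (Suc n)" if "0 < x" for x
  proof -
    have "tail b x \<le> kC ^ Suc n / fact n * (tail om x ^ Suc n / real (Suc n))"
      unfolding tb using kC_pos that by (intro mult_left_mono tail_mult_tail_power_le om) auto
    also have "\<dots> = (kC * tail om x) ^ Suc n / fact (Suc n)"
      by (simp add: power_mult_distrib field_simps)
    finally show ?thesis .
  qed
  moreover have "tail b x \<le> (kC * W) ^ Suc n / fact n" for x
  proof -
    have "tail (\<lambda>t. om t * tail om t ^ n) x \<le> tail (\<lambda>t. om t * W ^ n) x"
      by (intro tail_mono integrable_mult_tail_power integrable_mult_left mult_left_mono power_mono tail_le_integral tail_nonneg om)
    also have "\<dots> = tail om x * W ^ n"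
      unfolding tail_def by (simp flip: Bochner_Integration.integral_mult_left_zero add: mult.assoc)
    also have "\<dots> \<le> W * W ^ n"
      by (intro mult_right_mono tail_le_integral om zero_le_power Bochner_Integration.integral_nonneg)
    finally have "tail b x \<le> kC ^ Suc n / fact n * (W * W ^ n)"
      unfolding tb using kC_pos by (intro mult_left_mono) auto
    then show ?thesis by (simp add: power_mult_distrib mult_ac)
  qed
  ultimately show ?case
    using le order_trans[OF le(1)] order_trans[OF le(2)] continuous_on_Pair[OF c1[unfolded split_beta] c2[unfolded split_beta]]
    by (auto simp: split_beta)
qed

lemma J_continuous: "continuous_on (upper r \<times> UNIV) (\<lambda>(k, x). J n k x)"
  using J_properties by blast

lemma J_bound:
  assumes "k \<in> upper r"
  shows "0 < x \<Longrightarrow> norm (fst (J n k x)) \<le> (kC * tail om x) ^ n / fact n"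
    "0 < x \<Longrightarrow> norm (snd (J n k x)) \<le> (kC * tail om x) ^ n / fact n"
    "norm (fst (J n k x)) \<le> (kC * W) ^ n / fact (n - 1)"
    "norm (snd (J n k x)) \<le> (kC * W) ^ n / fact (n - 1)"
  using J_properties assms by blast+

lemma summable_bound: "summable (\<lambda>n. (kC * W) ^ n / fact (n - 1))"
proof -
  have "summable (\<lambda>n. (kC * W) * ((kC * W) ^ n / fact n))"
    using summable_exp[of "kC * W"] by (intro summable_mult) (simp add: divide_inverse mult.commute)
  then have "summable (\<lambda>n. (kC * W) ^ Suc n / fact (Suc n - 1))" by simp
  then show ?thesis by (subst (asm) summable_Suc_iff)
qed

lemma J_summable:
  assumes "k \<in> upper r"
  shows "summable (\<lambda>n. norm (fst (J n k x)))" "summable (\<lambda>n. norm (snd (J n k x)))"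
  by (rule summable_comparison_test'[OF summable_bound, of 0], use J_bound(3,4)[OF assms] in simp)+

lemma J_sums:
  assumes "k \<in> upper r"
  shows "(\<lambda>n. fst (J n k x)) sums JP k x" "(\<lambda>n. snd (J n k x)) sums JR k x"
  unfolding JP_def JR_def using J_summable[OF assms] by (auto intro: summable_sums summable_norm_cancel)

lemma JPR_continuous:
  "continuous_on (upper r \<times> UNIV) (\<lambda>(k, x). JP k x)"
  "continuous_on (upper r \<times> UNIV) (\<lambda>(k, x). JR k x)"
proof -
  have "uniform_limit (upper r \<times> UNIV) (\<lambda>n kx. \<Sum>i<n. fst (J i (fst kx) (snd kx))) (\<lambda>kx. \<Sum>i. fst (J i (fst kx) (snd kx))) sequentially"
    by (rule Weierstrass_m_test[OF _ summable_bound]) (use J_bound(3) in auto)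
  then show "continuous_on (upper r \<times> UNIV) (\<lambda>(k, x). JP k x)"
    unfolding JP_def split_beta
    by (rule uniform_limit_theorem[rotated])
      (auto intro!: always_eventually continuous_intros J_continuous[unfolded split_beta])
  have "uniform_limit (upper r \<times> UNIV) (\<lambda>n kx. \<Sum>i<n. snd (J i (fst kx) (snd kx))) (\<lambda>kx. \<Sum>i. snd (J i (fst kx) (snd kx))) sequentially"
    by (rule Weierstrass_m_test[OF _ summable_bound]) (use J_bound(4) in auto)
  then show "continuous_on (upper r \<times> UNIV) (\<lambda>(k, x). JR k x)"
    unfolding JR_def split_beta
    by (rule uniform_limit_theorem[rotated])
      (auto intro!: always_eventually continuous_intros J_continuous[unfolded split_beta])
qed

text \<open>The term of index 0 is \<open>(0, 1)\<close>; the remaining ones are dominated by the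
  exponential series without its constant term. This gives the asymptotics, since
  \<open>tail om x\<close> tends to 0.\<close>

lemma JPR_bound:
  assumes k: "k \<in> upper r" and x: "0 < x"
  shows "norm (JP k x) \<le> exp (kC * tail om x) - 1" "norm (JR k x - 1) \<le> exp (kC * tail om x) - 1"
proof -
  let ?a = "\<lambda>n. (kC * tail om x) ^ Suc n / fact (Suc n)"
  have "(\<lambda>n. (kC * tail om x) ^ n / fact n) sums exp (kC * tail om x)"
    using exp_converges[of "kC * tail om x"] by (simp add: divide_inverse mult.commute)
  then have e: "?a sums (exp (kC * tail om x) - 1)"
    by (subst sums_Suc_iff) simp
  have "(\<lambda>n. fst (J (Suc n) k x)) sums JP k x"
    using J_sums(1)[OF k, of x] by (subst sums_Suc_iff) simp
  then show "norm (JP k x) \<le> exp (kC * tail om x) - 1"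
    using norm_suminf_le[OF J_bound(1)[OF k x] sums_summable[OF e]] e by (simp add: sums_iff del: J.simps)
  have "(\<lambda>n. snd (J (Suc n) k x)) sums (JR k x - 1)"
    using J_sums(2)[OF k, of x] by (subst sums_Suc_iff) simp
  then show "norm (JR k x - 1) \<le> exp (kC * tail om x) - 1"
    using norm_suminf_le[OF J_bound(2)[OF k x] sums_summable[OF e]] e by (simp add: sums_iff del: J.simps)
qed

end

end

section \<open>Integral and differential equations for the Jost solution, and its current\<close>

lemma tail_sums:
  fixes f :: "nat \<Rightarrow> real \<Rightarrow> complex"
  assumes meas: "\<And>n. f n \<in> borel_measurable borel"
    and bound: "\<And>n t. x \<le> t \<Longrightarrow> norm (f n t) \<le> c n * w t"
    and c: "summable c" and w: "integrable lborel w"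
    and F: "\<And>t. x \<le> t \<Longrightarrow> (\<lambda>n. f n t) sums F t"
  shows "(\<lambda>n. tail (f n) x) sums tail F x"
proof -
  let ?g = "\<lambda>n t. indicat_real {x..} t *\<^sub>R f n t"
  have gb: "norm (?g n t) \<le> norm (c n * w t)" for n t
    using bound[of t n] by (auto simp: indicator_def)
  have gb': "norm (?g n t) \<le> norm (indicat_real {x..} t *\<^sub>R (c n * w t))" for n t
    using bound[of t n] by (auto simp: indicator_def)
  have int: "integrable lborel (?g n)" for n
    by (rule Bochner_Integration.integrable_bound[OF integrable_mult_right[OF w, of "c n"]])
      (use meas gb in \<open>auto intro!: AE_I2\<close>)
  have ind: "integrable lborel (\<lambda>t. indicat_real {x..} t *\<^sub>R (c n * w t))" for n
    by (intro integrable_mult_indicator integrable_mult_right w) auto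
  have "(\<lambda>n. integral\<^sup>L lborel (?g n)) sums (\<integral>t. (\<Sum>n. ?g n t) \<partial>lborel)"
  proof (rule sums_integral[OF int])
    show "AE t in lborel. summable (\<lambda>n. norm (?g n t))"
    proof (rule AE_I2)
      fix t
      show "summable (\<lambda>n. norm (?g n t))"
      proof (cases "x \<le> t")
        case True
        then show ?thesis
          by (intro summable_comparison_test'[OF summable_mult2[OF c, of "w t"], of 0]) (use bound in auto)
      qed simp
    qed
    show "summable (\<lambda>n. \<integral>t. norm (?g n t) \<partial>lborel)"
    proof (rule summable_comparison_test')
      show "summable (\<lambda>n. c n * tail w x)" by (rule summable_mult2[OF c])
      fix n
      have "(\<integral>t. norm (?g n t) \<partial>lborel) \<le> (\<integral>t. indicat_real {x..} t *\<^sub>R (c n * w t) \<partial>lborel)"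
        by (intro integral_mono integrable_norm int ind) (use bound in \<open>auto simp: indicator_def\<close>)
      also have "\<dots> = c n * tail w x"
        unfolding tail_def by (simp flip: Bochner_Integration.integral_mult_right_zero add: mult_ac)
      finally show "norm (\<integral>t. norm (?g n t) \<partial>lborel) \<le> c n * tail w x" by simp
    qed
  qed
  moreover have "(\<Sum>n. ?g n t) = indicat_real {x..} t *\<^sub>R F t" for t
    using F[of t] by (auto simp: indicator_def sums_iff)
  ultimately show ?thesis unfolding tail_def by simp
qed

lemma ac_deriv_exp: "ac_deriv (\<lambda>x. exp (c * of_real x)) (\<lambda>x. c * exp (c * of_real x))" for c :: complex
proof (rule ac_derivI_C1)
  show "((\<lambda>x. exp (c * of_real x)) has_vector_derivative c * exp (c * of_real x)) (at x)" for x
    by (rule has_vector_derivative_real_field) (auto intro!: derivative_eq_intros)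
  show "continuous_on UNIV (\<lambda>x. c * exp (c * complex_of_real x))" by (intro continuous_intros)
qed

lemma ac_deriv_const: "ac_deriv (\<lambda>x. c) (\<lambda>x. 0)" for c :: complex
  by (rule ac_derivI_C1) auto

text \<open>Compares what the product rule yields for the exponential times \<open>R - P\<close> and
  \<open>R + P\<close> with the right-hand sides of the first order system, as plain identities in
  complex numbers. Writing \<open>R\<close> as \<open>P + 2ik D\<close> removes the
  division.\<close>

lemma Jost_algebra:
  fixes E R P k \<sigma> \<rho> D :: complex
  assumes k: "k \<noteq> 0" and D: "D = (R - P) / (2 * \<i> * k)"
  shows "1 / (2 * \<i> * k) * (E * (- (\<sigma> * P + \<rho> * D) - (- 2 * \<i> * k * P - (\<sigma> * R + \<rho> * D))) + \<i> * k * E * (R - P))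
      = E * (R + P) / 2 + \<sigma> * (E * D)"
    and "1 / 2 * (E * (- (\<sigma> * P + \<rho> * D) + (- 2 * \<i> * k * P - (\<sigma> * R + \<rho> * D))) + \<i> * k * E * (R + P))
      = - \<sigma> * (E * (R + P) / 2) - (\<rho> + k\<^sup>2) * (E * D)"
proof -
  have R: "R = P + 2 * \<i> * k * D" using k by (simp add: D)
  have "E * (- (\<sigma> * P + \<rho> * D) - (- 2 * \<i> * k * P - (\<sigma> * R + \<rho> * D))) + \<i> * k * E * (R - P)
      = \<i> * k * (E * (R + P)) + 2 * \<i> * k * (\<sigma> * (E * D))"
    unfolding R by (simp add: algebra_simps)
  then show "1 / (2 * \<i> * k) * (E * (- (\<sigma> * P + \<rho> * D) - (- 2 * \<i> * k * P - (\<sigma> * R + \<rho> * D))) + \<i> * k * E * (R - P))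
      = E * (R + P) / 2 + \<sigma> * (E * D)"
    using k by (simp add: add_divide_distrib)
  have Z: "E * (- (\<sigma> * P + \<rho> * D) + (- 2 * \<i> * k * P - (\<sigma> * R + \<rho> * D))) + \<i> * k * E * (R + P)
      = - \<sigma> * (E * (R + P)) - 2 * ((\<rho> + k\<^sup>2) * (E * D))"
    unfolding R by (simp add: algebra_simps power2_eq_square)
  show "1 / 2 * (E * (- (\<sigma> * P + \<rho> * D) + (- 2 * \<i> * k * P - (\<sigma> * R + \<rho> * D))) + \<i> * k * E * (R + P))
      = - \<sigma> * (E * (R + P) / 2) - (\<rho> + k\<^sup>2) * (E * D)"
    unfolding Z by (simp add: diff_divide_distrib)
qed

context short_range
begin

text \<open>\<open>jost\<close> and \<open>jost1\<close> invert the substitution that led to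
  \<open>P\<close> and \<open>R\<close>, giving the solution and its quasi-derivative. The
  normalisation is \<open>e^(ikx) / (2ik)\<close> at infinity; constant factors cancel in the
  m-function.\<close>

definition jost :: "complex \<Rightarrow> real \<Rightarrow> complex" where
  "jost k x = exp (\<i> * k * of_real x) * (JR k x - JP k x) / (2 * \<i> * k)"

definition jost1 :: "complex \<Rightarrow> real \<Rightarrow> complex" where
  "jost1 k x = exp (\<i> * k * of_real x) * (JR k x + JP k x) / 2"

context
  fixes r :: real and k :: complex assumes r: "0 < r" and k: "k \<in> upper r"
begin

lemma k_nonzero: "k \<noteq> 0" using r k unfolding upper_def by auto

lemma continuous_on_section:
  assumes "continuous_on (upper r \<times> UNIV) (\<lambda>(k, x). f k x)"
  shows "continuous_on UNIV (f k)"
proof -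
  have "continuous_on UNIV ((\<lambda>(k, x). f k x) \<circ> (\<lambda>t. (k, t)))"
    by (intro continuous_on_compose continuous_intros continuous_on_subset[OF assms]) (use k in auto)
  then show ?thesis by (simp add: o_def)
qed

lemma JPR_continuous_on_x: "continuous_on UNIV (JP k)" "continuous_on UNIV (JR k)"
  by (rule continuous_on_section, rule JPR_continuous[OF r])+

lemma kernel_sums:
  "(\<lambda>n. kP k t (J n k t)) sums kP k t (PR k t)"
  "(\<lambda>n. kR k t (J n k t)) sums kR k t (PR k t)"
  unfolding kP_def kR_def fst_conv snd_conv
  by (intro sums_add sums_mult sums_divide sums_diff J_sums[OF r k])+

lemma J_measurable: "J n k \<in> borel_measurable borel"
  using continuous_on_section[OF J_continuous[OF r]] by (rule borel_measurable_continuous_onI)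

lemma phase_measurable: "(\<lambda>t. exp (c * of_real (t - x))) \<in> borel_measurable borel" for c :: complex
  by (intro borel_measurable_continuous_onI continuous_intros)

lemma Jost_integral_equations:
  "JP k x = tail (\<lambda>t. phase k (t - x) * kP k t (PR k t)) x"
  "JR k x = 1 + tail (\<lambda>t. kR k t (PR k t)) x"
proof -
  let ?c = "\<lambda>n. (kC r * integral\<^sup>L lborel om) ^ n / fact (n - 1)"
  have AB: "norm (kP k t (J n k t)) \<le> ?c n * (kC r * om t)" "norm (kR k t (J n k t)) \<le> ?c n * (kC r * om t)" for n t
    using norm_kernel[OF r k J_bound(3,4)[OF r k], of t n] by (simp_all add: mult_ac)
  have "(\<lambda>n. tail (\<lambda>t. phase k (t - x) * kP k t (J n k t)) x) sums
      tail (\<lambda>t. phase k (t - x) * kP k t (PR k t)) x"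
  proof (rule tail_sums[where c="?c" and w="\<lambda>t. kC r * om t"])
    show "norm (phase k (t - x) * kP k t (J n k t)) \<le> ?c n * (kC r * om t)" if "x \<le> t" for n t
    proof -
      have "norm (phase k (t - x) * kP k t (J n k t)) \<le> 1 * (?c n * (kC r * om t))"
        unfolding norm_mult by (intro mult_mono norm_phase[OF r k that] AB) auto
      then show ?thesis by simp
    qed
    show "(\<lambda>t. phase k (t - x) * kP k t (J n k t)) \<in> borel_measurable borel" for n
      by (intro borel_measurable_times phase_measurable measurable_kernel[OF r] J_measurable)
  qed (intro summable_bound[OF r] integrable_mult_right om sums_mult kernel_sums)+
  then have "(\<lambda>n. fst (J (Suc n) k x)) sums tail (\<lambda>t. phase k (t - x) * kP k t (PR k t)) x"
    by simp
  moreover have "(\<lambda>n. fst (J (Suc n) k x)) sums JP k x"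
    using J_sums(1)[OF r k, of x] by (subst sums_Suc_iff) simp
  ultimately show "JP k x = tail (\<lambda>t. phase k (t - x) * kP k t (PR k t)) x"
    using sums_unique2 by blast
  have "(\<lambda>n. tail (\<lambda>t. kR k t (J n k t)) x) sums tail (\<lambda>t. kR k t (PR k t)) x"
  proof (rule tail_sums[where c="?c" and w="\<lambda>t. kC r * om t"])
    show "(\<lambda>t. kR k t (J n k t)) \<in> borel_measurable borel" for n
      by (intro measurable_kernel[OF r] J_measurable)
  qed (intro summable_bound[OF r] integrable_mult_right om kernel_sums AB)+
  then have "(\<lambda>n. snd (J (Suc n) k x)) sums tail (\<lambda>t. kR k t (PR k t)) x"
    by simp
  moreover have "(\<lambda>n. snd (J (Suc n) k x)) sums (JR k x - 1)"
    using J_sums(2)[OF r k, of x] by (subst sums_Suc_iff) simp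
  ultimately have "JR k x - 1 = tail (\<lambda>t. kR k t (PR k t)) x"
    using sums_unique2 by blast
  then show "JR k x = 1 + tail (\<lambda>t. kR k t (PR k t)) x" by (simp add: algebra_simps)
qed

definition jost_bound :: real where "jost_bound = exp (kC r * integral\<^sup>L lborel om)"

lemma JPR_norm_le:
  assumes "0 < x"
  shows "norm (JP k x) \<le> jost_bound" "norm (JR k x) \<le> jost_bound"
proof -
  have "exp (kC r * tail om x) \<le> jost_bound"
    unfolding jost_bound_def using kC_pos[OF r] tail_le_integral[OF om, of x] by simp
  then show "norm (JP k x) \<le> jost_bound" "norm (JR k x) \<le> jost_bound"
    using JPR_bound[OF r k assms] norm_triangle_ineq[of "JR k x - 1" 1] by auto
qed

lemma integrable_Jost_kernel:
  "integrable lborel (\<lambda>t. phase k t * kP k t (PR k t))"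
  "integrable lborel (\<lambda>t. kR k t (PR k t))"
proof -
  have Y: "PR k \<in> borel_measurable borel"
    by (intro borel_measurable_continuous_onI continuous_intros JPR_continuous_on_x)
  have AB: "norm (kP k t (PR k t)) \<le> kC r * om t * jost_bound \<and> norm (kR k t (PR k t)) \<le> kC r * om t * jost_bound \<and>
     norm (phase k t * kP k t (PR k t)) \<le> kC r * om t * jost_bound" for t
  proof (cases "0 < t")
    case True
    have AB: "norm (kP k t (PR k t)) \<le> kC r * om t * jost_bound" "norm (kR k t (PR k t)) \<le> kC r * om t * jost_bound"
      using norm_kernel[OF r k, of "PR k t" jost_bound t] JPR_norm_le[OF True] by auto
    have "norm (phase k (t - 0) * kP k t (PR k t)) \<le> 1 * (kC r * om t * jost_bound)"
      unfolding norm_mult by (intro mult_mono norm_phase[OF r k] AB) (use True in auto)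
    with AB show ?thesis by simp
  next
    case False
    \<comment> \<open>For negative \<open>t\<close> the phase may grow, but it multiplies vanishing
      coefficients.\<close>
    then have "s t = 0" "q t = 0" using s0 q0 by auto
    then show ?thesis by (simp add: kP_def kR_def om_def)
  qed
  have w: "integrable lborel (\<lambda>t. kC r * om t * jost_bound)" using om by simp
  show "integrable lborel (\<lambda>t. phase k t * kP k t (PR k t))"
  proof (rule Bochner_Integration.integrable_bound[OF w])
    show "(\<lambda>t. phase k t * kP k t (PR k t)) \<in> borel_measurable lborel"
      using phase_measurable[of "2 * \<i> * k" 0] measurable_kernel(1)[OF r Y, of k] by simp
  qed (use AB in \<open>auto intro!: AE_I2 order_trans[OF _ abs_ge_self]\<close>)
  show "integrable lborel (\<lambda>t. kR k t (PR k t))"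
  proof (rule Bochner_Integration.integrable_bound[OF w])
    show "(\<lambda>t. kR k t (PR k t)) \<in> borel_measurable lborel"
      using measurable_kernel(2)[OF r Y, of k] by simp
  qed (use AB in \<open>auto intro!: AE_I2 order_trans[OF _ abs_ge_self]\<close>)
qed

lemma ac_deriv_JR: "ac_deriv (JR k) (\<lambda>x. - kR k x (PR k x))"
proof -
  have eq: "JR k = (\<lambda>x. 1 + tail (\<lambda>t. kR k t (PR k t)) x)"
    by (rule ext) (rule Jost_integral_equations(2))
  show ?thesis
    using ac_deriv_add[OF ac_deriv_const[of 1] ac_deriv_tail[OF integrable_Jost_kernel(2)]]
    unfolding eq[symmetric] add_0 .
qed

end


context
  fixes r :: real and k :: complex assumes r: "0 < r" and k: "k \<in> upper r"
begin

text \<open>Besides the lower limit, \<open>x\<close> enters the integral only through the phase,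
  which splits into a function of \<open>x\<close> times \<open>phase k t\<close>. After pulling the
  former out, the product rule applies to an ordinary tail.\<close>

lemma ac_deriv_JP: "ac_deriv (JP k) (\<lambda>x. - 2 * \<i> * k * JP k x - kP k x (PR k x))"
proof -
  let ?T = "tail (\<lambda>t. phase k t * kP k t (PR k t))"
  have eq: "JP k x = exp (- 2 * \<i> * k * of_real x) * ?T x" for x
  proof -
    have phase: "phase k (t - x) = exp (- 2 * \<i> * k * of_real x) * phase k t" for t
    proof -
      have "2 * \<i> * k * of_real (t - x) = - 2 * \<i> * k * of_real x + 2 * \<i> * k * of_real t"
        by (simp add: right_diff_distrib)
      then show ?thesis by (simp only: exp_add)
    qed
    have "JP k x = tail (\<lambda>t. phase k (t - x) * kP k t (PR k t)) x"
      by (rule Jost_integral_equations(1)[OF r k])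
    also have "\<dots> = tail (\<lambda>t. exp (- 2 * \<i> * k * of_real x) * (phase k t * kP k t (PR k t))) x"
      by (rule arg_cong[where f="\<lambda>h. tail h x"], rule ext) (subst phase, rule mult.assoc)
    also have "\<dots> = exp (- 2 * \<i> * k * of_real x) * ?T x"
      unfolding tail_def by (simp only: mult_scaleR_right[symmetric] Bochner_Integration.integral_mult_right_zero)
    finally show ?thesis .
  qed
  have "ac_deriv (\<lambda>x. exp (- 2 * \<i> * k * of_real x) * ?T x)
      (\<lambda>x. exp (- 2 * \<i> * k * of_real x) * - (phase k x * kP k x (PR k x))
        + - 2 * \<i> * k * exp (- 2 * \<i> * k * of_real x) * ?T x)"
    by (rule ac_deriv_mult[OF ac_deriv_exp ac_deriv_tail[OF integrable_Jost_kernel(1)[OF r k]]])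
  then have "ac_deriv (JP k)
      (\<lambda>x. exp (- 2 * \<i> * k * of_real x) * - (phase k x * kP k x (PR k x))
        + - 2 * \<i> * k * exp (- 2 * \<i> * k * of_real x) * ?T x)"
    unfolding eq[symmetric] .
  then show ?thesis
  proof (rule ac_deriv_cong_AE)
    have 1: "exp (- 2 * \<i> * k * of_real x) * phase k x = 1" for x
      using exp_minus_inverse[of "2 * \<i> * k * of_real x"] by (simp add: mult.commute)
    have "exp (- 2 * \<i> * k * of_real x) * - (phase k x * a) + - 2 * \<i> * k * exp (- 2 * \<i> * k * of_real x) * T
        = - 2 * \<i> * k * (exp (- 2 * \<i> * k * of_real x) * T) - a" for x a T
      using arg_cong[OF 1[of x], of "\<lambda>z. z * a"] by (simp add: mult.assoc)
    then show "AE x in lebesgue. 0 < x \<longrightarrow>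
        exp (- 2 * \<i> * k * of_real x) * - (phase k x * kP k x (PR k x))
        + - 2 * \<i> * k * exp (- 2 * \<i> * k * of_real x) * ?T x = - 2 * \<i> * k * JP k x - kP k x (PR k x)"
      by (intro AE_I2 impI) (simp only: eq[symmetric])
  qed
qed

lemma ac_deriv_jost: "ac_deriv (jost k) (\<lambda>x. jost1 k x + of_real (s x) * jost k x)"
proof -
  have eq: "jost k = (\<lambda>x. 1 / (2 * \<i> * k) * (exp (\<i> * k * of_real x) * (JR k x - JP k x)))"
    by (simp add: jost_def fun_eq_iff)
  show ?thesis unfolding eq
    by (rule ac_deriv_cong_AE[OF ac_deriv_cmult[OF ac_deriv_mult[OF ac_deriv_exp ac_deriv_diff[OF ac_deriv_JR[OF r k] ac_deriv_JP]]]])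
      (intro AE_I2 impI, simp only: jost1_def kP_def kR_def fst_conv snd_conv Jost_algebra(1)[OF k_nonzero[OF r k] refl], simp)
qed

lemma ac_deriv_jost1: "ac_deriv (jost1 k) (\<lambda>x. - of_real (s x) * jost1 k x - (of_real (q x) + k\<^sup>2) * jost k x)"
proof -
  have eq: "jost1 k = (\<lambda>x. 1 / 2 * (exp (\<i> * k * of_real x) * (JR k x + JP k x)))"
    by (simp add: jost1_def fun_eq_iff)
  note D = ac_deriv_cmult[OF ac_deriv_mult[OF ac_deriv_exp[where c="\<i> * k"] ac_deriv_add[OF ac_deriv_JR[OF r k] ac_deriv_JP]], where c="1 / 2"]
  show ?thesis
    by (rule ac_deriv_cong_AE[OF D[folded eq]])
      (intro AE_I2 impI, simp only: kP_def kR_def fst_conv snd_conv Jost_algebra(2)[OF k_nonzero[OF r k] refl], simp add: jost1_def jost_def)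
qed

lemma Jost_limits: "(JP k \<longlongrightarrow> 0) at_top" "(JR k \<longlongrightarrow> 1) at_top"
proof -
  have "((\<lambda>x. exp (kC r * tail om x) - 1) \<longlongrightarrow> exp (kC r * 0) - 1) at_top"
    by (intro tendsto_intros tail_tendsto_0 om)
  then have lim: "((\<lambda>x. exp (kC r * tail om x) - 1) \<longlongrightarrow> 0) at_top" by simp
  show "(JP k \<longlongrightarrow> 0) at_top"
    by (rule Lim_null_comparison[OF eventually_mono[OF eventually_gt_at_top[of 0] JPR_bound(1)[OF r k]] lim])
  have "((\<lambda>x. JR k x - 1) \<longlongrightarrow> 0) at_top"
    by (rule Lim_null_comparison[OF eventually_mono[OF eventually_gt_at_top[of 0] JPR_bound(2)[OF r k]] lim])
  then show "(JR k \<longlongrightarrow> 1) at_top" by (simp add: LIM_zero_iff)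
qed

lemma norm_exp_ik: "norm (exp (\<i> * k * of_real x)) = exp (- Im k * x)"
  unfolding norm_exp_eq_Re by simp

lemma Jost_solution_decay:
  "\<exists>M\<ge>0. \<forall>x>0. norm (jost k x) \<le> M * exp (- Im k * x) \<and> norm (jost1 k x) \<le> M * exp (- Im k * x)"
proof -
  let ?b = "jost_bound r"
  let ?M = "2 * ?b / (2 * norm k) + 2 * ?b / 2"
  have b: "0 \<le> ?b" unfolding jost_bound_def[OF r k] by simp
  have "norm (jost k x) \<le> ?M * exp (- Im k * x) \<and> norm (jost1 k x) \<le> ?M * exp (- Im k * x)" if x: "0 < x" for x
  proof
    have n: "norm (JR k x - JP k x) \<le> 2 * ?b" "norm (JR k x + JP k x) \<le> 2 * ?b"
      using JPR_norm_le[OF r k x] norm_triangle_ineq4[of "JR k x" "JP k x"] norm_triangle_ineq[of "JR k x" "JP k x"] by auto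
    have "norm (jost k x) = exp (- Im k * x) * (norm (JR k x - JP k x) / (2 * norm k))"
      unfolding jost_def by (simp add: norm_divide norm_mult norm_exp_ik)
    also have "\<dots> \<le> exp (- Im k * x) * ?M"
    proof (rule mult_left_mono)
      have "norm (JR k x - JP k x) / (2 * norm k) \<le> 2 * ?b / (2 * norm k)"
        by (rule divide_right_mono[OF n(1)]) simp
      then show "norm (JR k x - JP k x) / (2 * norm k) \<le> ?M" using b by linarith
    qed simp
    finally show "norm (jost k x) \<le> ?M * exp (- Im k * x)" by (simp add: mult.commute)
    have "norm (jost1 k x) = exp (- Im k * x) * (norm (JR k x + JP k x) / 2)"
      unfolding jost1_def by (simp add: norm_divide norm_mult norm_exp_ik)
    also have "\<dots> \<le> exp (- Im k * x) * ?M"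
      using n b by (intro mult_left_mono) (auto intro!: divide_right_mono add_increasing)
    finally show "norm (jost1 k x) \<le> ?M * exp (- Im k * x)" by (simp add: mult.commute)
  qed
  moreover have "0 \<le> ?M" using b by simp
  ultimately show ?thesis by blast
qed

lemma Jost_solution_continuous: "continuous_on UNIV (jost k)" "continuous_on UNIV (jost1 k)"
  unfolding jost_def jost1_def
  by (intro continuous_intros JPR_continuous_on_x[OF r k]; use k_nonzero[OF r k] in simp)+

text \<open>The exponentials combine to a positive factor; what remains tends to
  \<open>cnj (1 / (2ik)) / 2\<close>, whose imaginary part is
  \<open>Re k / (4 * (norm k)^2)\<close>.\<close>

lemma Jost_current_eventually_pos:
  assumes "0 < Re k"
  shows "\<forall>\<^sub>F x in at_top. 0 < Im (cnj (jost k x) * jost1 k x)"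
proof -
  let ?G = "\<lambda>x. cnj ((JR k x - JP k x) / (2 * \<i> * k)) * ((JR k x + JP k x) / 2)"
  have "(?G \<longlongrightarrow> cnj ((1 - 0) / (2 * \<i> * k)) * ((1 + 0) / 2)) at_top"
    by (intro tendsto_intros Jost_limits) (use k_nonzero[OF r k] in auto)
  then have "((\<lambda>x. Im (?G x)) \<longlongrightarrow> Im (cnj ((1 - 0) / (2 * \<i> * k)) * ((1 + 0) / 2))) at_top"
    by (rule tendsto_Im)
  moreover have "0 < Im (cnj ((1 - 0) / (2 * \<i> * k)) * ((1 + 0) / 2))"
  proof -
    have "cnj ((1 - 0) / (2 * \<i> * k)) * ((1 + 0) / 2) = \<i> * k / (4 * (k * cnj k))"
      using k_nonzero[OF r k] by (simp add: field_simps)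
    also have "\<dots> = \<i> * k / of_real (4 * (norm k)\<^sup>2)"
      unfolding of_real_mult complex_norm_square by simp
    finally have "Im (cnj ((1 - 0) / (2 * \<i> * k)) * ((1 + 0) / 2)) = Re k / (4 * (norm k)\<^sup>2)"
      by (simp only: Im_divide_of_real) simp
    then show ?thesis using assms k_nonzero[OF r k] by simp
  qed
  ultimately have "\<forall>\<^sub>F x in at_top. 0 < Im (?G x)" by (rule order_tendstoD)
  then show ?thesis
  proof eventually_elim
    case (elim x)
    have "cnj (jost k x) * jost1 k x = cnj (exp (\<i> * k * of_real x)) * exp (\<i> * k * of_real x) * ?G x"
      unfolding jost_def jost1_def by simp
    also have "cnj (exp (\<i> * k * of_real x)) * exp (\<i> * k * of_real x) = of_real ((exp (- Im k * x))\<^sup>2)"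
      unfolding norm_exp_ik[symmetric] by (simp only: complex_norm_square mult.commute)
    finally have eq: "cnj (jost k x) * jost1 k x = of_real ((exp (- Im k * x))\<^sup>2) * ?G x" .
    have "Im (of_real a * z) = a * Im z" for a z by simp
    then have "Im (cnj (jost k x) * jost1 k x) = (exp (- Im k * x))\<^sup>2 * Im (?G x)" by (simp only: eq)
    moreover have "0 < (exp (- Im k * x))\<^sup>2" by simp
    ultimately show ?case using elim by (simp only: mult_pos_pos)
  qed
qed

text \<open>Since \<open>s\<close> and \<open>q\<close> are real, their contributions drop out of
  the derivative of the current, leaving \<open>- Im (k^2)\<close> times the squared modulus. The
  sign follows from \<open>Re k > 0\<close> and \<open>Im k \<ge> 0\<close>, so positivity
  propagates from infinity to the left, for real \<open>k\<close> as well.\<close>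

lemma Jost_current_pos:
  assumes Re: "0 < Re k" and x: "0 \<le> x"
  shows "0 < Im (cnj (jost k x) * jost1 k x)"
proof -
  let ?F = "\<lambda>x. cnj (jost k x) * jost1 k x"
  have cnj: "ac_deriv (\<lambda>x. cnj (jost k x)) (\<lambda>x. cnj (jost1 k x + of_real (s x) * jost k x))"
    by (rule ac_deriv_bounded_linear[OF bounded_linear_cnj ac_deriv_jost])
  have D: "ac_deriv (\<lambda>x. Im (?F x)) (\<lambda>x. - Im (k\<^sup>2) * (norm (jost k x))\<^sup>2)"
    by (rule ac_deriv_cong_AE[OF ac_deriv_bounded_linear[OF bounded_linear_Im ac_deriv_mult[OF cnj ac_deriv_jost1]]])
      (intro AE_I2 impI, simp add: cmod_power2, simp add: power2_eq_square algebra_simps)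
  have Imk2: "0 \<le> Im (k\<^sup>2)" using Re k unfolding upper_def by (simp add: power2_eq_square)
  have mono: "Im (?F z) \<le> Im (?F y)" if "0 < y" "y \<le> z" for y z
  proof -
    have "Im (?F z) - Im (?F y) \<le> 0"
      by (rule has_integral_le[OF ac_deriv_ftc[OF D that] has_integral_0]) (use Imk2 in simp)
    then show ?thesis by simp
  qed
  obtain N where N: "\<And>y. N \<le> y \<Longrightarrow> 0 < Im (?F y)"
    using Jost_current_eventually_pos[OF Re] by (auto simp: eventually_at_top_linorder)
  define z where "z = max N (x + 1)"
  have z: "0 < z" "x < z" "0 < Im (?F z)" using x N[of z] unfolding z_def by auto
  show ?thesis
  proof (cases "0 < x")
    case True
    then show ?thesis using mono[of x z] z by simp
  next
    case False
    then have [simp]: "x = 0" using x by simp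
    \<comment> \<open>Monotonicity is known on the open half line only and is carried to
      \<open>0\<close> by continuity; comparison with the fixed point \<open>z\<close> keeps the
      inequality strict.\<close>
    have "continuous_on UNIV (\<lambda>x. Im (?F x))"
      by (intro continuous_intros Jost_solution_continuous)
    then have "isCont (\<lambda>x. Im (?F x)) 0" by (simp add: continuous_on_eq_continuous_at)
    then have "((\<lambda>x. Im (?F x)) \<longlongrightarrow> Im (?F 0)) (at_right 0)"
      by (simp add: isCont_def filterlim_at_split)
    moreover have "\<forall>\<^sub>F y in at_right 0. Im (?F z) \<le> Im (?F y)"
      unfolding eventually_at_right_field using z mono by (intro exI[of _ z]) auto
    ultimately have "Im (?F z) \<le> Im (?F 0)"
      by (intro tendsto_lowerbound) auto
    then show ?thesis using z by simp
  qed
qed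

end

lemma Jost_solution_continuous_in_k:
  assumes "0 < r"
  shows "continuous_on (upper r) (\<lambda>k. jost k 0)" "continuous_on (upper r) (\<lambda>k. jost1 k 0)"
proof -
  have sect: "continuous_on (upper r) (\<lambda>k. f k 0)" if "continuous_on (upper r \<times> UNIV) (\<lambda>(k, x). f k x)"
    for f :: "complex \<Rightarrow> real \<Rightarrow> complex"
  proof -
    have "continuous_on (upper r) ((\<lambda>(k, x). f k x) \<circ> (\<lambda>k. (k, 0)))"
      by (intro continuous_on_compose continuous_intros continuous_on_subset[OF that]) auto
    then show ?thesis by (simp add: o_def)
  qed
  have nz: "2 * \<i> * k \<noteq> 0" if "k \<in> upper r" for k using that assms unfolding upper_def by auto
  note JPR = sect[OF JPR_continuous(1)[OF assms]] sect[OF JPR_continuous(2)[OF assms]]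
  show "continuous_on (upper r) (\<lambda>k. jost k 0)" "continuous_on (upper r) (\<lambda>k. jost1 k 0)"
    unfolding jost_def jost1_def by (intro continuous_intros JPR; use nz in simp)+
qed

end

section \<open>Weyl solutions and the m-function\<close>

text \<open>Supplies the data for \<open>short_range\<close>: a Lebesgue measurable coefficient is
  changed on a null set to a Borel one and cut off at \<open>0\<close>, which leaves the almost
  everywhere equations on the half line intact.\<close>

lemma borel_representative:
  fixes f :: "real \<Rightarrow> real"
  assumes f: "set_integrable lebesgue {0<..} f"
  shows "\<exists>g. integrable lborel g \<and> (\<forall>x\<le>0. g x = 0) \<and> (AE x in lebesgue. 0 < x \<longrightarrow> g x = f x)"
proof -
  let ?h = "\<lambda>x. indicator {0<..} x * f x"
  have h: "integrable lebesgue ?h" using f by (simp add: set_integrable_def)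
  then have "?h \<in> borel_measurable lebesgue" by auto
  then obtain f' where f': "f' \<in> borel_measurable lborel" "AE x in lborel. ?h x = f' x"
    using completion_ex_borel_measurable_real by blast
  define g where "g x = indicator {0<..} x * f' x" for x
  have gm: "g \<in> borel_measurable lborel" unfolding g_def using f'(1) by measurable
  have ae: "AE x in lebesgue. ?h x = g x"
    using AE_completion[OF f'(2)] by eventually_elim (auto simp: g_def indicator_def split: if_splits)
  have "integrable lebesgue g"
    by (subst integrable_cong_AE[OF _ _ ae, symmetric]) (use h gm in \<open>auto intro: measurable_completion\<close>)
  then have "integrable lborel g" using gm by (simp add: integrable_completion)
  moreover have "AE x in lebesgue. 0 < x \<longrightarrow> g x = f x"
    using ae by eventually_elim auto
  ultimately show ?thesis by (intro exI[of _ g]) (simp add: g_def)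
qed

lemma AE_eq_continuous_imp_eq:
  fixes v w :: "real \<Rightarrow> complex"
  assumes "continuous_on {0<..} v" "continuous_on {0<..} w"
    and ae: "AE x in lebesgue. 0 < x \<longrightarrow> v x = w x" and x: "0 < x"
  shows "v x = w x"
proof (rule ccontr)
  assume ne: "v x \<noteq> w x"
  define S where "S = {0<..} \<inter> (\<lambda>x. v x - w x) -` (- {0})"
  have "open S" unfolding S_def
    by (intro continuous_open_preimage continuous_intros assms)
  moreover have "x \<in> S" using x ne unfolding S_def by auto
  moreover have "negligible S"
  proof -
    obtain N where "{x \<in> space lebesgue. \<not> (0 < x \<longrightarrow> v x = w x)} \<subseteq> N" "emeasure lebesgue N = 0" "N \<in> sets lebesgue"
      using ae by (rule AE_E)
    moreover from this have "negligible N" by (simp add: negligible_iff_null_sets null_sets_def)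
    ultimately show ?thesis by (elim negligible_subset) (auto simp: S_def)
  qed
  ultimately show False using open_not_negligible by blast
qed

lemma ac_deriv_quasi:
  assumes "is_quasi_deriv \<sigma> u v" "AC_loc u"
  shows "ac_deriv u (\<lambda>x. v x + of_real (\<sigma> x) * u x)"
  unfolding ac_deriv_def
proof
  have "AE x in lebesgue. 0 < x \<longrightarrow> u differentiable (at x) \<and> v x = vector_derivative u (at x) - of_real (\<sigma> x) * u x"
    using assms(1) unfolding is_quasi_deriv_def by blast
  then show "AE x in lebesgue. 0 < x \<longrightarrow> (u has_vector_derivative v x + of_real (\<sigma> x) * u x) (at x)"
    by eventually_elim (auto simp: vector_derivative_works)
qed (rule assms(2))

text \<open>\<open>quasi_deriv\<close> is a choice; any two candidates are continuous and agree
  almost everywhere on the half line, hence agree everywhere there. Outside it their values are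
  arbitrary.\<close>

lemma quasi_deriv_eq:
  assumes v: "is_quasi_deriv \<sigma> u v" and x: "0 < x"
  shows "quasi_deriv \<sigma> u x = v x"
proof -
  have w: "is_quasi_deriv \<sigma> u (quasi_deriv \<sigma> u)"
    unfolding quasi_deriv_def using v by (rule someI[of "is_quasi_deriv \<sigma> u"])
  show ?thesis
  proof (rule AE_eq_continuous_imp_eq[OF _ _ _ x])
    show "continuous_on {0<..} (quasi_deriv \<sigma> u)" "continuous_on {0<..} v"
      using v w unfolding is_quasi_deriv_def by (auto intro: AC_loc_continuous_on)
    have "AE x in lebesgue. 0 < x \<longrightarrow> v x = vector_derivative u (at x) - of_real (\<sigma> x) * u x"
      "AE x in lebesgue. 0 < x \<longrightarrow> quasi_deriv \<sigma> u x = vector_derivative u (at x) - of_real (\<sigma> x) * u x"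
      using v w unfolding is_quasi_deriv_def by (auto elim: eventually_mono)
    then show "AE x in lebesgue. 0 < x \<longrightarrow> quasi_deriv \<sigma> u x = v x" by eventually_elim simp
  qed
qed

text \<open>The equation is solved for the derivative of the quasi-derivative. That this derivative
  exists almost everywhere comes from absolute continuity, because \<open>vector_derivative\<close>
  denotes some value even where it does not exist.\<close>

lemma weyl_solution_system:
  assumes "is_weyl_solution \<sigma> \<tau> z \<psi>"
  shows "ac_deriv \<psi> (\<lambda>x. quasi_deriv \<sigma> \<psi> x + of_real (\<sigma> x) * \<psi> x)"
    "ac_deriv (quasi_deriv \<sigma> \<psi>) (\<lambda>x. - of_real (\<sigma> x) * quasi_deriv \<sigma> \<psi> x - (of_real ((\<sigma> x)\<^sup>2 - \<tau> x) + z) * \<psi> x)"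
proof -
  have \<psi>: "\<psi> \<in> quasi_dom \<sigma>" "AE x in lebesgue. 0 < x \<longrightarrow> ell \<sigma> \<tau> \<psi> x = z * \<psi> x"
    using assms unfolding is_weyl_solution_def by auto
  have w: "is_quasi_deriv \<sigma> \<psi> (quasi_deriv \<sigma> \<psi>)"
    using \<psi>(1) unfolding quasi_dom_def quasi_deriv_def by (auto intro: someI[of "is_quasi_deriv \<sigma> \<psi>"])
  show "ac_deriv \<psi> (\<lambda>x. quasi_deriv \<sigma> \<psi> x + of_real (\<sigma> x) * \<psi> x)"
    by (rule ac_deriv_quasi[OF w]) (use \<psi>(1) in \<open>simp add: quasi_dom_def\<close>)
  have ac: "AC_loc (quasi_deriv \<sigma> \<psi>)" using w unfolding is_quasi_deriv_def by simp
  show "ac_deriv (quasi_deriv \<sigma> \<psi>) (\<lambda>x. - of_real (\<sigma> x) * quasi_deriv \<sigma> \<psi> x - (of_real ((\<sigma> x)\<^sup>2 - \<tau> x) + z) * \<psi> x)"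
    unfolding ac_deriv_def
  proof
    show "AE x in lebesgue. 0 < x \<longrightarrow> (quasi_deriv \<sigma> \<psi> has_vector_derivative
        - of_real (\<sigma> x) * quasi_deriv \<sigma> \<psi> x - (of_real ((\<sigma> x)\<^sup>2 - \<tau> x) + z) * \<psi> x) (at x)"
      using \<psi>(2) AC_loc_differentiable[OF ac]
    proof eventually_elim
      case (elim x)
      show ?case
      proof
        assume "0 < x"
        then have "(quasi_deriv \<sigma> \<psi> has_vector_derivative vector_derivative (quasi_deriv \<sigma> \<psi>) (at x)) (at x)"
          and "ell \<sigma> \<tau> \<psi> x = z * \<psi> x" using elim by (auto simp: vector_derivative_works)
        moreover from this(2) have "vector_derivative (quasi_deriv \<sigma> \<psi>) (at x)
            = - of_real (\<sigma> x) * quasi_deriv \<sigma> \<psi> x - (of_real ((\<sigma> x)\<^sup>2 - \<tau> x) + z) * \<psi> x"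
          unfolding ell_def by (simp add: algebra_simps add_eq_0_iff)
        ultimately show "(quasi_deriv \<sigma> \<psi> has_vector_derivative
            - of_real (\<sigma> x) * quasi_deriv \<sigma> \<psi> x - (of_real ((\<sigma> x)\<^sup>2 - \<tau> x) + z) * \<psi> x) (at x)" by simp
      qed
    qed
  qed (rule ac)
qed

text \<open>The converse passage: the chosen quasi-derivative coincides with \<open>v\<close> on an
  open set, so it has the same derivative there.\<close>

lemma weyl_solutionI:
  assumes u: "ac_deriv u (\<lambda>x. v x + of_real (\<sigma> x) * u x)"
    and v: "ac_deriv v (\<lambda>x. - of_real (\<sigma> x) * v x - (of_real ((\<sigma> x)\<^sup>2 - \<tau> x) + z) * u x)"
    and "L2_pos u" "\<exists>x>0. u x \<noteq> 0"
  shows "is_weyl_solution \<sigma> \<tau> z u"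
proof -
  have qd: "is_quasi_deriv \<sigma> u v"
    unfolding is_quasi_deriv_def
  proof
    show "AC_loc v" using v unfolding ac_deriv_def by simp
    show "AE x in lebesgue. 0 < x \<longrightarrow> u differentiable at x \<and> v x = vector_derivative u (at x) - of_real (\<sigma> x) * u x"
      using u[unfolded ac_deriv_def, THEN conjunct2]
      by eventually_elim (auto intro: differentiableI_vector simp: vector_derivative_at)
  qed
  have "AE x in lebesgue. 0 < x \<longrightarrow> ell \<sigma> \<tau> u x = z * u x"
    using v[unfolded ac_deriv_def, THEN conjunct2]
  proof eventually_elim
    case (elim x)
    show ?case
    proof
      assume x: "0 < x"
      have "(quasi_deriv \<sigma> u has_vector_derivative - of_real (\<sigma> x) * v x - (of_real ((\<sigma> x)\<^sup>2 - \<tau> x) + z) * u x) (at x)"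
        by (rule has_vector_derivative_transform_within_open[of v _ _ "{0<..}"])
          (use elim x quasi_deriv_eq[OF qd] in auto)
      then show "ell \<sigma> \<tau> u x = z * u x"
        unfolding ell_def by (simp add: vector_derivative_at quasi_deriv_eq[OF qd x] algebra_simps)
    qed
  qed
  then show ?thesis
    using assms qd unfolding is_weyl_solution_def quasi_dom_def ac_deriv_def by blast
qed

section \<open>Square integrable solutions are multiples of the Jost solution\<close>

context short_range
begin

context
  fixes r :: real and k :: complex
  assumes r: "0 < r" and k: "k \<in> upper r" and Re: "0 < Re k"
begin

lemma Jost_solution_nonzero: "0 \<le> x \<Longrightarrow> jost k x \<noteq> 0"
  using Jost_current_pos[OF r k Re, of x] by auto

context
  fixes \<psi> \<theta> :: "real \<Rightarrow> complex" and S :: real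
  assumes Im: "0 < Im k"
    and \<psi>: "ac_deriv \<psi> (\<lambda>x. \<theta> x + of_real (s x) * \<psi> x)"
    and \<theta>: "ac_deriv \<theta> (\<lambda>x. - of_real (s x) * \<theta> x - (of_real (q x) + k\<^sup>2) * \<psi> x)"
    and L2: "set_integrable lebesgue {0<..} (\<lambda>x. (norm (\<psi> x))\<^sup>2)"
    and sq: "\<And>a. 0 < a \<Longrightarrow> (\<lambda>x. (s x)\<^sup>2) integrable_on {a..a+1}"
      "\<And>a. 0 < a \<Longrightarrow> integral {a..a+1} (\<lambda>x. (s x)\<^sup>2) \<le> S"
begin

text \<open>Formed with quasi-derivatives, so that the terms with \<open>s\<close> cancel; those
  with \<open>q\<close> and \<open>k^2\<close> cancel because both functions solve the same
  equation.\<close>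

lemma Wronskian_const:
  assumes "0 < x" "0 < y"
  shows "jost k x * \<theta> x - jost1 k x * \<psi> x = jost k y * \<theta> y - jost1 k y * \<psi> y"
proof (rule ac_deriv_zero_const[OF _ assms])
  show "ac_deriv (\<lambda>x. jost k x * \<theta> x - jost1 k x * \<psi> x) (\<lambda>x. 0)"
    by (rule ac_deriv_cong_AE[OF ac_deriv_diff[OF ac_deriv_mult[OF ac_deriv_jost[OF r k] \<theta>] ac_deriv_mult[OF ac_deriv_jost1[OF r k] \<psi>]]])
      (simp add: algebra_simps)
qed

text \<open>
  Nothing is known about the size of \<open>\<theta>\<close>; it is eliminated by averaging the constant Wronskian against
  \<open>\<phi>\<close>, which vanishes at both endpoints, and integrating by parts.
\<close>

lemma Wronskian_decay_bound:
  fixes a :: real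
  assumes a: "0 < a" and M: "0 \<le> M" "\<And>x. 0 < x \<Longrightarrow> norm (jost k x) \<le> M * exp (- Im k * x)"
    "\<And>x. 0 < x \<Longrightarrow> norm (jost1 k x) \<le> M * exp (- Im k * x)"
  shows "norm (jost k a * \<theta> a - jost1 k a * \<psi> a) / 6
    \<le> M * exp (- Im k * a) * (3 + 4 * integral {0<..} (\<lambda>x. (norm (\<psi> x))\<^sup>2) + S)"
proof -
  define c where "c = jost k a * \<theta> a - jost1 k a * \<psi> a"
  \<comment> \<open>A parabola vanishing at \<open>a\<close> and \<open>a + 1\<close>; its integral
    between them is \<open>1/2 - 1/3\<close>, the source of the 6 in the claim.\<close>
  define \<phi> where "\<phi> x = (x - a) * (a + 1 - x)" for x
  let ?F = "\<lambda>x. complex_of_real (\<phi> x) * (jost k x * \<psi> x)"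
  let ?F' = "\<lambda>x. complex_of_real (\<phi> x) * (jost k x * (\<theta> x + of_real (s x) * \<psi> x) + (jost1 k x + of_real (s x) * jost k x) * \<psi> x)
      + complex_of_real (2 * a + 1 - 2 * x) * (jost k x * \<psi> x)"
  \<comment> \<open>\<open>?F'\<close> contains \<open>\<phi>\<close> times
    \<open>jost k * \<theta>\<close>. Subtracting \<open>\<phi>\<close> times the Wronskian turns
    that product into \<open>jost1 k * \<psi>\<close>, and \<open>\<theta>\<close> is gone.\<close>
  let ?H = "\<lambda>x. ?F' x - \<phi> x *\<^sub>R c"
  have d\<phi>: "ac_deriv (\<lambda>x. complex_of_real (\<phi> x)) (\<lambda>x. complex_of_real (2 * a + 1 - 2 * x))"
  proof (rule ac_derivI_C1)
    have "(\<phi> has_real_derivative 2 * a + 1 - 2 * x) (at x)" for x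
      unfolding \<phi>_def by (auto intro!: derivative_eq_intros)
    then show "((\<lambda>x. complex_of_real (\<phi> x)) has_vector_derivative complex_of_real (2 * a + 1 - 2 * x)) (at x)" for x
      by (simp add: has_vector_derivative_complex_iff)
  qed (intro continuous_intros)
  have "ac_deriv ?F ?F'"
    by (rule ac_deriv_mult[OF d\<phi> ac_deriv_mult[OF ac_deriv_jost[OF r k] \<psi>]])
  from ac_deriv_ftc[OF this a, of "a + 1"] have F0: "(?F' has_integral 0) {a..a+1}"
    by (simp add: \<phi>_def)
  have "(\<phi> has_integral ((a + 1 - a)\<^sup>2 / 2 - (a + 1 - a)^3 / 3 - ((a - a)\<^sup>2 / 2 - (a - a)^3 / 3))) {a..a+1}"
  proof (rule fundamental_theorem_of_calculus)
    fix x
    have "((\<lambda>x. (x - a)\<^sup>2 / 2 - (x - a)^3 / 3) has_real_derivative \<phi> x) (at x)"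
      unfolding \<phi>_def by (auto intro!: derivative_eq_intros simp: algebra_simps power2_eq_square add_divide_distrib diff_divide_distrib)
    then show "((\<lambda>x. (x - a)\<^sup>2 / 2 - (x - a)^3 / 3) has_vector_derivative \<phi> x) (at x within {a..a+1})"
      by (rule has_vector_derivative_at_within[OF has_real_derivative_iff_has_vector_derivative[THEN iffD1]])
  qed simp
  then have "(\<phi> has_integral 1 / 6) {a..a+1}" by (simp add: power3_eq_cube)
  from has_integral_linear[OF this bounded_linear_scaleR_left[of c]]
  have "((\<lambda>x. \<phi> x *\<^sub>R c) has_integral (1 / 6) *\<^sub>R c) {a..a+1}" by (simp add: o_def)
  from has_integral_diff[OF F0 this] have H: "(?H has_integral - ((1 / 6) *\<^sub>R c)) {a..a+1}" by simp
  \<comment> \<open>Quadratic in \<open>\<psi>\<close> and \<open>s\<close>, the only quantities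
    with integral bounds uniform in \<open>a\<close>; the decay is taken at the left endpoint, where
    it is weakest.\<close>
  define b where "b x = M * exp (- Im k * a) * (3 + 4 * (norm (\<psi> x))\<^sup>2 + (s x)\<^sup>2)" for x
  have \<psi>i: "(\<lambda>x. (norm (\<psi> x))\<^sup>2) integrable_on {0<..}" using L2 by (rule set_lebesgue_integral_eq_integral(1))
  have "set_integrable lebesgue {a..a+1} (\<lambda>x. (norm (\<psi> x))\<^sup>2)"
    by (rule set_integrable_subset[OF L2]) (use a in auto)
  then have \<psi>ia: "(\<lambda>x. (norm (\<psi> x))\<^sup>2) integrable_on {a..a+1}" by (rule set_lebesgue_integral_eq_integral(1))
  have bi: "(b has_integral M * exp (- Im k * a) * (3 + 4 * integral {a..a+1} (\<lambda>x. (norm (\<psi> x))\<^sup>2)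
      + integral {a..a+1} (\<lambda>x. (s x)\<^sup>2))) {a..a+1}"
  proof -
    have "((\<lambda>x. 3::real) has_integral 3) {a..a+1}" using has_integral_const_real[of "3::real" a "a+1"] by simp
    then show ?thesis
      unfolding b_def by (intro has_integral_mult_right has_integral_add integrable_integral \<psi>ia sq(1)[OF a])
  qed
  have Hb: "norm (?H x) \<le> b x" if x: "x \<in> {a..a+1}" for x
  proof -
    have x0: "0 < x" using x a by simp
    have cx: "c = jost k x * \<theta> x - jost1 k x * \<psi> x" unfolding c_def by (rule Wronskian_const[OF a x0])
    define m where "m = M * exp (- Im k * a)"
    have "exp (- Im k * x) \<le> exp (- Im k * a)" using x Im by simp
    then have mm: "M * exp (- Im k * x) \<le> m" unfolding m_def by (rule mult_left_mono[OF _ M(1)])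
    have fm: "norm (jost k x) \<le> m" "norm (jost1 k x) \<le> m" using M(2,3)[OF x0] mm by auto
    have m0: "0 \<le> m" using fm(1) norm_ge_zero order_trans by blast
    have "\<bar>\<phi> x\<bar> = \<bar>x - a\<bar> * \<bar>a + 1 - x\<bar>" unfolding \<phi>_def by (rule abs_mult)
    also have "\<dots> \<le> 1 * 1" by (rule mult_mono) (use x in auto)
    finally have \<phi>1: "\<bar>\<phi> x\<bar> \<le> 1" by simp
    have "?H x = of_real (\<phi> x) * (2 * (jost1 k x * \<psi> x) + 2 * (of_real (s x) * (jost k x * \<psi> x)))
        + of_real (2 * a + 1 - 2 * x) * (jost k x * \<psi> x)"
      unfolding cx by (simp add: algebra_simps scaleR_conv_of_real)
    also have "norm \<dots> \<le> \<bar>\<phi> x\<bar> * (2 * (norm (jost1 k x) * norm (\<psi> x)) + 2 * (\<bar>s x\<bar> * (norm (jost k x) * norm (\<psi> x))))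
        + \<bar>2 * a + 1 - 2 * x\<bar> * (norm (jost k x) * norm (\<psi> x))"
    proof (rule order_trans[OF norm_triangle_ineq], rule add_mono)
      have "norm (2 * (jost1 k x * \<psi> x) + 2 * (of_real (s x) * (jost k x * \<psi> x)))
          \<le> norm (2 * (jost1 k x * \<psi> x)) + norm (2 * (of_real (s x) * (jost k x * \<psi> x)))"
        by (rule norm_triangle_ineq)
      also have "\<dots> = 2 * (norm (jost1 k x) * norm (\<psi> x)) + 2 * (\<bar>s x\<bar> * (norm (jost k x) * norm (\<psi> x)))"
        by (simp add: norm_mult)
      finally show "norm (of_real (\<phi> x) * (2 * (jost1 k x * \<psi> x) + 2 * (of_real (s x) * (jost k x * \<psi> x))))
        \<le> \<bar>\<phi> x\<bar> * (2 * (norm (jost1 k x) * norm (\<psi> x)) + 2 * (\<bar>s x\<bar> * (norm (jost k x) * norm (\<psi> x))))"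
        unfolding norm_mult[of "of_real (\<phi> x)"] norm_of_real by (rule mult_left_mono) simp
      show "norm (of_real (2 * a + 1 - 2 * x) * (jost k x * \<psi> x)) \<le> \<bar>2 * a + 1 - 2 * x\<bar> * (norm (jost k x) * norm (\<psi> x))"
        by (simp only: norm_mult norm_of_real order_refl)
    qed
    also have "\<dots> \<le> 1 * (2 * (m * norm (\<psi> x)) + 2 * (\<bar>s x\<bar> * (m * norm (\<psi> x)))) + 1 * (m * norm (\<psi> x))"
      using x m0 by (intro add_mono mult_mono \<phi>1 fm mult_left_mono order_refl) auto
    also have "\<dots> = m * (3 * norm (\<psi> x) + 2 * (\<bar>s x\<bar> * norm (\<psi> x)))" by (simp add: algebra_simps)
    also have "\<dots> \<le> m * (3 + 4 * (norm (\<psi> x))\<^sup>2 + (s x)\<^sup>2)"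
    proof (rule mult_left_mono[OF _ m0])
      \<comment> \<open>The first square splits the product of \<open>s\<close> and
        \<open>\<psi>\<close>, the second one bounds the linear term by a quadratic one.\<close>
      have "0 \<le> (\<bar>s x\<bar> - norm (\<psi> x))\<^sup>2" "0 \<le> (norm (\<psi> x) - 1 / 2)\<^sup>2" by simp_all
      then show "3 * norm (\<psi> x) + 2 * (\<bar>s x\<bar> * norm (\<psi> x)) \<le> 3 + 4 * (norm (\<psi> x))\<^sup>2 + (s x)\<^sup>2"
        by (simp add: power2_diff) (simp add: power2_eq_square)
    qed
    finally show ?thesis unfolding b_def m_def .
  qed
  have "norm (integral {a..a+1} ?H) \<le> integral {a..a+1} b"
    by (rule Henstock_Kurzweil_Integration.integral_norm_bound_integral) (use H bi Hb in auto)
  then have "norm c / 6 \<le> M * exp (- Im k * a) * (3 + 4 * integral {a..a+1} (\<lambda>x. (norm (\<psi> x))\<^sup>2)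
      + integral {a..a+1} (\<lambda>x. (s x)\<^sup>2))"
    unfolding integral_unique[OF H] integral_unique[OF bi] by simp
  also have "\<dots> \<le> M * exp (- Im k * a) * (3 + 4 * integral {0<..} (\<lambda>x. (norm (\<psi> x))\<^sup>2) + S)"
  proof (rule mult_left_mono)
    have "integral {a..a+1} (\<lambda>x. (norm (\<psi> x))\<^sup>2) \<le> integral {0<..} (\<lambda>x. (norm (\<psi> x))\<^sup>2)"
      by (rule integral_subset_le[OF _ \<psi>ia \<psi>i]) (use a in auto)
    then show "3 + 4 * integral {a..a+1} (\<lambda>x. (norm (\<psi> x))\<^sup>2) + integral {a..a+1} (\<lambda>x. (s x)\<^sup>2)
        \<le> 3 + 4 * integral {0<..} (\<lambda>x. (norm (\<psi> x))\<^sup>2) + S"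
      using sq(2)[OF a] by simp
  qed (use M(1) in simp)
  finally show ?thesis unfolding c_def .
qed

text \<open>The Wronskian does not depend on the point, while its bound at \<open>a\<close> tends to
  0 as \<open>a\<close> grows, because \<open>Im k > 0\<close>.\<close>

lemma Wronskian_eq_0:
  assumes x: "0 < x"
  shows "jost k x * \<theta> x - jost1 k x * \<psi> x = 0"
proof -
  obtain M where M: "0 \<le> M" "\<And>x. 0 < x \<Longrightarrow> norm (jost k x) \<le> M * exp (- Im k * x)"
    "\<And>x. 0 < x \<Longrightarrow> norm (jost1 k x) \<le> M * exp (- Im k * x)"
    using Jost_solution_decay[OF r k] by meson
  let ?c = "jost k x * \<theta> x - jost1 k x * \<psi> x"
  let ?K = "3 + 4 * integral {0<..} (\<lambda>x. (norm (\<psi> x))\<^sup>2) + S"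
  have "((\<lambda>a. M * exp (- Im k * a) * ?K) \<longlongrightarrow> M * 0 * ?K) at_top"
  proof (intro tendsto_intros)
    have "filterlim (\<lambda>a. - Im k * a) at_bot at_top"
      using Im by (intro filterlim_tendsto_neg_mult_at_bot[OF tendsto_const _ filterlim_ident]) auto
    then show "((\<lambda>a. exp (- Im k * a)) \<longlongrightarrow> 0) at_top" by (rule filterlim_compose[OF exp_at_bot])
  qed
  moreover have "\<forall>\<^sub>F a in at_top. norm ?c / 6 \<le> M * exp (- Im k * a) * ?K"
    using eventually_gt_at_top[of 0]
    by eventually_elim (use Wronskian_decay_bound[OF _ M] Wronskian_const[OF x] in auto)
  ultimately have "norm ?c / 6 \<le> M * 0 * ?K"
    by (intro tendsto_lowerbound[of _ _ at_top]) auto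
  then show ?thesis by simp
qed

text \<open>By the vanishing Wronskian the quotient of \<open>\<psi>\<close> by the Jost solution
  has derivative zero. The quotient is legitimate because a positive current forbids zeros of the
  Jost solution.\<close>

lemma L2_solution_multiple:
  obtains c where "\<And>x. 0 < x \<Longrightarrow> \<psi> x = c * jost k x" "\<And>x. 0 < x \<Longrightarrow> \<theta> x = c * jost1 k x"
proof -
  have nz: "jost k x \<noteq> 0" if "0 < x" for x using Jost_solution_nonzero[of x] that by simp
  have W: "jost k x * \<theta> x = jost1 k x * \<psi> x" if "0 < x" for x using Wronskian_eq_0[OF that] by simp
  let ?r = "\<lambda>x. \<psi> x * inverse (jost k x)"
  have "ac_deriv ?r (\<lambda>x. 0)"
  proof (rule ac_deriv_cong_AE[OF ac_deriv_mult[OF \<psi> ac_deriv_inverse[OF ac_deriv_jost[OF r k] nz]]])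
    have "\<psi> x * - (inverse (jost k x) * (jost1 k x + of_real (s x) * jost k x) * inverse (jost k x))
        + (\<theta> x + of_real (s x) * \<psi> x) * inverse (jost k x) = 0" if x: "0 < x" for x
      using nz[OF x] W[OF x] by (simp add: field_simps)
    then show "AE x in lebesgue. 0 < x \<longrightarrow> \<psi> x * - (inverse (jost k x) * (jost1 k x + of_real (s x) * jost k x) * inverse (jost k x))
        + (\<theta> x + of_real (s x) * \<psi> x) * inverse (jost k x) = 0" by (intro AE_I2 impI)
  qed
  then have const: "?r x = ?r 1" if "0 < x" for x using that by (rule ac_deriv_zero_const) simp
  have 1: "\<psi> x = ?r 1 * jost k x" if "0 < x" for x
    using const[OF that] nz[OF that] by (simp add: field_simps)
  moreover have "\<theta> x = ?r 1 * jost1 k x" if x: "0 < x" for x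
  proof -
    have "jost k x * \<theta> x = jost k x * (?r 1 * jost1 k x)"
      using W[OF x] 1[OF x] by (metis mult.commute mult.left_commute)
    then show ?thesis using nz[OF x] by (metis mult_left_cancel)
  qed
  ultimately show ?thesis using that by blast
qed

end

end


section \<open>The m-function in terms of the Jost solution\<close>

text \<open>The expression defining the m-function, evaluated on Jost data. Unlike
  \<open>m_function\<close> it makes no reference to square integrability, so it is also meaningful
  for real \<open>k\<close> and provides the boundary values.\<close>

definition m_jost :: "real \<Rightarrow> complex \<Rightarrow> complex" where
  "m_jost \<alpha> k = (of_real (cos \<alpha>) * jost1 k 0 - of_real (sin \<alpha>) * jost k 0)
    / (of_real (sin \<alpha>) * jost1 k 0 + of_real (cos \<alpha>) * jost k 0)"

lemma L2_pos_Jost_solution: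
  assumes r: "0 < r" and k: "k \<in> upper r" and Im: "0 < Im k"
  shows "L2_pos (jost k)"
proof -
  obtain M where M: "0 \<le> M" "\<And>x. 0 < x \<Longrightarrow> norm (jost k x) \<le> M * exp (- Im k * x)"
      "\<And>x. 0 < x \<Longrightarrow> norm (jost1 k x) \<le> M * exp (- Im k * x)"
    using Jost_solution_decay[OF r k] by meson
  have bm: "jost k \<in> borel_measurable borel"
    by (rule borel_measurable_continuous_onI[OF Jost_solution_continuous(1)[OF r k]])
  have m: "set_borel_measurable lebesgue {0<..} f" if "f \<in> borel_measurable borel" for f :: "real \<Rightarrow> 'b::{real_normed_vector,second_countable_topology}"
  proof -
    have "(\<lambda>x. indicat_real {0<..} x *\<^sub>R f x) \<in> borel_measurable lborel" using that by measurable
    then show ?thesis unfolding set_borel_measurable_def by (rule measurable_completion)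
  qed
  have "(\<lambda>x. exp (- (2 * Im k) * x)) integrable_on {0..}"
    using has_integral_exp_minus_to_infinity[of "2 * Im k" 0] Im by (auto simp: integrable_on_def)
  then have "set_integrable lebesgue {0..} (\<lambda>x. exp (- (2 * Im k) * x))"
    by (rule nonnegative_absolutely_integrable_1) simp
  then have "set_integrable lebesgue {0<..} (\<lambda>x. exp (- (2 * Im k) * x))"
    by (rule set_integrable_subset) auto
  then have "set_integrable lebesgue {0<..} (\<lambda>x. M\<^sup>2 * exp (- (2 * Im k) * x))" by simp
  then have "set_integrable lebesgue {0<..} (\<lambda>x. (norm (jost k x))\<^sup>2)"
  proof (rule set_integrable_bound)
    show "set_borel_measurable lebesgue {0<..} (\<lambda>x. (norm (jost k x))\<^sup>2)"
      by (rule m) (use bm in measurable)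
    have "norm ((norm (jost k x))\<^sup>2) \<le> norm (M\<^sup>2 * exp (- (2 * Im k) * x))" if "0 < x" for x
    proof -
      have "(norm (jost k x))\<^sup>2 \<le> (M * exp (- Im k * x))\<^sup>2"
        by (rule power_mono[OF M(2)[OF that]]) simp
      also have "\<dots> = M\<^sup>2 * exp (- (2 * Im k) * x)"
        by (simp add: power_mult_distrib flip: exp_double)
      finally show ?thesis by simp
    qed
    then show "AE x in lebesgue. x \<in> {0<..} \<longrightarrow> norm ((norm (jost k x))\<^sup>2) \<le> norm (M\<^sup>2 * exp (- (2 * Im k) * x))"
      by (intro AE_I2) auto
  qed
  then show ?thesis unfolding L2_pos_def using m[OF bm] by simp
qed

text \<open>The Jost solution witnesses that the choice in \<open>weyl_solution\<close> is not
  vacuous; whatever function is chosen is a nonzero multiple of it, and the multiple cancels in the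
  quotient.\<close>

lemma m_function_eq:
  assumes r: "0 < r" and k: "k \<in> upper r" and Re: "0 < Re k" and Im: "0 < Im k"
    and s: "AE x in lebesgue. 0 < x \<longrightarrow> s x = \<sigma> x" and q: "AE x in lebesgue. 0 < x \<longrightarrow> q x = (\<sigma> x)\<^sup>2 - \<tau> x"
    and sq: "\<And>a. 0 < a \<Longrightarrow> (\<lambda>x. (s x)\<^sup>2) integrable_on {a..a+1}"
      "\<And>a. 0 < a \<Longrightarrow> integral {a..a+1} (\<lambda>x. (s x)\<^sup>2) \<le> S"
  shows "m_function \<sigma> \<tau> \<alpha> (k\<^sup>2) = m_jost \<alpha> k"
proof -
  have "is_weyl_solution \<sigma> \<tau> (k\<^sup>2) (jost k)"
  proof (rule weyl_solutionI)
    show "ac_deriv (jost k) (\<lambda>x. jost1 k x + of_real (\<sigma> x) * jost k x)"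
      by (rule ac_deriv_cong_AE[OF ac_deriv_jost[OF r k]]) (use s in eventually_elim, simp)
    show "ac_deriv (jost1 k) (\<lambda>x. - of_real (\<sigma> x) * jost1 k x - (of_real ((\<sigma> x)\<^sup>2 - \<tau> x) + k\<^sup>2) * jost k x)"
      by (rule ac_deriv_cong_AE[OF ac_deriv_jost1[OF r k]]) (use s q in eventually_elim, simp)
    show "\<exists>x>0. jost k x \<noteq> 0" using Jost_solution_nonzero[OF r k Re, of 1] by (intro exI[of _ 1]) simp
  qed (rule L2_pos_Jost_solution[OF r k Im])
  then have w: "is_weyl_solution \<sigma> \<tau> (k\<^sup>2) (weyl_solution \<sigma> \<tau> (k\<^sup>2))"
    unfolding weyl_solution_def by (rule someI[of "is_weyl_solution \<sigma> \<tau> (k\<^sup>2)"])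
  define \<psi> where "\<psi> = weyl_solution \<sigma> \<tau> (k\<^sup>2)"
  define \<theta> where "\<theta> = quasi_deriv \<sigma> \<psi>"
  have w: "is_weyl_solution \<sigma> \<tau> (k\<^sup>2) \<psi>" using w unfolding \<psi>_def .
  have 1: "ac_deriv \<psi> (\<lambda>x. \<theta> x + of_real (s x) * \<psi> x)"
    unfolding \<theta>_def by (rule ac_deriv_cong_AE[OF weyl_solution_system(1)[OF w]]) (use s in eventually_elim, simp)
  have 2: "ac_deriv \<theta> (\<lambda>x. - of_real (s x) * \<theta> x - (of_real (q x) + k\<^sup>2) * \<psi> x)"
    unfolding \<theta>_def by (rule ac_deriv_cong_AE[OF weyl_solution_system(2)[OF w]]) (use s q in eventually_elim, simp)
  have L2: "set_integrable lebesgue {0<..} (\<lambda>x. (norm (\<psi> x))\<^sup>2)"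
    using w unfolding is_weyl_solution_def L2_pos_def by simp
  obtain c where c: "\<And>x. 0 < x \<Longrightarrow> \<psi> x = c * jost k x" "\<And>x. 0 < x \<Longrightarrow> \<theta> x = c * jost1 k x"
    using L2_solution_multiple[OF r k Re Im 1 2 L2 sq] by blast
  have "\<exists>x>0. \<psi> x \<noteq> 0" using w unfolding is_weyl_solution_def by simp
  then have c0: "c \<noteq> 0" using c(1) by auto
  \<comment> \<open>Only values on the half line enter the limit of \<open>f\<close>, while
    \<open>g\<close> is continuous across \<open>0\<close>; thus both right limits exist and are
    values of the Jost data.\<close>
  have lim: "Lim (at_right 0) f = c * g 0" if fg: "\<And>x. 0 < x \<Longrightarrow> f x = c * g x" and g: "continuous_on UNIV g"
    for f g :: "real \<Rightarrow> complex"
  proof (rule tendsto_Lim)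
    have "isCont g 0" using g by (simp add: continuous_on_eq_continuous_at)
    then have "(g \<longlongrightarrow> g 0) (at_right 0)" by (simp add: isCont_def filterlim_at_split)
    then have "((\<lambda>x. c * g x) \<longlongrightarrow> c * g 0) (at_right 0)" by (intro tendsto_intros)
    moreover have "\<forall>\<^sub>F x in at_right 0. c * g x = f x"
      using fg by (auto simp: eventually_at_right_field intro: exI[of _ 1])
    ultimately show "(f \<longlongrightarrow> c * g 0) (at_right 0)" by (rule Lim_transform_eventually)
  qed simp
  have L: "Lim (at_right 0) \<psi> = c * jost k 0" "Lim (at_right 0) \<theta> = c * jost1 k 0"
    by (rule lim, erule c, rule Jost_solution_continuous[OF r k])+
  have "m_function \<sigma> \<tau> \<alpha> (k\<^sup>2) = (of_real (cos \<alpha>) * (c * jost1 k 0) - of_real (sin \<alpha>) * (c * jost k 0))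
      / (of_real (sin \<alpha>) * (c * jost1 k 0) + of_real (cos \<alpha>) * (c * jost k 0))"
    unfolding m_function_def Let_def \<psi>_def[symmetric] \<theta>_def[symmetric] L ..
  also have "\<dots> = (c * (of_real (cos \<alpha>) * jost1 k 0 - of_real (sin \<alpha>) * jost k 0))
      / (c * (of_real (sin \<alpha>) * jost1 k 0 + of_real (cos \<alpha>) * jost k 0))"
    by (simp add: algebra_simps)
  also have "\<dots> = m_jost \<alpha> k" using c0 unfolding m_jost_def by simp
  finally show ?thesis .
qed

context
  fixes r :: real and k :: complex
  assumes r: "0 < r" and k: "k \<in> upper r" and Re: "0 < Re k"
begin

text \<open>If it vanished, \<open>sin \<alpha>\<close> times
  \<open>cnj (jost k 0) * jost1 k 0\<close> would be real; the positive current forces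
  \<open>sin \<alpha> = 0\<close>, and then \<open>jost k 0 = 0\<close>, which the current excludes
  as well.\<close>

lemma m_jost_denominator_nonzero: "of_real (sin \<alpha>) * jost1 k 0 + of_real (cos \<alpha>) * jost k 0 \<noteq> 0"
proof
  assume 0: "of_real (sin \<alpha>) * jost1 k 0 + of_real (cos \<alpha>) * jost k 0 = 0"
  then have sv: "of_real (sin \<alpha>) * jost1 k 0 = - (of_real (cos \<alpha>) * jost k 0)"
    by (simp add: eq_neg_iff_add_eq_0)
  have "of_real (sin \<alpha>) * (cnj (jost k 0) * jost1 k 0) = cnj (jost k 0) * (of_real (sin \<alpha>) * jost1 k 0)" by simp
  also have "\<dots> = - of_real (cos \<alpha>) * (jost k 0 * cnj (jost k 0))"
    unfolding sv by (simp add: algebra_simps)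
  also have "\<dots> = of_real (- cos \<alpha> * (norm (jost k 0))\<^sup>2)"
    by (simp only: of_real_mult of_real_minus complex_norm_square)
  finally have "Im (of_real (sin \<alpha>) * (cnj (jost k 0) * jost1 k 0)) = 0" by (simp only: Im_complex_of_real)
  then have "sin \<alpha> * Im (cnj (jost k 0) * jost1 k 0) = 0" by simp
  then have s: "sin \<alpha> = 0" using Jost_current_pos[OF r k Re, of 0] by simp
  then have "cos \<alpha> \<noteq> 0" by (metis sin_zero_norm_cos_one norm_zero zero_neq_one)
  then show False using 0 s Jost_solution_nonzero[OF r k Re, of 0] by simp
qed

text \<open>Numerator and denominator arise from the boundary data by the rotation through
  \<open>\<alpha>\<close>, and a real matrix of determinant 1 preserves the current.\<close>

lemma Im_m_jost_pos: "0 < Im (m_jost \<alpha> k)"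
proof -
  let ?u = "jost k 0" and ?v = "jost1 k 0" and ?c = "cos \<alpha>" and ?s = "sin \<alpha>"
  let ?d = "of_real ?s * ?v + of_real ?c * ?u"
  have "m_jost \<alpha> k = (of_real ?c * ?v - of_real ?s * ?u) * cnj ?d / of_real ((norm ?d)\<^sup>2)"
    unfolding m_jost_def complex_norm_square
    by (rule mult_divide_mult_cancel_right[symmetric]) (simp only: complex_cnj_zero_iff m_jost_denominator_nonzero not_False_eq_True)
  then have "Im (m_jost \<alpha> k) = Im ((of_real ?c * ?v - of_real ?s * ?u) * cnj ?d) / (norm ?d)\<^sup>2"
    by (simp only: Im_divide_of_real)
  also have "Im ((of_real ?c * ?v - of_real ?s * ?u) * cnj ?d) = (?c\<^sup>2 + ?s\<^sup>2) * Im (cnj ?u * ?v)"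
  proof -
    have "Im ((of_real c * v - of_real s * u) * cnj (of_real s * v + of_real c * u)) = (c\<^sup>2 + s\<^sup>2) * Im (cnj u * v)"
      for c s :: real and u v by (simp add: algebra_simps power2_eq_square)
    then show ?thesis .
  qed
  finally show ?thesis using Jost_current_pos[OF r k Re, of 0] m_jost_denominator_nonzero[of \<alpha>] by simp
qed

end

lemma continuous_on_m_jost:
  assumes r: "0 < r"
  shows "continuous_on (upper r \<inter> {k. 0 < Re k}) (m_jost \<alpha>)"
proof -
  have c: "continuous_on (upper r \<inter> {k. 0 < Re k}) (\<lambda>k. jost k 0)" "continuous_on (upper r \<inter> {k. 0 < Re k}) (\<lambda>k. jost1 k 0)"
    using continuous_on_subset[OF Jost_solution_continuous_in_k(1)[OF r]]
      continuous_on_subset[OF Jost_solution_continuous_in_k(2)[OF r]] by auto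
  show ?thesis
    unfolding m_jost_def by (intro continuous_intros c) (use m_jost_denominator_nonzero[OF r] in auto)
qed

text \<open>Uses the energy \<open>t + ie\<close> as variable. For \<open>t > 0\<close> and
  \<open>e \<ge> 0\<close> the principal root has positive real part and lies in the closed upper
  half plane; \<open>e = 0\<close> gives the boundary value.\<close>

definition Im_m :: "real \<Rightarrow> real \<Rightarrow> real \<Rightarrow> real" where
  "Im_m \<alpha> t e = Im (m_jost \<alpha> (csqrt (Complex t e)))"

lemma csqrt_upper:
  assumes "0 < a" "a \<le> t" "0 \<le> e"
  shows "csqrt (Complex t e) \<in> upper (sqrt a)" "0 < Re (csqrt (Complex t e))" "0 < e \<Longrightarrow> 0 < Im (csqrt (Complex t e))"
proof -
  have n: "t \<le> norm (Complex t e)" using complex_Re_le_cmod[of "Complex t e"] by simp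
  have "norm (csqrt (Complex t e)) = sqrt (norm (Complex t e))"
    using norm_power[of "csqrt (Complex t e)" 2] by (simp add: real_sqrt_unique)
  then have "sqrt a \<le> norm (csqrt (Complex t e))" using n assms by simp
  moreover have "0 \<le> Im (csqrt (Complex t e))" using assms n by (auto simp: sgn_if)
  ultimately show "csqrt (Complex t e) \<in> upper (sqrt a)" unfolding upper_def by simp
  show "0 < Re (csqrt (Complex t e))" using n assms by simp
  show "0 < Im (csqrt (Complex t e))" if e: "0 < e"
  proof -
    have "t < norm (Complex t e)" using assms e by (simp add: cmod_def real_less_rsqrt)
    then show ?thesis using e by simp
  qed
qed

text \<open>Continuity is joint and includes \<open>e = 0\<close>. The bound
  \<open>a \<le> t\<close> avoids the cut of the root and keeps \<open>k\<close> at distance at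
  least \<open>sqrt a\<close> from \<open>0\<close>.\<close>

lemma continuous_on_Im_m:
  assumes a: "0 < a"
  shows "continuous_on ({0..} \<times> {a..}) (\<lambda>(e, t). Im_m \<alpha> t e)"
proof -
  have cs: "continuous_on ({0..} \<times> {a..}) (\<lambda>et :: real \<times> real. csqrt (Complex (snd et) (fst et)))"
  proof (rule continuous_on_compose2[of "- \<real>\<^sub>\<le>\<^sub>0" csqrt])
    show "continuous_on (- \<real>\<^sub>\<le>\<^sub>0) csqrt" by (rule continuous_on_csqrt)
    show "continuous_on ({0..} \<times> {a..}) (\<lambda>et. Complex (snd et) (fst et))"
      unfolding Complex_eq by (intro continuous_intros)
    show "(\<lambda>et. Complex (snd et) (fst et)) ` ({0..} \<times> {a..}) \<subseteq> - \<real>\<^sub>\<le>\<^sub>0"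
      using a by (auto simp: complex_nonpos_Reals_iff)
  qed
  have "continuous_on ({0..} \<times> {a..}) (\<lambda>et. m_jost \<alpha> (csqrt (Complex (snd et) (fst et))))"
    by (rule continuous_on_compose2[OF continuous_on_m_jost cs, of "sqrt a"]) (use csqrt_upper[OF a] a in auto)
  then show ?thesis unfolding Im_m_def split_beta by (intro continuous_intros)
qed

lemma Im_m_pos: "0 < t \<Longrightarrow> 0 < Im_m \<alpha> t 0"
  unfolding Im_m_def using Im_m_jost_pos[of "sqrt t" "csqrt (Complex t 0)"] csqrt_upper[of t t 0] by auto

end

section \<open>The spectral measure\<close>

text \<open>Only intervals at positive distance from \<open>0\<close> can be compared directly,
  since nothing is known about the density near \<open>0\<close>. Intervals starting at
  \<open>0\<close> follow by continuity from below, and finiteness there allows the generator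
  argument.\<close>

lemma measure_eq_of_Ioc_pos:
  fixes M N :: "real measure"
  assumes sM: "sets M = sets borel" and sN: "sets N = sets borel"
    and M0: "emeasure M {..0} = 0" and N0: "emeasure N {..0} = 0"
    and eq: "\<And>a b. 0 < a \<Longrightarrow> a < b \<Longrightarrow> emeasure M {a<..b} = emeasure N {a<..b}"
    and fin: "\<And>b. emeasure M {0<..b} < \<infinity>"
  shows "M = N"
proof -
  have half: "emeasure M {0<..b} = emeasure N {0<..b}" for b
  proof (cases "0 < b")
    case b: True
    \<comment> \<open>\<open>n + 2\<close> makes the left endpoint smaller than \<open>b\<close>
      already at \<open>n = 0\<close>, as \<open>eq\<close> requires.\<close>
    define A where "A n = {b / real (n + 2)<..b}" for n
    have inc: "incseq A"
      unfolding A_def incseq_def using b by (auto intro!: divide_left_mono elim!: le_less_trans[rotated])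
    have UA: "(\<Union>n. A n) = {0<..b}"
    proof (intro set_eqI iffI)
      fix x assume "x \<in> (\<Union>n. A n)"
      then obtain n where "b / real (n + 2) < x" "x \<le> b" unfolding A_def by auto
      moreover have "0 < b / real (n + 2)" using b by simp
      ultimately show "x \<in> {0<..b}" by auto
    next
      fix x assume x: "x \<in> {0<..b}"
      obtain n where "b / x < real n" using reals_Archimedean2 by blast
      then have "b / x < real (n + 2)" by simp
      then have "b / real (n + 2) < x" using x b by (simp add: field_simps)
      then show "x \<in> (\<Union>n. A n)" using x unfolding A_def by auto
    qed
    have "(\<lambda>n. emeasure M (A n)) \<longlonglongrightarrow> emeasure M {0<..b}" "(\<lambda>n. emeasure N (A n)) \<longlonglongrightarrow> emeasure N {0<..b}"
      unfolding UA[symmetric]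
      by (rule Lim_emeasure_incseq[OF _ inc], simp add: A_def sM sN image_subset_iff)+
    moreover have "emeasure M (A n) = emeasure N (A n)" for n
      unfolding A_def by (rule eq) (use b in \<open>auto simp: field_simps intro: add_pos_nonneg\<close>)
    ultimately show ?thesis using LIMSEQ_unique by simp
  qed simp
  \<comment> \<open>A measure that does not charge \<open>{..0}\<close> sees only the positive part
    of an interval.\<close>
  have cut: "emeasure L {a<..b} = emeasure L {max a 0<..b}"
    if "sets L = sets borel" "emeasure L {..0} = 0" for L :: "real measure" and a b
  proof (rule emeasure_eq_AE)
    have "{..0} \<in> null_sets L" using that by (simp add: null_sets_def)
    then have "AE x in L. x \<notin> {..0}" by (rule AE_not_in)
    then show "AE x in L. x \<in> {a<..b} \<longleftrightarrow> x \<in> {max a 0<..b}" by eventually_elim auto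
  qed (use that in auto)
  have ab: "emeasure M {a<..b} = emeasure N {a<..b}" for a b
  proof -
    have "emeasure M {max a 0<..b} = emeasure N {max a 0<..b}"
    proof (cases "0 < a \<and> a < b")
      case True
      then show ?thesis using eq[of a b] by simp
    next
      case False
      then show ?thesis using half[of b] by (cases "0 < a") auto
    qed
    then show ?thesis unfolding cut[OF sM M0, of a b] cut[OF sN N0, of a b] .
  qed
  show ?thesis
  proof (rule measure_eqI_generator_eq[where E="range (\<lambda>(a, b). {a<..b::real})" and \<Omega>=UNIV and A="\<lambda>n. {- real n<..real n}"])
    show "Int_stable (range (\<lambda>(a, b). {a<..b::real}))"
    proof (rule Int_stableI)
      fix X Y :: "real set" assume "X \<in> range (\<lambda>(a, b). {a<..b})" "Y \<in> range (\<lambda>(a, b). {a<..b})"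
      then obtain a b c d where "X = {a<..b}" "Y = {c<..d}" by auto
      then have "X \<inter> Y = (\<lambda>(a, b). {a<..b}) (max a c, min b d)" by auto
      then show "X \<inter> Y \<in> range (\<lambda>(a, b). {a<..b})" by blast
    qed
    show "emeasure M X = emeasure N X" if "X \<in> range (\<lambda>(a, b). {a<..b})" for X using that ab by auto
    show "sets M = sigma_sets UNIV (range (\<lambda>(a, b). {a<..b}))" "sets N = sigma_sets UNIV (range (\<lambda>(a, b). {a<..b}))"
      unfolding sM sN borel_sigma_sets_Ioc by simp_all
    show "range (\<lambda>n. {- real n<..real n}) \<subseteq> range (\<lambda>(a, b). {a<..b})"
      by (auto intro!: image_eqI[where x="(- real _, real _)"])
    show "(\<Union>n. {- real n<..real n}) = UNIV"
    proof (intro set_eqI iffI UNIV_I)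
      fix x :: real
      obtain n where "\<bar>x\<bar> < real n" using reals_Archimedean2 by blast
      then show "x \<in> (\<Union>n. {- real n<..real n})" by (intro UN_I[of n]) auto
    qed
    show "emeasure M {- real n<..real n} \<noteq> \<infinity>" for n
      using fin[of "real n"] unfolding cut[OF sM M0, of "- real n" "real n"] by simp
  qed auto
qed

context short_range
begin

lemma continuous_on_Im_m_0: "continuous_on {0<..} (\<lambda>t. Im_m \<alpha> t 0)"
  unfolding continuous_on_eq_continuous_at[OF open_greaterThan]
proof
  fix x :: real assume "x \<in> {0<..}"
  then have x: "0 < x / 2" "x / 2 < x" by auto
  have "continuous_on {x/2<..} ((\<lambda>(e, t). Im_m \<alpha> t e) \<circ> (\<lambda>t. (0, t)))"
    by (intro continuous_on_compose continuous_intros continuous_on_subset[OF continuous_on_Im_m[OF x(1)]]) auto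
  then have "continuous_on {x/2<..} (\<lambda>t. Im_m \<alpha> t 0)" by (simp add: o_def)
  then show "isCont (\<lambda>t. Im_m \<alpha> t 0) x"
    by (metis continuous_on_eq_continuous_at greaterThan_iff open_greaterThan x(2))
qed

context
  fixes \<sigma> \<tau> :: "real \<Rightarrow> real" and S :: real
  assumes s\<sigma>: "AE x in lebesgue. 0 < x \<longrightarrow> s x = \<sigma> x" and q\<tau>: "AE x in lebesgue. 0 < x \<longrightarrow> q x = (\<sigma> x)\<^sup>2 - \<tau> x"
    and sq: "\<And>a. 0 < a \<Longrightarrow> (\<lambda>x. (s x)\<^sup>2) integrable_on {a..a+1}"
      "\<And>a. 0 < a \<Longrightarrow> integral {a..a+1} (\<lambda>x. (s x)\<^sup>2) \<le> S"
begin

lemma Im_m_function_eq: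
  assumes "0 < t" "0 < e"
  shows "Im (m_function \<sigma> \<tau> \<alpha> (Complex t e)) = Im_m \<alpha> t e"
proof -
  have "m_function \<sigma> \<tau> \<alpha> ((csqrt (Complex t e))\<^sup>2) = m_jost \<alpha> (csqrt (Complex t e))"
    by (rule m_function_eq[OF _ csqrt_upper(1)[of t t e] csqrt_upper(2)[of t t e] csqrt_upper(3)[of t t e] s\<sigma> q\<tau> sq])
      (use assms in auto)
  then show ?thesis unfolding Im_m_def by simp
qed

text \<open>Joint continuity on a compact interval of energies, down to \<open>e = 0\<close>, lets
  the limit pass under the integral. The m-function agrees with \<open>Im_m\<close> only for
  \<open>e > 0\<close>, which is enough for a right limit.\<close>

lemma m_function_boundary_limit:
  assumes a: "0 < a"
  shows "((\<lambda>e. LINT t:{a..b}|lborel. Im (m_function \<sigma> \<tau> \<alpha> (Complex t e)))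
    \<longlongrightarrow> integral {a..b} (\<lambda>t. Im_m \<alpha> t 0)) (at_right 0)"
proof -
  have "continuous_on ({0..} \<times> {a..b}) (\<lambda>(e, t). Im_m \<alpha> t e)"
    by (rule continuous_on_subset[OF continuous_on_Im_m[OF a]]) auto
  then have "continuous_on {0..} (\<lambda>e. integral (cbox a b) (\<lambda>t. Im_m \<alpha> t e))"
    by (intro integral_continuous_on_param) simp
  then have "((\<lambda>e. integral {a..b} (\<lambda>t. Im_m \<alpha> t e)) \<longlongrightarrow> integral {a..b} (\<lambda>t. Im_m \<alpha> t 0)) (at 0 within {0..})"
    by (simp add: continuous_on_def)
  then have "((\<lambda>e. integral {a..b} (\<lambda>t. Im_m \<alpha> t e)) \<longlongrightarrow> integral {a..b} (\<lambda>t. Im_m \<alpha> t 0)) (at_right 0)"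
    by (rule tendsto_within_subset) auto
  moreover have "\<forall>\<^sub>F e in at_right 0. integral {a..b} (\<lambda>t. Im_m \<alpha> t e) = (LINT t:{a..b}|lborel. Im (m_function \<sigma> \<tau> \<alpha> (Complex t e)))"
    unfolding eventually_at_right_field
  proof (intro exI[of _ 1] conjI allI impI)
    fix e :: real assume "0 < e" "e < 1"
    have "continuous_on {a..b} ((\<lambda>(e, t). Im_m \<alpha> t e) \<circ> (\<lambda>t. (e, t)))"
      by (intro continuous_on_compose continuous_intros continuous_on_subset[OF continuous_on_Im_m[OF a]])
        (use \<open>0 < e\<close> in auto)
    then have si: "set_integrable lborel {a..b} (\<lambda>t. Im_m \<alpha> t e)"
      by (intro borel_integrable_atLeastAtMost') (simp add: o_def)
    have "(LINT t:{a..b}|lborel. Im (m_function \<sigma> \<tau> \<alpha> (Complex t e))) = (LINT t:{a..b}|lborel. Im_m \<alpha> t e)"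
      by (rule set_lebesgue_integral_cong) (use a \<open>0 < e\<close> Im_m_function_eq in auto)
    then show "integral {a..b} (\<lambda>t. Im_m \<alpha> t e) = (LINT t:{a..b}|lborel. Im (m_function \<sigma> \<tau> \<alpha> (Complex t e)))"
      using set_borel_integral_eq_integral(2)[OF si] by simp
  qed simp
  ultimately show ?thesis by (rule Lim_transform_eventually)
qed

text \<open>The inner limit is an increment of the indefinite integral of the boundary value; that
  integral is continuous, so the shift by \<open>\<delta>\<close> disappears in the outer
  limit.\<close>

lemma spectral_measure_Ioc:
  assumes \<mu>: "is_spectral_measure \<sigma> \<tau> \<alpha> \<mu>" and a: "0 < a" and ab: "a < b"
  shows "measure \<mu> {a<..b} = 1 / pi * integral {a..b} (\<lambda>t. Im_m \<alpha> t 0)"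
proof -
  obtain G where G: "\<forall>\<^sub>F \<delta> in at_right 0.
      ((\<lambda>e. 1 / pi * (LINT t:{a+\<delta>..b+\<delta>}|lborel. Im (m_function \<sigma> \<tau> \<alpha> (Complex t e)))) \<longlongrightarrow> G \<delta>) (at_right 0)"
    "(G \<longlongrightarrow> measure \<mu> {a<..b}) (at_right 0)"
    using \<mu> ab unfolding is_spectral_measure_def by blast
  let ?w = "\<lambda>t. Im_m \<alpha> t 0"
  \<comment> \<open>Anchored at \<open>a\<close>, so that for small positive shifts both endpoints
    lie in its interval of continuity \<open>{a..b+1}\<close>.\<close>
  let ?I = "\<lambda>x. integral {a..x} ?w"
  have wi: "?w integrable_on {x..y}" if "0 < x" for x y
    by (rule integrable_continuous_real[OF continuous_on_subset[OF continuous_on_Im_m_0]]) (use that in auto)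
  have "\<forall>\<^sub>F \<delta> in at_right 0. G \<delta> = 1 / pi * (?I (b + \<delta>) - ?I (a + \<delta>))"
    using G(1) eventually_at_right_less[of "0::real"]
  proof eventually_elim
    case (elim \<delta>)
    have "((\<lambda>e. 1 / pi * (LINT t:{a+\<delta>..b+\<delta>}|lborel. Im (m_function \<sigma> \<tau> \<alpha> (Complex t e))))
        \<longlongrightarrow> 1 / pi * integral {a+\<delta>..b+\<delta>} ?w) (at_right 0)"
      by (intro tendsto_intros m_function_boundary_limit) (use a elim in simp)
    then have "G \<delta> = 1 / pi * integral {a+\<delta>..b+\<delta>} ?w"
      using tendsto_unique[OF _ elim(1)] by simp
    moreover have "?I (a + \<delta>) + integral {a+\<delta>..b+\<delta>} ?w = ?I (b + \<delta>)"
      by (rule Henstock_Kurzweil_Integration.integral_combine) (use elim ab wi[OF a] in auto)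
    ultimately show ?case by simp
  qed
  moreover have "((\<lambda>\<delta>. 1 / pi * (?I (b + \<delta>) - ?I (a + \<delta>))) \<longlongrightarrow> 1 / pi * (?I b - ?I a)) (at_right 0)"
  proof -
    have I: "continuous_on {a..b+1} ?I" by (rule indefinite_integral_continuous_1[OF wi[OF a]])
    have lim: "((\<lambda>\<delta>. ?I (x + \<delta>)) \<longlongrightarrow> ?I x) (at_right 0)" if x: "a \<le> x" "x \<le> b" for x
    proof -
      have "continuous_on {0..1} (\<lambda>\<delta>. ?I (x + \<delta>))"
        by (rule continuous_on_compose2[OF I]) (use x in \<open>auto intro!: continuous_intros\<close>)
      then have "((\<lambda>\<delta>. ?I (x + \<delta>)) \<longlongrightarrow> ?I (x + 0)) (at 0 within {0..1})"
        unfolding continuous_on_def by (rule bspec) simp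
      then show ?thesis by (simp add: at_within_Icc_at_right)
    qed
    show ?thesis by (intro tendsto_intros lim) (use ab in auto)
  qed
  ultimately have "(G \<longlongrightarrow> 1 / pi * (?I b - ?I a)) (at_right 0)"
    by (subst tendsto_cong)
  from tendsto_unique[OF _ G(2) this] show ?thesis by simp
qed

text \<open>Both sides are carried by the open half line and give the same mass to every
  \<open>{a<..b}\<close> with \<open>a > 0\<close>, which determines them.\<close>

lemma spectral_measure_density:
  assumes \<mu>: "is_spectral_measure \<sigma> \<tau> \<alpha> \<mu>"
  shows "density \<mu> (indicator {0<..}) = density lborel (\<lambda>E. indicator {0<..} E * ennreal (1 / pi * Im_m \<alpha> E 0))"
proof -
  let ?w = "\<lambda>t. 1 / pi * Im_m \<alpha> t 0"
  let ?M = "density \<mu> (indicator {0<..})" and ?N = "density lborel (\<lambda>E. indicator {0<..} E * ennreal (?w E))"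
  have s\<mu>: "sets \<mu> = sets borel" using \<mu> unfolding is_spectral_measure_def by simp
  have fin: "emeasure \<mu> {a<..b} < \<infinity>" if "a < b" for a b using \<mu> that unfolding is_spectral_measure_def by blast
  have wc: "continuous_on {0<..} ?w" by (intro continuous_intros continuous_on_Im_m_0)
  have wm: "(\<lambda>E. indicator {0<..} E *\<^sub>R ?w E) \<in> borel_measurable borel"
    by (rule borel_measurable_continuous_on_indicator[OF _ wc]) simp
  have eq: "indicator {0<..} E * ennreal (?w E) = ennreal (indicator {0<..} E *\<^sub>R ?w E)" for E :: real
    by (auto simp: indicator_def)
  have dm: "(\<lambda>E. indicator {0<..} E * ennreal (?w E)) \<in> borel_measurable borel"
    unfolding eq using wm by measurable
  have im: "indicator {0<..} \<in> borel_measurable \<mu>" by (rule borel_measurable_indicator) (simp add: s\<mu>)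
  have eM: "emeasure ?M A = emeasure \<mu> ({0<..} \<inter> A)" if "A \<in> sets borel" for A
    using that by (subst emeasure_density[OF im]) (auto simp: s\<mu> indicator_inter_arith[symmetric] intro!: nn_integral_indicator)
  show ?thesis
  proof (rule measure_eq_of_Ioc_pos)
    show "sets ?M = sets borel" "sets ?N = sets borel" by (simp_all add: s\<mu>)
    have "{0<..} \<inter> {..0} = ({} :: real set)" by auto
    then show "emeasure ?M {..0} = 0" using eM[of "{..0}"] by simp
    have "(\<integral>\<^sup>+E. indicator {0<..} E * ennreal (?w E) * indicator {..0} E \<partial>lborel) = integral\<^sup>N lborel (\<lambda>E::real. 0)"
      by (rule nn_integral_cong) (auto simp: indicator_def)
    then show "emeasure ?N {..0} = 0" using dm by (subst emeasure_density) auto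
    show "emeasure ?M {0<..b} < \<infinity>" for b
    proof -
      have "{0<..} \<inter> {0<..b} = {0<..b}" by auto
      then show ?thesis using eM[of "{0<..b}"] fin[of 0 b] by (cases "0 < b") auto
    qed
    fix a b :: real assume a: "0 < a" and ab: "a < b"
    have "{0<..} \<inter> {a<..b} = {a<..b}" using a by auto
    then have "emeasure ?M {a<..b} = ennreal (measure \<mu> {a<..b})"
      using eM[of "{a<..b}"] fin[OF ab] by (simp add: emeasure_eq_ennreal_measure less_top)
    also have "\<dots> = ennreal (integral {a..b} ?w)"
      unfolding spectral_measure_Ioc[OF \<mu> a ab] by simp
    also have "\<dots> = emeasure ?N {a<..b}"
    proof -
      have si: "set_integrable lborel {a..b} ?w"
        by (rule borel_integrable_atLeastAtMost'[OF continuous_on_subset[OF wc]]) (use a in auto)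
      have "emeasure ?N {a<..b} = (\<integral>\<^sup>+E. indicator {0<..} E * ennreal (?w E) * indicator {a<..b} E \<partial>lborel)"
        using dm by (subst emeasure_density) auto
      \<comment> \<open>The half-open interval is closed at the null point \<open>a\<close>;
        positivity of \<open>a\<close> absorbs the indicator of the half line.\<close>
      also have "\<dots> = (\<integral>\<^sup>+E. ennreal (indicator {a..b} E *\<^sub>R ?w E) \<partial>lborel)"
        by (rule nn_integral_cong_AE, use AE_lborel_singleton[of a] in eventually_elim) (use a in \<open>auto simp: indicator_def\<close>)
      also have "\<dots> = ennreal (LINT E|lborel. indicator {a..b} E *\<^sub>R ?w E)"
        by (rule nn_integral_eq_integral) (use si Im_m_pos a in \<open>auto simp: set_integrable_def indicator_def intro!: AE_I2 less_imp_le\<close>)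
      also have "(LINT E|lborel. indicator {a..b} E *\<^sub>R ?w E) = integral {a..b} ?w"
        using set_borel_integral_eq_integral(2)[OF si] unfolding set_lebesgue_integral_def .
      finally show ?thesis by simp
    qed
    finally show "emeasure ?M {a<..b} = emeasure ?N {a<..b}" .
  qed
qed

end

end


theorem theorem1p10:
  fixes \<sigma> \<tau> :: "real \<Rightarrow> real" and \<alpha> :: real and \<mu> :: "real measure"
  assumes "(SUP x\<in>{0<..}. \<integral>\<^sup>+t\<in>{x..x+1}. ennreal ((\<sigma> t)\<^sup>2) \<partial>lebesgue) < \<infinity>"
    and "(SUP x\<in>{0<..}. \<integral>\<^sup>+t\<in>{x..x+1}. ennreal \<bar>\<tau> t\<bar> \<partial>lebesgue) < \<infinity>"
    and "set_integrable lebesgue {0<..} \<sigma>"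
    and "set_integrable lebesgue {0<..} (\<lambda>x. (\<sigma> x)\<^sup>2 - \<tau> x)"
    and "0 \<le> \<alpha>" and "\<alpha> < pi"
    and "is_spectral_measure \<sigma> \<tau> \<alpha> \<mu>"
  shows "(\<exists>w. continuous_on {0<..} w \<and> (\<forall>E>0. 0 < w E) \<and>
            density \<mu> (indicator {0<..}) = density lborel (\<lambda>E. indicator {0<..} E * ennreal (w E)))
       \<and> absolutely_continuous (restrict_space lborel {0<..}) (restrict_space \<mu> {0<..})"
proof -
  \<comment> \<open>Passing to representatives leaves \<open>m_function\<close> as it is; the link
    is made in \<open>m_function_eq\<close> through the almost everywhere equalities.\<close>
  obtain s where hs: "integrable lborel s" "\<And>x. x \<le> 0 \<Longrightarrow> s x = 0" "AE x in lebesgue. 0 < x \<longrightarrow> s x = \<sigma> x"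
    using borel_representative[OF assms(3)] by blast
  obtain q where hq: "integrable lborel q" "\<And>x. x \<le> 0 \<Longrightarrow> q x = 0" "AE x in lebesgue. 0 < x \<longrightarrow> q x = (\<sigma> x)\<^sup>2 - \<tau> x"
    using borel_representative[OF assms(4)] by blast
  interpret short_range s q by unfold_locales (use hs hq in auto)
  \<comment> \<open>The supremum is extended real; being finite, it is turned into a real bound by
    \<open>enn2real\<close> without loss.\<close>
  define S where "S = (SUP x\<in>{0<..}. \<integral>\<^sup>+t\<in>{x..x+1}. ennreal ((\<sigma> t)\<^sup>2) \<partial>lebesgue)"
  have S: "S < \<infinity>" unfolding S_def by (rule assms(1))
  have sq: "(\<lambda>x. (s x)\<^sup>2) integrable_on {a..a+1}" "integral {a..a+1} (\<lambda>x. (s x)\<^sup>2) \<le> enn2real S" if a: "0 < a" for a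
  proof -
    let ?f = "\<lambda>t. indicator {a..a+1} t *\<^sub>R (s t)\<^sup>2"
    have "(\<integral>\<^sup>+t. ennreal (?f t) \<partial>lebesgue) = (\<integral>\<^sup>+t\<in>{a..a+1}. ennreal ((\<sigma> t)\<^sup>2) \<partial>lebesgue)"
      by (rule nn_integral_cong_AE, use hs(3) in eventually_elim) (use a in \<open>auto simp: indicator_def\<close>)
    also have "\<dots> \<le> S" unfolding S_def by (rule SUP_upper) (use a in simp)
    finally have le: "(\<integral>\<^sup>+t. ennreal (?f t) \<partial>lebesgue) \<le> S" .
    have "?f \<in> borel_measurable lborel" by measurable
    then have m: "?f \<in> borel_measurable lebesgue" by (rule measurable_completion)
    have i: "integrable lebesgue ?f"
      by (rule integrableI_nonneg[OF m]) (use le S in \<open>auto simp: le_less_trans\<close>)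
    then have si: "set_integrable lebesgue {a..a+1} (\<lambda>x. (s x)\<^sup>2)" by (simp add: set_integrable_def)
    then show "(\<lambda>x. (s x)\<^sup>2) integrable_on {a..a+1}" by (rule set_lebesgue_integral_eq_integral(1))
    have "integral {a..a+1} (\<lambda>x. (s x)\<^sup>2) = integral\<^sup>L lebesgue ?f"
      using set_lebesgue_integral_eq_integral(2)[OF si] unfolding set_lebesgue_integral_def by simp
    also have "\<dots> = enn2real (\<integral>\<^sup>+t. ennreal (?f t) \<partial>lebesgue)"
      by (rule integral_eq_nn_integral[OF m]) simp
    also have "\<dots> \<le> enn2real S" by (rule enn2real_mono[OF le]) (use S in simp)
    finally show "integral {a..a+1} (\<lambda>x. (s x)\<^sup>2) \<le> enn2real S" .
  qed
  \<comment> \<open>The boundary value of the imaginary part of the m-function divided by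
    \<open>pi\<close>, as in the Stieltjes inversion formula.\<close>
  let ?w = "\<lambda>E. 1 / pi * Im_m \<alpha> E 0"
  have dens: "density \<mu> (indicator {0<..}) = density lborel (\<lambda>E. indicator {0<..} E * ennreal (?w E))"
    by (rule spectral_measure_density[OF hs(3) hq(3) sq assms(7)])
  have wc: "continuous_on {0<..} ?w" by (intro continuous_intros continuous_on_Im_m_0)
  have wp: "\<forall>E>0. 0 < ?w E" using Im_m_pos by simp
  have s\<mu>: "sets \<mu> = sets borel" using assms(7) unfolding is_spectral_measure_def by simp
  have "absolutely_continuous (restrict_space lborel {0<..}) (restrict_space \<mu> {0<..})"
    unfolding absolutely_continuous_def
  proof
    fix A assume "A \<in> null_sets (restrict_space lborel {0::real<..})"
    \<comment> \<open>A null set inside the half line has the same mass under \<open>\<mu>\<close>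
      and under the restricted density, so the density formula already gives absolute
      continuity.\<close>
    then have A: "A \<subseteq> {0<..}" "A \<in> null_sets lborel" by (auto simp: null_sets_restrict_space)
    then have AE: "AE x in lborel. x \<notin> A" by (intro AE_not_in)
    have Ab: "A \<in> sets borel" using A(2) by (auto simp: null_sets_def)
    have im: "indicator {0<..} \<in> borel_measurable \<mu>" by (rule borel_measurable_indicator) (simp add: s\<mu>)
    have "emeasure \<mu> A = integral\<^sup>N \<mu> (indicator A)" using Ab by (simp add: s\<mu>)
    also have "\<dots> = (\<integral>\<^sup>+x. indicator {0<..} x * indicator A x \<partial>\<mu>)"
      by (rule nn_integral_cong) (use A(1) in \<open>auto simp: indicator_def\<close>)
    also have "\<dots> = emeasure (density \<mu> (indicator {0<..})) A"
      using Ab by (subst emeasure_density[OF im]) (simp_all add: s\<mu>)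
    also have "\<dots> = (\<integral>\<^sup>+E. indicator {0<..} E * ennreal (?w E) * indicator A E \<partial>lborel)"
    proof -
      have "(\<lambda>E. indicator {0<..} E *\<^sub>R ?w E) \<in> borel_measurable borel"
        by (rule borel_measurable_continuous_on_indicator[OF _ wc]) simp
      then have "(\<lambda>E. ennreal (indicator {0<..} E *\<^sub>R ?w E)) \<in> borel_measurable borel" by measurable
      moreover have "ennreal (indicator {0<..} E *\<^sub>R ?w E) = indicator {0<..} E * ennreal (?w E)" for E :: real
        by (auto simp: indicator_def)
      ultimately have "(\<lambda>E. indicator {0<..} E * ennreal (?w E)) \<in> borel_measurable borel" by (simp only:)
      then show ?thesis unfolding dens using Ab by (subst emeasure_density) auto
    qed
    also have "\<dots> = integral\<^sup>N lborel (\<lambda>E::real. 0)"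
      by (rule nn_integral_cong_AE, use AE in eventually_elim) simp
    finally have "emeasure \<mu> A = 0" by simp
    then have "A \<in> null_sets \<mu>" using Ab by (simp add: null_sets_def s\<mu>)
    then show "A \<in> null_sets (restrict_space \<mu> {0<..})"
      using A(1) by (simp add: null_sets_restrict_space s\<mu>)
  qed
  with dens wc wp show ?thesis by blast
qed

end
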